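(* Let $k$ and $s$ be positive integers, and let $I_0(k,s)$ denote the set of indices $\mathbf{k}=(k_1,\ldots,k_r)$ (tuples of positive integers, $r\ge1$) with $k_1>1$, weight $k_1+\cdots+k_r=k$, and height $s$. Then the following identities hold in $\mathcal{A}$: \[ \sum_{\mathbf{k}\in I_0(k,s)} \zeta_{\mathcal{A}}^\star(\mathbf{k}) = 2\binom{k-1}{2s-1}(1-2^{1-k})Z(k), \] \[ \sum_{\mathbf{k}\in I_0(k,s)} (-1)^{\mathrm{dep}(\mathbf{k})}\zeta_{\mathcal{A}}(\mathbf{k}) = 2\binom{k-1}{2s-1}(1-2^{1-k})Z(k). \]
   Context: For an index $\mathbf{k}=(k_1,\ldots,k_r)$ of positive integers, its weight is $k_1+\cdots+k_r$, its depth $\mathrm{dep}(\mathbf{k})$ is $r$, and its height is the number of $i$ with $k_i>1$. Let $\mathcal{A}=\left(\prod_p \mathbb{Z}/p\mathbb{Z}\right)/\left(\bigoplus_p \mathbb{Z}/p\mathbb{Z}\right)$, where $p$ runs over all primes. The finite multiple zeta value $\zeta_{\mathcal{A}}(\mathbf{k})$ and finite multiple zeta-star value $\zeta_{\mathcal{A}}^\star(\mathbf{k})$ are the elements of $\mathcal{A}$ represented respectively by $\left(\sum_{p>m_1>\cdots>m_r>0} \frac{1}{m_1^{k_1}\cdots m_r^{k_r}} \bmod p\right)_p$ and $\left(\sum_{p>m_1\ge\cdots\ge m_r>0} \frac{1}{m_1^{k_1}\cdots m_r^{k_r}} \bmod p\right)_p$. For a positive integer $k$, $Z(k)\in\mathcal{A}$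 is the element represented by $\left(\frac{B_{p-k}}{k} \bmod p\right)_p$ (defined for all sufficiently large $p$), where $B_n$ denotes the $n$-th Bernoulli number. *)

theory Defs
  imports "HOL-Number_Theory.Number_Theory"
begin

section \<open>The ring \<open>\<A>\<close>\<close>

text \<open>
  A family \<open>f :: nat \<Rightarrow> int\<close> represents the element \<open>(f p mod p)\<^sub>p\<close> of the product of the
  \<open>\<int>/p\<int>\<close> over all primes \<open>p\<close>; its values at non-primes are irrelevant. Two families have
  the same image modulo the direct sum iff they agree mod \<open>p\<close> for all but finitely
  many primes \<open>p\<close>.
\<close>

definition fin_rel :: "(nat \<Rightarrow> int) \<Rightarrow> (nat \<Rightarrow> int) \<Rightarrow> bool" where
  "fin_rel f g \<longleftrightarrow> finite {p. prime p \<and> \<not> [f p = g p] (mod int p)}"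

lemma fin_rel_lift:
  assumes "fin_rel f f'" "fin_rel g g'"
    and "\<And>p. [f p = f' p] (mod int p) \<Longrightarrow> [g p = g' p] (mod int p) \<Longrightarrow> [h p = h' p] (mod int p)"
  shows "fin_rel h h'"
  unfolding fin_rel_def
proof (rule finite_subset)
  show "{p. prime p \<and> \<not> [h p = h' p] (mod int p)} \<subseteq>
    {p. prime p \<and> \<not> [f p = f' p] (mod int p)} \<union> {p. prime p \<and> \<not> [g p = g' p] (mod int p)}"
    using assms(3) by blast
qed (use assms(1,2) in \<open>simp add: fin_rel_def\<close>)

lemma equivp_fin_rel: "equivp fin_rel"
proof (rule equivpI)
  show "reflp fin_rel" by (simp add: reflp_def fin_rel_def)
  show "symp fin_rel" by (simp add: symp_def fin_rel_def cong_sym_eq)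
  show "transp fin_rel"
    by (rule transpI) (blast intro: fin_rel_lift cong_trans)
qed

quotient_type ring_A = "nat \<Rightarrow> int" / fin_rel
  by (rule equivp_fin_rel)

instantiation ring_A :: comm_ring_1
begin

lift_definition zero_ring_A :: ring_A is "\<lambda>p. 0" .

lift_definition one_ring_A :: ring_A is "\<lambda>p. 1" .

lift_definition plus_ring_A :: "ring_A \<Rightarrow> ring_A \<Rightarrow> ring_A" is "\<lambda>f g p. f p + g p"
  by (erule (1) fin_rel_lift) (rule cong_add)

lift_definition minus_ring_A :: "ring_A \<Rightarrow> ring_A \<Rightarrow> ring_A" is "\<lambda>f g p. f p - g p"
  by (erule (1) fin_rel_lift) (rule cong_diff)

lift_definition uminus_ring_A :: "ring_A \<Rightarrow> ring_A" is "\<lambda>f p. - f p"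
  by (rule fin_rel_lift) (auto simp: cong_minus_minus_iff)

lift_definition times_ring_A :: "ring_A \<Rightarrow> ring_A \<Rightarrow> ring_A" is "\<lambda>f g p. f p * g p"
  by (erule (1) fin_rel_lift) (rule cong_mult)

instance
proof
  fix a b c :: ring_A
  show "a + b + c = a + (b + c)" by transfer (simp add: fin_rel_def add.assoc)
  show "a + b = b + a" by transfer (simp add: fin_rel_def add.commute)
  show "0 + a = a" by transfer (simp add: fin_rel_def)
  show "- a + a = 0" by transfer (simp add: fin_rel_def)
  show "a - b = a + - b" by transfer (simp add: fin_rel_def)
  show "a * b * c = a * (b * c)" by transfer (simp add: fin_rel_def mult.assoc)
  show "a * b = b * a" by transfer (simp add: fin_rel_def mult.commute)
  show "1 * a = a" by transfer (simp add: fin_rel_def)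
  show "(a + b) * c = a * c + b * c" by transfer (simp add: fin_rel_def distrib_right)
  have "{p :: nat. prime p \<and> \<not> [0 = 1] (mod int p)} = {p. prime p}"
    by (auto simp: cong_def dest: prime_gt_1_nat)
  then show "(0 :: ring_A) \<noteq> 1"
    by transfer (simp add: fin_rel_def primes_infinite)
qed

end


section \<open>Families of rational numbers\<close>

text \<open>
  The residue mod \<open>p\<close> of a rational number with denominator prime to \<open>p\<close>. If \<open>p\<close> divides
  the denominator, the value is meaningless; the theory only uses families of rationals that
  are \<open>p\<close>-integral for all but finitely many primes \<open>p\<close>, with the one exception noted at
  \<open>Z_A\<close> below.
\<close>

definition rat_mod :: "rat \<Rightarrow> nat \<Rightarrow> int" where
  "rat_mod q p = (case quotient_of q of (a, b) \<Rightarrow> (a * modular_inverse (int p) b) mod int p)"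

definition of_rat_family :: "(nat \<Rightarrow> rat) \<Rightarrow> ring_A" where
  "of_rat_family q = abs_ring_A (\<lambda>p. rat_mod (q p) p)"

definition of_rat_A :: "rat \<Rightarrow> ring_A" where
  "of_rat_A q = of_rat_family (\<lambda>p. q)"


section \<open>Finite multiple zeta(-star) values and \<open>Z(k)\<close>\<close>

text \<open>An index is a nonempty list of positive integers; its weight is the sum of the list
  and its depth the length.\<close>

definition height :: "nat list \<Rightarrow> nat" where
  "height ks = card {i. i < length ks \<and> ks ! i > 1}"

definition I\<^sub>0 :: "nat \<Rightarrow> nat \<Rightarrow> nat list set" where
  "I\<^sub>0 k s = {ks. ks \<noteq> [] \<and> (\<forall>x\<in>set ks. x > 0) \<and> hd ks > 1 \<and> sum_list ks = k \<and> height ks = s}"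

lemma finite_I\<^sub>0: "finite (I\<^sub>0 k s)"
proof (rule finite_subset)
  show "I\<^sub>0 k s \<subseteq> {ks. set ks \<subseteq> {..k} \<and> length ks \<le> k}"
  proof clarify
    fix ks assume "ks \<in> I\<^sub>0 k s"
    then have pos: "\<forall>x\<in>set ks. x > 0" and k: "sum_list ks = k"
      by (auto simp: I\<^sub>0_def)
    from pos have "length ks \<le> sum_list ks"
      by (induction ks) auto
    then show "set ks \<subseteq> {..k} \<and> length ks \<le> k"
      using k member_le_sum_list by fastforce
  qed
qed (simp add: finite_lists_length_le)

definition zeta_sum :: "nat list \<Rightarrow> nat \<Rightarrow> rat" where
  "zeta_sum ks p =
    (\<Sum>ms | length ms = length ks \<and> set ms \<subseteq> {0<..<p} \<and> sorted_wrt (>) ms.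
       1 / (\<Prod>i<length ks. of_nat (ms ! i) ^ (ks ! i)))"

definition zeta_star_sum :: "nat list \<Rightarrow> nat \<Rightarrow> rat" where
  "zeta_star_sum ks p =
    (\<Sum>ms | length ms = length ks \<and> set ms \<subseteq> {0<..<p} \<and> sorted_wrt (\<ge>) ms.
       1 / (\<Prod>i<length ks. of_nat (ms ! i) ^ (ks ! i)))"

definition zeta_A :: "nat list \<Rightarrow> ring_A" where
  "zeta_A ks = of_rat_family (zeta_sum ks)"

definition zeta_star_A :: "nat list \<Rightarrow> ring_A" where
  "zeta_star_A ks = of_rat_family (zeta_star_sum ks)"

text \<open>Bernoulli numbers (\<open>B\<^sub>1 = - 1 / 2\<close>), by the recursion
  \<open>\<Sum>j\<le>n. (n + 1 choose j) B\<^sub>j = 0\<close> for \<open>n > 0\<close>.\<close>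

fun bernoulli :: "nat \<Rightarrow> rat" where
  "bernoulli 0 = 1"
| "bernoulli (Suc n) = - (\<Sum>j\<le>n. of_nat (n + 2 choose j) * bernoulli j) / of_nat (n + 2)"

text \<open>
  The truncated subtraction \<open>p - k\<close> affects only the finitely many primes \<open>p < k\<close>. For
  \<open>k \<ge> 2\<close> and \<open>p > k\<close> the number \<open>B\<^sub>p\<^sub>-\<^sub>k / k\<close> is \<open>p\<close>-integral by von Staudt--Clausen. For
  \<open>k = 1\<close> it never is, so that \<open>Z_A 1\<close> is a meaningless value.
\<close>

definition Z_A :: "nat \<Rightarrow> ring_A" where
  "Z_A k = of_rat_family (\<lambda>p. bernoulli (p - k) / of_nat k)"

end

theory Submission
  imports Defs "HOL-Computational_Algebra.Formal_Laurent_Series"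
begin

text \<open>
  Fix an odd prime \<open>p\<close> and mark height by \<open>z = w\<^sup>2\<close> and weight by \<open>t\<close>. One summation variable \<open>m\<close>
  contributes \<open>f\<^sub>m = t/m + z t\<^sup>2/(m(m - t))\<close>, and
  \<open>1 - f\<^sub>m = (m - (1 + w)t)(m - (1 - w)t) / (m(m - t))\<close>. Hence the generating function of the
  star sums is \<open>P\<^sub>p\<^sub>-\<^sub>1 - 1 - t (\<Sum>m<p. P\<^sub>m / m)\<close> with \<open>P\<^sub>m = (\<Prod>j\<le>m. 1 / (1 - f\<^sub>j))\<close>, and
  \<open>P\<^sub>p\<^sub>-\<^sub>1 \<equiv> 1\<close> modulo \<open>p\<close> and \<open>t\<^bsup>p-1\<^esup>\<close> because \<open>\<Prod>r<p. (r - c t) \<equiv> (p - 1)!\<close>.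

  Modulo \<open>p\<close> one may replace \<open>(m - 1)!\<close> by \<open>(1 - p)(2 - p)\<dots>(m - 1 - p)\<close> in \<open>P\<^sub>m / m\<close>. Then the
  coefficients of the partial fraction expansion of the sum in \<open>w\<^sup>2\<close> are terminating
  hypergeometric series, summed by Chu--Vandermonde. What remains modulo \<open>p\<close> is
  \<open>\<Sum>j<p. (-1)\<^sup>j (1/(j - (1 + w)t) - 1/(j - (1 - w)t))\<close> up to a factor, that is, the alternating
  harmonic sums \<open>\<Sum>j<p. (-1)\<^sup>j / j\<^sup>k \<equiv> -2 (1 - 2\<^bsup>1-k\<^esup>) B\<^sub>p\<^sub>-\<^sub>k / k\<close>.

  The non-star sums have generating functions built from the inverse products
  \<open>1 / P\<^sub>m\<^sub>-\<^sub>1 \<equiv> \<Prod>m\<le>j<p. 1 / (1 - f\<^sub>j)\<close>, and \<open>j \<mapsto> p - j\<close> turns these into star sums with \<open>-t\<close> for \<open>t\<close>.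
\<close>

section \<open>Partial fractions of a hypergeometric sum\<close>

text \<open>With (m - 1)! itself the residue at each pole would be a truncated, non-terminating
  hypergeometric series, out of reach of Chu--Vandermonde; with (1 - p)...(m - 1 - p) it terminates.
  Its closed form has the denominator (1 + j - 2t)(2 + j - 2t)...(p + j - 2t), whose factor p - 2t
  is not invertible modulo p. This factor is moved to the other side, where it becomes -2t and
  supplies the t in front of the sum over m; the remaining factors cancel modulo p against (1 -
  t)...(p - 1 - t). The identity itself is exact and is proved over the rationals before any
  reduction. Chu--Vandermonde is used without its last term, since m stops at p - 1; the missing
  term produces ordinary harmonic sums, which vanish modulo p. The height variable is a number, not
  a formal variable: w runs through 1, ..., p - 1, and orthogonality of the powers of w separates
  the heights once p > 2k + 1. The binomial coefficients come from expanding w ((1 + w)^(k-1) - (1 -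
  w)^(k-1)).\<close>

lemma partial_fractions:
  fixes x :: "'b \<Rightarrow> 'a::field"
  assumes "finite A" "A \<noteq> {}" "inj_on x A" "\<And>i. i \<in> A \<Longrightarrow> x i \<noteq> v"
  shows "(\<Prod>i\<in>A. 1 / (x i - v)) = (\<Sum>j\<in>A. (1 / (x j - v)) * (\<Prod>i\<in>A - {j}. 1 / (x i - x j)))"
  using assms
proof (induction A arbitrary: v rule: finite_ne_induct)
  case (singleton a)
  then show ?case by simp
next
  case (insert a A)
  from insert.prems have inj: "inj_on x A" and ne: "\<And>i. i \<in> A \<Longrightarrow> x i \<noteq> x a"
    using insert.hyps(3) by (auto simp: inj_on_def)
  have v: "x i \<noteq> v" if "i \<in> insert a A" for i
    using insert.prems that by blast
  let ?P = "\<lambda>j. \<Prod>i\<in>A - {j}. 1 / (x i - x j)"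
  have split: "1 / ((x j - v) * (x a - v)) = 1 / (x j - v) * (1 / (x a - x j)) - 1 / (x a - v) * (1 / (x a - x j))"
    if "j \<in> A" for j
  proof -
    have "x a - x j \<noteq> 0" "x j - v \<noteq> 0" "x a - v \<noteq> 0"
      using ne[OF that] v that by auto
    then show ?thesis
      by (simp add: divide_simps)
  qed
  have "(\<Prod>i\<in>insert a A. 1 / (x i - v)) = 1 / (x a - v) * (\<Sum>j\<in>A. (1 / (x j - v)) * ?P j)"
    using insert.hyps insert.IH[OF inj, of v] v by simp
  also have "\<dots> = (\<Sum>j\<in>A. 1 / ((x j - v) * (x a - v)) * ?P j)"
    by (simp add: sum_distrib_left ac_simps)
  also have "\<dots> = (\<Sum>j\<in>A. 1 / (x j - v) * (1 / (x a - x j)) * ?P j)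
                  + 1 / (x a - v) * (\<Sum>j\<in>A. 1 / (x j - x a) * ?P j)"
  proof -
    have "1 / (x a - x j) = - (1 / (x j - x a))" for j
      by (metis divide_minus_right minus_diff_eq)
    then have "1 / ((x j - v) * (x a - v)) * ?P j =
        1 / (x j - v) * (1 / (x a - x j)) * ?P j + 1 / (x a - v) * (1 / (x j - x a) * ?P j)" if "j \<in> A" for j
      unfolding split[OF that] by (simp add: algebra_simps)
    then have "(\<Sum>j\<in>A. 1 / ((x j - v) * (x a - v)) * ?P j) =
      (\<Sum>j\<in>A. 1 / (x j - v) * (1 / (x a - x j)) * ?P j + 1 / (x a - v) * (1 / (x j - x a) * ?P j))"
      by (intro sum.cong refl)
    then show ?thesis
      by (simp add: sum.distrib sum_distrib_left)
  qed
  \<comment> \<open>The coefficient of \<open>1 / (x a - v)\<close> is the original product at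
    \<open>v = x a\<close>, so the induction hypothesis is used a second time; this is why
    \<open>v\<close> is arbitrary.\<close>
  also have "(\<Sum>j\<in>A. 1 / (x j - x a) * ?P j) = (\<Prod>i\<in>A. 1 / (x i - x a))"
    using insert.IH[OF inj, of "x a"] ne by simp
  also have "(\<Sum>j\<in>A. 1 / (x j - v) * (1 / (x a - x j)) * ?P j) =
      (\<Sum>j\<in>A. 1 / (x j - v) * (\<Prod>i\<in>insert a A - {j}. 1 / (x i - x j)))"
  proof (intro sum.cong refl)
    fix j assume "j \<in> A"
    then have "insert a A - {j} = insert a (A - {j})"
      using insert.hyps(3) by auto
    then show "1 / (x j - v) * (1 / (x a - x j)) * ?P j =
        1 / (x j - v) * (\<Prod>i\<in>insert a A - {j}. 1 / (x i - x j))"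
      using insert.hyps by simp
  qed
  finally show ?case
    using insert.hyps by (simp add: insert_Diff_if)
qed

text \<open>The quotient (c)_N / (c)_n is (c + n)_{N-n}, and reversing its factors gives (-1)^(N-n)
  (d)_{N-n} with d = 1 - c - N. After multiplication by (c)_N the sum is a binomial convolution,
  evaluated by the binomial theorem for rising factorials.\<close>

lemma chu_vandermonde:
  fixes b c :: "'a::field_char_0"
  assumes "pochhammer c N \<noteq> 0"
  shows "(\<Sum>n\<le>N. pochhammer (- of_nat N) n * pochhammer b n / (fact n * pochhammer c n))
           = pochhammer (c - b) N / pochhammer c N"
proof -
  define d where "d = 1 - c - of_nat N"
  have "pochhammer (- of_nat N) n * pochhammer b n / (fact n * pochhammer c n) * pochhammer c N
          = (-1) ^ N * (of_nat (N choose n) * pochhammer b n * pochhammer d (N - n))" if "n \<le> N" for n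
  proof -
    have "(- 1) ^ n * pochhammer (- of_nat N :: 'a) n = of_nat (N choose n) * fact n"
      using gbinomial_pochhammer[of "of_nat N :: 'a" n] by (simp add: binomial_gbinomial)
    then have "(-1) ^ n * ((- 1) ^ n * pochhammer (- of_nat N :: 'a) n) = (-1) ^ n * (of_nat (N choose n) * fact n)"
      by simp
    then have 1: "pochhammer (- of_nat N :: 'a) n = (-1) ^ n * (of_nat (N choose n) * fact n)"
      by (simp flip: mult.assoc power_mult_distrib)
    have "pochhammer (c + of_nat N - 1 - of_nat (N - n) + 1) (N - n) = (-1) ^ (N - n) * pochhammer (- (c + of_nat N - 1)) (N - n)"
      by (rule pochhammer_minus')
    moreover have "c + of_nat N - 1 - of_nat (N - n) + 1 = c + of_nat n" "- (c + of_nat N - 1) = d"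
      using that by (simp_all add: of_nat_diff d_def)
    ultimately have 2: "pochhammer (c + of_nat n) (N - n) = (-1) ^ (N - n) * pochhammer d (N - n)"
      by simp
    have 3: "pochhammer c N = pochhammer c n * pochhammer (c + of_nat n) (N - n)"
      using that by (rule pochhammer_product)
    with assms have 4: "pochhammer c n \<noteq> 0" by auto
    have 5: "(-1 :: 'a) ^ N = (-1) ^ n * (-1) ^ (N - n)"
      using that by (simp flip: power_add)
    show ?thesis
      unfolding 3 1 2 5 using 4 by (simp add: field_simps)
  qed
  then have "(\<Sum>n\<le>N. pochhammer (- of_nat N) n * pochhammer b n / (fact n * pochhammer c n)) * pochhammer c N
     = (-1) ^ N * pochhammer (b + d) N"
    unfolding pochhammer_binomial_sum by (simp add: sum_distrib_right sum_distrib_left)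
  also have "b + d = - (c - b + of_nat N - 1)"
    by (simp add: d_def)
  also have "(-1) ^ N * pochhammer (- (c - b + of_nat N - 1)) N = pochhammer (c - b + of_nat N - 1 - of_nat N + 1) N"
    by (rule pochhammer_minus'[symmetric])
  finally show ?thesis
    using assms by (simp add: field_simps)
qed

text \<open>In the application \<open>n = N\<close> would mean \<open>m = q\<close>, one step beyond
  the range of the summation variable. The omitted term accounts for the second summand of the
  numerator.\<close>

lemma truncated_chu_vandermonde:
  fixes b c :: "'a::field_char_0"
  assumes "pochhammer c N \<noteq> 0"
  shows "(\<Sum>n<N. pochhammer (- of_nat N) n * pochhammer b n / (fact n * pochhammer c n))
           = (pochhammer (c - b) N - (-1) ^ N * pochhammer b N) / pochhammer c N"
proof -
  have "pochhammer (- of_nat N :: 'a) N = (-1) ^ N * fact N"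
    by (rule pochhammer_same)
  then show ?thesis
    using chu_vandermonde[OF assms, of b] assms
    by (simp add: lessThan_Suc_atMost[symmetric] diff_divide_distrib eq_diff_eq)
qed

text \<open>Each factor is (i - j)(i + j - 2t). The numbers i - j give the sign and the two
  factorials; 2 (j - t) is the factor i = j missing from the product of the i + j - 2t and completes
  it to a Pochhammer symbol.\<close>

lemma prod_diff_squares:
  fixes t :: "'a::field_char_0"
  assumes "1 \<le> j" "j \<le> m"
  shows "(\<Prod>i\<in>{1..m} - {j}. (of_nat i - t)\<^sup>2 - (of_nat j - t)\<^sup>2) * (2 * (of_nat j - t))
           = (-1) ^ (j - 1) * fact (j - 1) * fact (m - j) * pochhammer (1 + of_nat j - 2 * t) m"
  using assms(2)
proof (induction m rule: dec_induct)
  case base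
  have split: "(of_nat i - t)\<^sup>2 - (of_nat j - t)\<^sup>2 = - of_nat (j - i) * (of_nat i + of_nat j - 2 * t)"
    if "i < j" for i
    using that by (simp add: of_nat_diff power2_eq_square algebra_simps)
  have "{1..j} - {j} = {1..<j}" by auto
  then have "(\<Prod>i\<in>{1..j} - {j}. (of_nat i - t)\<^sup>2 - (of_nat j - t)\<^sup>2)
      = (\<Prod>i\<in>{1..<j}. - of_nat (j - i)) * (\<Prod>i\<in>{1..<j}. of_nat i + of_nat j - 2 * t)"
    by (simp add: split prod.distrib)
  also have "(\<Prod>i\<in>{1..<j}. - of_nat (j - i) :: 'a) = (\<Prod>i\<in>{1..j-1}. - of_nat i)"
    by (rule prod.reindex_bij_witness[of _ "\<lambda>i. j - i" "\<lambda>i. j - i"]) (use assms(1) in auto)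
  also have "\<dots> = (-1) ^ (j - 1) * fact (j - 1)"
    by (simp add: prod_uminus fact_prod)
  finally have "(\<Prod>i\<in>{1..j} - {j}. (of_nat i - t)\<^sup>2 - (of_nat j - t)\<^sup>2) * (2 * (of_nat j - t))
      = (-1) ^ (j - 1) * fact (j - 1) * ((\<Prod>i\<in>{1..<j}. of_nat i + of_nat j - 2 * t) * (2 * (of_nat j - t)))"
    by (simp only: mult.assoc)
  also have "(\<Prod>i\<in>{1..<j}. of_nat i + of_nat j - 2 * t) * (2 * (of_nat j - t))
      = (\<Prod>i\<in>insert j {1..<j}. of_nat i + of_nat j - 2 * t)"
    by (simp add: mult.commute algebra_simps)
  also have "insert j {1..<j} = {1..j}" using assms(1) by auto
  also have "(\<Prod>i\<in>{1..j}. of_nat i + of_nat j - 2 * t) = pochhammer (1 + of_nat j - 2 * t) j"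
    unfolding pochhammer_prod
    by (rule prod.reindex_bij_witness[of _ Suc "\<lambda>i. i - 1"]) (auto simp: of_nat_diff algebra_simps)
  finally show ?case by simp
next
  case (step m)
  have "{1..Suc m} - {j} = insert (Suc m) ({1..m} - {j})"
    using step.hyps by auto
  then have "(\<Prod>i\<in>{1..Suc m} - {j}. (of_nat i - t)\<^sup>2 - (of_nat j - t)\<^sup>2) * (2 * (of_nat j - t))
     = ((of_nat (Suc m) - t)\<^sup>2 - (of_nat j - t)\<^sup>2) *
       ((\<Prod>i\<in>{1..m} - {j}. (of_nat i - t)\<^sup>2 - (of_nat j - t)\<^sup>2) * (2 * (of_nat j - t)))"
    by simp
  also have "(of_nat (Suc m) - t)\<^sup>2 - (of_nat j - t)\<^sup>2 = of_nat (Suc m - j) * (1 + of_nat j - 2 * t + of_nat m)"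
    using step.hyps by (simp add: of_nat_diff power2_eq_square algebra_simps)
  also have "fact (Suc m - j) = (of_nat (Suc m - j) * fact (m - j) :: 'a)"
    using step.hyps by (simp add: Suc_diff_le)
  ultimately show ?case
    unfolding step.IH by (simp add: pochhammer_Suc)
qed

text \<open>The left side collects the coefficients of \<open>1 / ((j - t)^2 - v)\<close> from all m
  whose product contains this pole, that is m \<ge> j. With m = j + n it is a multiple of a Gauss
  series at 1 with upper parameters j - q and 1 + j - t and lower parameter 1 + 2j - 2t.\<close>

lemma partial_fraction_coeff:
  fixes t :: "'a::field_char_0"
  assumes "1 \<le> j" "j < q" and nz: "\<And>n. of_nat n - 2 * t \<noteq> 0"
  shows "(\<Sum>m\<in>{j..<q}. pochhammer (1 - of_nat q) (m - 1) * pochhammer (1 - t) m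
             / (\<Prod>i\<in>{1..m} - {j}. (of_nat i - t)\<^sup>2 - (of_nat j - t)\<^sup>2))
    = (-1) ^ (j - 1) * 2 * (of_nat j - t) * pochhammer (1 - of_nat q) (j - 1) / fact (j - 1)
        * (pochhammer (1 - t) (q - 1) * (of_nat j - t - (-1) ^ (q - j) * (of_nat q - t)))
        / pochhammer (1 + of_nat j - 2 * t) q" (is "?L = ?R")
proof -
  define N where "N = q - j"
  have q: "q = j + N" using assms by (simp add: N_def)
  have poch: "pochhammer (1 + of_nat n - 2 * t) m \<noteq> 0" for n m
  proof -
    have "1 + of_nat n - 2 * t \<noteq> - of_nat k" for k
      using nz[of "1 + n + k"] by (auto simp: algebra_simps eq_neg_iff_add_eq_0)
    then show ?thesis by (simp add: pochhammer_eq_0_iff)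
  qed
  have jt: "2 * (of_nat j - t) \<noteq> 0"
    using nz[of "2 * j"] by (simp add: algebra_simps)
  \<comment> \<open>\<open>K\<close> is the summand at \<open>m = j\<close>; dividing by it leaves a
    hypergeometric term in \<open>n = m - j\<close>.\<close>
  define K where "K = (-1) ^ (j - 1) * 2 * (of_nat j - t) / fact (j - 1) * pochhammer (1 - of_nat q) (j - 1)
     * pochhammer (1 - t) j / pochhammer (1 + of_nat j - 2 * t) j"
  define b where "b = 1 + of_nat j - t"
  define c where "c = 1 + of_nat (2 * j) - 2 * t"
  have c: "pochhammer c n \<noteq> 0" for n
    unfolding c_def by (rule poch)
  have summand: "pochhammer (1 - of_nat q) (m - 1) * pochhammer (1 - t) m
             / (\<Prod>i\<in>{1..m} - {j}. (of_nat i - t)\<^sup>2 - (of_nat j - t)\<^sup>2)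
       = K * (pochhammer (- of_nat N) n * pochhammer b n / (fact n * pochhammer c n))" 
    if m: "m = j + n" for m n
  proof -
    have "pochhammer (1 - of_nat q :: 'a) (m - 1) = pochhammer (1 - of_nat q) (j - 1) * pochhammer (- of_nat N) n"
      using pochhammer_product'[of "1 - of_nat q :: 'a" "j - 1" n] assms(1) by (simp add: m q of_nat_diff)
    moreover have "pochhammer (1 - t) m = pochhammer (1 - t) j * pochhammer b n"
      using pochhammer_product'[of "1 - t" j n] by (simp add: m b_def algebra_simps)
    moreover have "pochhammer (1 + of_nat j - 2 * t) m = pochhammer (1 + of_nat j - 2 * t) j * pochhammer c n"
      using pochhammer_product'[of "1 + of_nat j - 2 * t" j n] by (simp add: m c_def algebra_simps)
    moreover have "(\<Prod>i\<in>{1..m} - {j}. (of_nat i - t)\<^sup>2 - (of_nat j - t)\<^sup>2)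
       = (-1) ^ (j - 1) * fact (j - 1) * fact n * pochhammer (1 + of_nat j - 2 * t) m / (2 * (of_nat j - t))"
      using prod_diff_squares[of j m t] assms(1) jt by (simp add: m eq_divide_eq)
    moreover have "A * B * (C * D) / (((-1) ^ (j - 1) * F * G * (H * I)) / J)
        = (-1) ^ (j - 1) * J / F * A * C / H * (B * D / (G * I))"
      if "F \<noteq> 0" "G \<noteq> 0" "H \<noteq> 0" "I \<noteq> 0" "J \<noteq> 0" for A B C D F G H I J :: 'a
      using that by (cases "even (j - 1)") (auto simp: field_simps)
    ultimately show ?thesis
      using jt poch[of j j] c[of n] by (simp only: K_def fact_nonzero not_False_eq_True mult.assoc)
  qed
  have "?L = (\<Sum>m\<in>{j..<q}. K * (pochhammer (- of_nat N) (m - j) * pochhammer b (m - j) / (fact (m - j) * pochhammer c (m - j))))"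
    by (intro sum.cong refl summand) auto
  also have "\<dots> = (\<Sum>n<N. K * (pochhammer (- of_nat N) n * pochhammer b n / (fact n * pochhammer c n)))"
    by (rule sum.reindex_bij_witness[of _ "\<lambda>n. j + n" "\<lambda>m. m - j"]) (use q in auto)
  also have "\<dots> = K * ((pochhammer (c - b) N - (-1) ^ N * pochhammer b N) / pochhammer c N)"
    unfolding sum_distrib_left[symmetric] truncated_chu_vandermonde[OF c] ..
  also have "\<dots> = ?R"
  proof -
    \<comment> \<open>\<open>c - b\<close> equals the last factor j - t of (1 - t)_j. This factor
      occurs twice, while the others continue the product up to q - 1 - t.\<close>
    have "pochhammer (1 - t) j * pochhammer (c - b) N = pochhammer (1 - t) (q - 1) * (of_nat j - t)"
    proof -
      obtain N' where N': "N = Suc N'" using assms by (cases N) (auto simp: N_def)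
      have "c - b = of_nat j - t" by (simp add: b_def c_def)
      then have "pochhammer (c - b) N = (of_nat j - t) * pochhammer (of_nat j - t + 1) N'"
        by (simp add: N' pochhammer_rec)
      moreover have "pochhammer (1 - t) (q - 1) = pochhammer (1 - t) j * pochhammer (of_nat j - t + 1) N'"
        using pochhammer_product'[of "1 - t" j N'] by (simp add: q N' add_diff_eq diff_add_eq add.commute)
      ultimately show ?thesis by simp
    qed
    moreover have "pochhammer (1 - t) j * pochhammer b N = pochhammer (1 - t) (q - 1) * (of_nat q - t)"
    proof -
      have "pochhammer (1 - t) (Suc (q - 1)) = pochhammer (1 - t) (q - 1) * (of_nat q - t)"
        unfolding pochhammer_Suc using assms by (simp add: of_nat_diff)
      then show ?thesis
        using pochhammer_product'[of "1 - t" j N] assms by (simp add: q b_def algebra_simps)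
    qed
    ultimately have 1: "pochhammer (1 - t) j * (pochhammer (c - b) N - (-1) ^ N * pochhammer b N)
        = pochhammer (1 - t) (q - 1) * (of_nat j - t - (-1) ^ N * (of_nat q - t))"
      by (simp only: right_diff_distrib mult.left_commute[of _ "(-1) ^ N"])
    have 2: "A * B / C * D * E / F * (G / H) = A * B * D / C * (E * G) / (F * H)" for A B C D E F G H :: 'a
      by (simp add: mult.assoc)
    have 3: "pochhammer (1 + of_nat j - 2 * t) q = pochhammer (1 + of_nat j - 2 * t) j * pochhammer c N"
      using pochhammer_product'[of "1 + of_nat j - 2 * t" j N] by (simp add: q c_def algebra_simps)
    show ?thesis
      unfolding K_def N_def[symmetric] 3 2 1 ..
  qed
  finally show ?thesis .
qed

text \<open>Each product is expanded in partial fractions in \<open>v\<close>, and the triangular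
  double sum is exchanged. The assumption \<open>nz\<close> makes the poles distinct: (i - t)^2 = (j
  - t)^2 with i \<noteq> j would force i + j = 2t.\<close>

lemma hypergeometric_partial_fractions:
  fixes t v :: "'a::field_char_0"
  assumes nz: "\<And>n. of_nat n - 2 * t \<noteq> 0"
    and v: "\<And>j. 1 \<le> j \<Longrightarrow> j < q \<Longrightarrow> (of_nat j - t)\<^sup>2 \<noteq> v"
  shows "(\<Sum>m\<in>{1..<q}. pochhammer (1 - of_nat q) (m - 1) * pochhammer (1 - t) m
             / (\<Prod>i\<in>{1..m}. (of_nat i - t)\<^sup>2 - v))
    = (\<Sum>j\<in>{1..<q}. (-1) ^ (j - 1) * 2 * (of_nat j - t) * pochhammer (1 - of_nat q) (j - 1) / fact (j - 1)
        * (pochhammer (1 - t) (q - 1) * (of_nat j - t - (-1) ^ (q - j) * (of_nat q - t)))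
        / pochhammer (1 + of_nat j - 2 * t) q / ((of_nat j - t)\<^sup>2 - v))"
proof -
  define y where "y = (\<lambda>i::nat. (of_nat i - t)\<^sup>2)"
  define C where "C = (\<lambda>m. pochhammer (1 - of_nat q) (m - 1) * pochhammer (1 - t) m)"
  have inj: "inj y"
  proof (rule injI)
    fix i j assume "y i = y j"
    then have "(of_nat i - of_nat j) * (of_nat (i + j) - 2 * t) = 0"
      by (simp add: y_def power2_eq_square algebra_simps)
    then show "i = j" using nz[of "i + j"] by simp
  qed
  have "(\<Sum>m\<in>{1..<q}. C m / (\<Prod>i\<in>{1..m}. y i - v)) =
    (\<Sum>m\<in>{1..<q}. \<Sum>j\<in>{1..m}. C m / (\<Prod>i\<in>{1..m} - {j}. y i - y j) / (y j - v))"
  proof (intro sum.cong refl)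
    fix m assume m: "m \<in> {1..<q}"
    have "1 / (\<Prod>i\<in>{1..m}. y i - v) = (\<Sum>j\<in>{1..m}. (1 / (y j - v)) * (1 / (\<Prod>i\<in>{1..m} - {j}. y i - y j)))"
      using partial_fractions[of "{1..m}" y v] m v inj_on_subset[OF inj] by (auto simp: y_def prod_dividef)
    then have "C m * (1 / (\<Prod>i\<in>{1..m}. y i - v)) = C m * (\<Sum>j\<in>{1..m}. (1 / (y j - v)) * (1 / (\<Prod>i\<in>{1..m} - {j}. y i - y j)))"
      by simp
    then show "C m / (\<Prod>i\<in>{1..m}. y i - v) = (\<Sum>j\<in>{1..m}. C m / (\<Prod>i\<in>{1..m} - {j}. y i - y j) / (y j - v))"
      by (simp add: sum_distrib_left mult.commute)
  qed
  also have "\<dots> = (\<Sum>j\<in>{1..<q}. \<Sum>m\<in>{j..<q}. C m / (\<Prod>i\<in>{1..m} - {j}. y i - y j) / (y j - v))"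
    unfolding sum.Sigma[OF finite_atLeastLessThan ballI[OF finite_atLeastAtMost]]
      sum.Sigma[OF finite_atLeastLessThan ballI[OF finite_atLeastLessThan]]
    by (rule sum.reindex_bij_witness[of _ "\<lambda>(j, m). (m, j)" "\<lambda>(m, j). (j, m)"]) auto
  also have "\<dots> = (\<Sum>j\<in>{1..<q}. (\<Sum>m\<in>{j..<q}. C m / (\<Prod>i\<in>{1..m} - {j}. y i - y j)) / (y j - v))"
    by (simp add: sum_divide_distrib)
  finally show ?thesis
    unfolding C_def y_def using partial_fraction_coeff[OF _ _ nz] by simp
qed

section \<open>Congruences of rational numbers and power series\<close>

text \<open>The localization of the integers at p; any fraction with admissible denominator is a
  witness, reduced or not.\<close>

definition p_integral :: "nat \<Rightarrow> rat \<Rightarrow> bool" where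
  "p_integral p q \<longleftrightarrow> (\<exists>a b. \<not> int p dvd b \<and> q = of_int a / of_int b)"

text \<open>Only the difference is constrained, so congruent numbers may have p in their
  denominators. Multiplicative rules therefore carry separate integrality hypotheses.\<close>

definition p_cong :: "nat \<Rightarrow> rat \<Rightarrow> rat \<Rightarrow> bool" where
  "p_cong p x y \<longleftrightarrow> (\<exists>r. p_integral p r \<and> x - y = of_nat p * r)"

definition fps_p_integral :: "nat \<Rightarrow> rat fps \<Rightarrow> bool" where
  "fps_p_integral p F \<longleftrightarrow> (\<forall>n. p_integral p (fps_nth F n))"

definition fps_p_cong :: "nat \<Rightarrow> nat \<Rightarrow> rat fps \<Rightarrow> rat fps \<Rightarrow> bool" where
  "fps_p_cong p M F G \<longleftrightarrow> (\<forall>n<M. p_cong p (fps_nth F n) (fps_nth G n))"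

locale prime_nat =
  fixes p :: nat
  assumes prime: "prime p"
begin

lemma p_integral_of_int [simp, intro]: "p_integral p (of_int a)"
  unfolding p_integral_def
  by (rule exI[of _ a], rule exI[of _ 1]) (use prime prime_nat_iff in auto)

lemma p_integral_of_nat [simp, intro]: "p_integral p (of_nat a)"
  using p_integral_of_int[of "int a"] by simp

lemma p_integral_numeral [simp, intro]: "p_integral p (numeral a)"
  using p_integral_of_nat[of "numeral a"] by simp

lemma p_integral_0 [simp, intro]: "p_integral p 0" and p_integral_1 [simp, intro]: "p_integral p 1"
  using p_integral_of_int[of 0] p_integral_of_int[of 1] by simp_all

lemma p_integral_mult [intro]:
  assumes "p_integral p x" "p_integral p y"
  shows "p_integral p (x * y)"
proof -
  from assms obtain a b c d where "\<not> int p dvd b" "x = of_int a / of_int b" "\<not> int p dvd d" "y = of_int c / of_int d"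
    unfolding p_integral_def by blast
  then have "x * y = of_int (a * c) / of_int (b * d) \<and> \<not> int p dvd b * d"
    using prime by (simp add: prime_dvd_mult_iff)
  then show ?thesis unfolding p_integral_def by blast
qed

lemma p_integral_add [intro]:
  assumes "p_integral p x" "p_integral p y"
  shows "p_integral p (x + y)"
proof -
  from assms obtain a b c d where *: "\<not> int p dvd b" "x = of_int a / of_int b" "\<not> int p dvd d" "y = of_int c / of_int d"
    unfolding p_integral_def by blast
  then have "b \<noteq> 0" "d \<noteq> 0" by auto
  then have "x + y = of_int (a * d + c * b) / of_int (b * d) \<and> \<not> int p dvd b * d"
    using prime * by (simp add: prime_dvd_mult_iff field_simps)
  then show ?thesis unfolding p_integral_def by blast
qed

lemma p_integral_uminus [intro]: "p_integral p x \<Longrightarrow> p_integral p (- x)"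
  using p_integral_mult[OF p_integral_of_int[of "-1"]] by simp

lemma p_integral_diff [intro]: "p_integral p x \<Longrightarrow> p_integral p y \<Longrightarrow> p_integral p (x - y)"
  using p_integral_add[of x "- y"] by auto

lemma p_integral_power [intro]: "p_integral p x \<Longrightarrow> p_integral p (x ^ n)"
  by (induction n) auto

lemma p_integral_sum [intro]: "(\<And>i. i \<in> A \<Longrightarrow> p_integral p (f i)) \<Longrightarrow> p_integral p (\<Sum>i\<in>A. f i)"
  by (induction A rule: infinite_finite_induct) auto

lemma p_integral_prod [intro]: "(\<And>i. i \<in> A \<Longrightarrow> p_integral p (f i)) \<Longrightarrow> p_integral p (\<Prod>i\<in>A. f i)"
  by (induction A rule: infinite_finite_induct) auto

lemma p_integral_inverse [intro]: "\<not> p dvd n \<Longrightarrow> p_integral p (1 / of_nat n)"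
  unfolding p_integral_def by (rule exI[of _ 1], rule exI[of _ "int n"]) (simp add: int_dvd_int_iff)

lemma p_integral_divide: "p_integral p x \<Longrightarrow> \<not> p dvd n \<Longrightarrow> p_integral p (x / of_nat n)"
  using p_integral_mult[OF _ p_integral_inverse] by simp

lemma not_dvd_less: "0 < n \<Longrightarrow> n < p \<Longrightarrow> \<not> p dvd n"
  by (simp add: nat_dvd_not_less)

lemma not_dvd_power: "\<not> p dvd n \<Longrightarrow> \<not> p dvd n ^ k"
  using prime prime_dvd_power_nat by blast

lemma not_dvd_fact: "n < p \<Longrightarrow> \<not> p dvd fact n"
  using prime by (simp add: prime_dvd_fact_iff)

lemma p_cong_refl [simp, intro]: "p_cong p x x"
  unfolding p_cong_def by (rule exI[of _ 0]) auto

lemma p_cong_mult: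
  assumes "p_cong p x x'" "p_cong p y y'" "p_integral p x" "p_integral p y'"
  shows "p_cong p (x * y) (x' * y')"
proof -
  from assms obtain r s where r: "p_integral p r" "x - x' = of_nat p * r" and s: "p_integral p s" "y - y' = of_nat p * s"
    unfolding p_cong_def by blast
  have "x * y - x' * y' = x * (y - y') + (x - x') * y'" by (simp add: algebra_simps)
  also have "\<dots> = of_nat p * (x * s + r * y')"
    unfolding r s by (simp add: algebra_simps)
  finally have "x * y - x' * y' = of_nat p * (x * s + r * y')" .
  moreover have "p_integral p (x * s + r * y')"
    using r(1) s(1) assms(3,4) by auto
  ultimately show ?thesis unfolding p_cong_def by blast
qed

lemma p_cong_add [intro]:
  assumes "p_cong p x x'" "p_cong p y y'"
  shows "p_cong p (x + y) (x' + y')"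
proof -
  from assms obtain r s where "p_integral p r" "x - x' = of_nat p * r" "p_integral p s" "y - y' = of_nat p * s"
    unfolding p_cong_def by blast
  then have "x + y - (x' + y') = of_nat p * (r + s) \<and> p_integral p (r + s)"
    by (auto simp: algebra_simps)
  then show ?thesis unfolding p_cong_def by blast
qed

lemma p_cong_uminus [intro]:
  assumes "p_cong p x y"
  shows "p_cong p (- x) (- y)"
proof -
  from assms obtain r where "p_integral p r" "x - y = of_nat p * r"
    unfolding p_cong_def by blast
  then have "- x - - y = of_nat p * (- r) \<and> p_integral p (- r)"
    by (auto simp: algebra_simps)
  then show ?thesis unfolding p_cong_def by blast
qed

lemma p_cong_diff [intro]: "p_cong p x x' \<Longrightarrow> p_cong p y y' \<Longrightarrow> p_cong p (x - y) (x' - y')"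
  using p_cong_add[of x x' "- y" "- y'"] by auto

lemma p_cong_iff_diff: "p_cong p x y \<longleftrightarrow> p_cong p (x - y) 0"
  by (simp add: p_cong_def)

lemma p_cong_sym: "p_cong p x y \<Longrightarrow> p_cong p y x"
  using p_cong_uminus[of "x - y" 0] p_cong_iff_diff[of x y] p_cong_iff_diff[of y x] by simp

lemma p_cong_trans [trans]: "p_cong p x y \<Longrightarrow> p_cong p y z \<Longrightarrow> p_cong p x z"
  using p_cong_add[of "x - y" 0 "y - z" 0] p_cong_iff_diff[of x y] p_cong_iff_diff[of y z]
    p_cong_iff_diff[of x z] by simp

lemma p_cong_mult_left: "p_cong p x y \<Longrightarrow> p_integral p c \<Longrightarrow> p_cong p (c * x) (c * y)"
  unfolding p_cong_def by (metis mult.left_commute p_integral_mult right_diff_distrib)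

lemma p_cong_mult_p: "p_integral p x \<Longrightarrow> p_cong p (of_nat p * x) 0"
  unfolding p_cong_def by auto

lemma p_cong_sum [intro]: "(\<And>i. i \<in> A \<Longrightarrow> p_cong p (f i) (g i)) \<Longrightarrow> p_cong p (\<Sum>i\<in>A. f i) (\<Sum>i\<in>A. g i)"
  by (induction A rule: infinite_finite_induct) auto

lemma p_cong_prod:
  assumes "\<And>i. i \<in> A \<Longrightarrow> p_cong p (f i) (g i)" "\<And>i. i \<in> A \<Longrightarrow> p_integral p (f i)" "\<And>i. i \<in> A \<Longrightarrow> p_integral p (g i)"
  shows "p_cong p (\<Prod>i\<in>A. f i) (\<Prod>i\<in>A. g i)"
  using assms by (induction A rule: infinite_finite_induct) (auto intro!: p_cong_mult)

lemma p_cong_power: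
  "p_cong p x y \<Longrightarrow> p_integral p x \<Longrightarrow> p_integral p y \<Longrightarrow> p_cong p (x ^ n) (y ^ n)"
  by (induction n) (auto intro!: p_cong_mult)

lemma p_cong_cancel:
  assumes "p_cong p (of_nat n * x) (of_nat n * y)" "\<not> p dvd n"
  shows "p_cong p x y"
proof -
  have "n \<noteq> 0" using assms(2) by (metis dvd_0_right)
  then show ?thesis
    using p_cong_mult_left[OF assms(1) p_integral_inverse[OF assms(2)]] by simp
qed

text \<open>In the application \<open>s\<close> is the sign (-1)^k that arises when a power of p - j
  in a denominator is replaced by a power of j.\<close>

lemma p_cong_inverse:
  assumes "p_cong p (of_nat m) (s * of_nat n)" "\<not> p dvd m" "\<not> p dvd n" "s * s = 1" "p_integral p s"
  shows "p_cong p (1 / of_nat m) (s / of_nat n)"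
proof (rule p_cong_cancel)
  have nz: "m \<noteq> 0" "n \<noteq> 0" using assms(2,3) by (metis dvd_0_right)+
  have "p_cong p (s * of_nat n * (s / of_nat n)) (of_nat m * (s / of_nat n))"
    using p_cong_mult_left[OF p_cong_sym[OF assms(1)], of "s / of_nat n"] p_integral_divide[OF assms(5,3)]
    by (simp add: mult.commute)
  then show "p_cong p (of_nat m * (1 / of_nat m)) (of_nat m * (s / of_nat n))"
    using nz assms(4) by simp
qed (fact assms(2))

lemma p_cong_of_int_iff: "p_cong p (of_int a) (of_int b) \<longleftrightarrow> [a = b] (mod int p)"
proof
  assume "p_cong p (of_int a) (of_int b)"
  then obtain c d where *: "\<not> int p dvd d" "of_int a - of_int b = rat_of_nat p * (of_int c / of_int d)"
    unfolding p_cong_def p_integral_def by blast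
  then have "d \<noteq> 0" by auto
  with *(2) have "rat_of_int ((a - b) * d) = of_int (int p * c)"
    by (simp add: field_simps)
  then have "(a - b) * d = int p * c"
    by (simp only: of_int_eq_iff)
  then have "int p dvd (a - b) * d" by simp
  with *(1) show "[a = b] (mod int p)"
    using prime by (simp add: cong_iff_dvd_diff prime_dvd_mult_iff)
next
  assume "[a = b] (mod int p)"
  then obtain c where "a - b = int p * c" by (auto simp: cong_iff_dvd_diff)
  then have "rat_of_int (a - b) = of_int (int p * c)" by simp
  then have "of_int a - of_int b = rat_of_nat p * of_int c" by simp
  then show "p_cong p (of_int a) (of_int b)" unfolding p_cong_def by blast
qed

lemma p_cong_fermat:
  assumes "\<not> p dvd n"
  shows "p_cong p (of_nat n ^ (p - 1)) 1"
proof -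
  have "[int (n ^ (p - 1)) = int 1] (mod int p)"
    using fermat_theorem[OF prime assms] by (simp only: cong_int_iff)
  then show ?thesis
    using p_cong_of_int_iff[of "int (n ^ (p - 1))" "int 1"] by simp
qed

text \<open>The reduced denominator divides every other denominator of the same number, so
  p-integrality keeps it prime to p, and \<open>modular_inverse\<close> really inverts it.\<close>

lemma p_cong_rat_mod:
  assumes "p_integral p x"
  shows "p_cong p (of_int (rat_mod x p)) x"
proof -
  obtain a b where ab: "quotient_of x = (a, b)" by force
  then have x: "x = of_int a / of_int b" and "b > 0" and cop: "coprime a b"
    by (auto simp: quotient_of_div quotient_of_denom_pos quotient_of_coprime)
  from assms obtain c d where cd: "\<not> int p dvd d" "x = of_int c / of_int d"
    unfolding p_integral_def by blast
  then have "d \<noteq> 0" by auto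
  then have "rat_of_int (a * d) = of_int (c * b)"
    using x cd \<open>b > 0\<close> by (simp add: field_simps)
  then have "a * d = c * b" by (simp only: of_int_eq_iff)
  then have "b dvd d" using cop
    by (metis coprime_commute coprime_dvd_mult_right_iff dvd_triv_right)
  then have b: "\<not> int p dvd b" using cd(1) dvd_trans by blast
  then have "coprime b (int p)"
    using prime prime_imp_coprime[of "int p" b] by (simp add: coprime_commute)
  then have "[a * (b * modular_inverse (int p) b) = a * 1] (mod int p)"
    by (intro cong_mult cong_refl cong_modular_inverse1)
  then have "[rat_mod x p * b = a] (mod int p)"
    unfolding rat_mod_def ab by (simp add: cong_def mod_simps ac_simps)
  then have *: "p_cong p (of_int (rat_mod x p * b)) (of_int a)"
    by (simp only: p_cong_of_int_iff)
  have "p_integral p (of_int 1 / of_int b)"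
    using b unfolding p_integral_def by blast
  from p_cong_mult_left[OF * this] show ?thesis
    using \<open>b > 0\<close> by (simp add: x)
qed

end

section \<open>Families of rational numbers as elements of the quotient ring\<close>

lemma of_rat_family_eq_abs_ring_A:
  assumes "\<And>p. prime p \<Longrightarrow> p > M \<Longrightarrow> p_integral p (f p) \<and> p_cong p (f p) (of_int (g p))"
  shows "of_rat_family f = abs_ring_A g"
proof -
  have "fin_rel (\<lambda>p. rat_mod (f p) p) g"
    unfolding fin_rel_def
  proof (rule finite_subset)
    \<comment> \<open>At primes up to \<open>M\<close> the residues may be meaningless; they fall
      into the finite exceptional set.\<close>
    show "{p. prime p \<and> \<not> [rat_mod (f p) p = g p] (mod int p)} \<subseteq> {..M}"
    proof safe
      fix p assume p: "prime p" and nc: "\<not> [rat_mod (f p) p = g p] (mod int p)"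
      interpret prime_nat p using p by unfold_locales
      show "p \<le> M"
      proof (rule ccontr)
        assume "\<not> p \<le> M"
        then have "p_integral p (f p)" "p_cong p (f p) (of_int (g p))"
          using assms p by auto
        then have "p_cong p (of_int (rat_mod (f p) p)) (of_int (g p))"
          using p_cong_rat_mod p_cong_trans by blast
        with nc show False by (simp add: p_cong_of_int_iff)
      qed
    qed
  qed simp
  then show ?thesis
    by (simp add: of_rat_family_def ring_A.abs_eq_iff)
qed

lemma of_rat_family_cong:
  assumes "\<And>p. prime p \<Longrightarrow> p > M \<Longrightarrow> p_integral p (f p) \<and> p_integral p (g p) \<and> p_cong p (f p) (g p)"
  shows "of_rat_family f = of_rat_family g"
  unfolding of_rat_family_def[of g]
proof (rule of_rat_family_eq_abs_ring_A)
  fix p assume p: "prime p" "p > M"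
  interpret prime_nat p using p by unfold_locales
  show "p_integral p (f p) \<and> p_cong p (f p) (of_int (rat_mod (g p) p))"
    using assms[OF p] p_cong_rat_mod p_cong_trans p_cong_sym by blast
qed

lemma of_rat_family_add:
  assumes "\<And>p. prime p \<Longrightarrow> p > M \<Longrightarrow> p_integral p (f p) \<and> p_integral p (g p)"
  shows "of_rat_family f + of_rat_family g = of_rat_family (\<lambda>p. f p + g p)"
  unfolding of_rat_family_def[of g] of_rat_family_def[of f] plus_ring_A.abs_eq
proof (rule of_rat_family_eq_abs_ring_A[symmetric])
  fix p assume p: "prime p" "p > M"
  interpret prime_nat p using p by unfold_locales
  show "p_integral p (f p + g p) \<and> p_cong p (f p + g p) (of_int (rat_mod (f p) p + rat_mod (g p) p))"
    using assms[OF p] by (auto intro!: p_cong_add p_cong_sym[OF p_cong_rat_mod])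
qed

lemma of_rat_family_mult:
  assumes "\<And>p. prime p \<Longrightarrow> p > M \<Longrightarrow> p_integral p (f p) \<and> p_integral p (g p)"
  shows "of_rat_family f * of_rat_family g = of_rat_family (\<lambda>p. f p * g p)"
  unfolding of_rat_family_def[of g] of_rat_family_def[of f] times_ring_A.abs_eq
proof (rule of_rat_family_eq_abs_ring_A[symmetric])
  fix p assume p: "prime p" "p > M"
  interpret prime_nat p using p by unfold_locales
  show "p_integral p (f p * g p) \<and> p_cong p (f p * g p) (of_int (rat_mod (f p) p * rat_mod (g p) p))"
    using assms[OF p] by (auto intro!: p_cong_mult p_cong_sym[OF p_cong_rat_mod])
qed

lemma of_rat_family_0: "of_rat_family (\<lambda>p. 0) = 0"
  unfolding zero_ring_A_def by (rule of_rat_family_eq_abs_ring_A[of 0])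
    (auto intro!: prime_nat.p_integral_0 prime_nat.p_cong_refl prime_nat.intro)

lemma of_rat_family_1: "of_rat_family (\<lambda>p. 1) = 1"
  unfolding one_ring_A_def by (rule of_rat_family_eq_abs_ring_A[of 0])
    (auto intro!: prime_nat.p_integral_1 prime_nat.p_cong_refl prime_nat.intro)

lemma of_rat_family_of_nat: "of_rat_family (\<lambda>p. of_nat n) = of_nat n"
proof (induction n)
  case (Suc n)
  have "of_rat_family (\<lambda>p. 1) + of_rat_family (\<lambda>p. of_nat n) = of_rat_family (\<lambda>p. 1 + of_nat n)"
    by (rule of_rat_family_add[of 0])
      (auto intro!: prime_nat.p_integral_1 prime_nat.p_integral_of_nat prime_nat.intro)
  then show ?case by (simp add: Suc of_rat_family_1)
qed (simp add: of_rat_family_0)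

lemma of_rat_family_minus_1_power: "of_rat_family (\<lambda>p. (-1) ^ n) = (-1) ^ n"
proof (cases "even n")
  case False
  have "of_rat_family (\<lambda>p. -1) + of_rat_family (\<lambda>p. 1) = of_rat_family (\<lambda>p. - 1 + 1)"
    by (rule of_rat_family_add[of 0])
      (auto intro!: prime_nat.p_integral_1 prime_nat.p_integral_uminus prime_nat.intro)
  then have "of_rat_family (\<lambda>p. -1) = -1"
    by (simp add: of_rat_family_0 of_rat_family_1 eq_neg_iff_add_eq_0)
  with False show ?thesis by simp
qed (simp add: of_rat_family_1)

lemma of_rat_family_sum:
  assumes "finite S" "\<And>i p. i \<in> S \<Longrightarrow> prime p \<Longrightarrow> p > M \<Longrightarrow> p_integral p (f i p)"
  shows "(\<Sum>i\<in>S. of_rat_family (f i)) = of_rat_family (\<lambda>p. \<Sum>i\<in>S. f i p)"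
  using assms
proof (induction S rule: finite_induct)
  case empty
  then show ?case by (simp add: of_rat_family_0)
next
  case (insert i S)
  have "of_rat_family (f i) + of_rat_family (\<lambda>p. \<Sum>i\<in>S. f i p) = of_rat_family (\<lambda>p. f i p + (\<Sum>i\<in>S. f i p))"
    by (rule of_rat_family_add[of M]) (use insert.prems in \<open>auto intro!: prime_nat.p_integral_sum prime_nat.intro\<close>)
  with insert show ?case by simp
qed

section \<open>Power series modulo p, up to a given degree\<close>

context prime_nat
begin

lemma fps_p_integral_const [intro]: "p_integral p c \<Longrightarrow> fps_p_integral p (fps_const c)"
  by (simp add: fps_p_integral_def)

lemma fps_p_integral_X [simp, intro]: "fps_p_integral p fps_X"
  by (simp add: fps_p_integral_def fps_X_def)

lemma fps_p_integral_0 [simp, intro]: "fps_p_integral p 0"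
  by (simp add: fps_p_integral_def)

lemma fps_p_integral_1 [simp, intro]: "fps_p_integral p 1"
  by (simp add: fps_p_integral_def)

lemma fps_p_integral_of_nat [simp, intro]: "fps_p_integral p (of_nat n)"
  by (simp add: fps_p_integral_def fps_of_nat[symmetric])

lemma fps_p_integral_numeral [simp, intro]: "fps_p_integral p (numeral n)"
  using fps_p_integral_of_nat[of "numeral n"] by simp

lemma fps_p_integral_add [intro]: "fps_p_integral p F \<Longrightarrow> fps_p_integral p G \<Longrightarrow> fps_p_integral p (F + G)"
  by (auto simp: fps_p_integral_def)

lemma fps_p_integral_diff [intro]: "fps_p_integral p F \<Longrightarrow> fps_p_integral p G \<Longrightarrow> fps_p_integral p (F - G)"
  by (auto simp: fps_p_integral_def)

lemma fps_p_integral_uminus [intro]: "fps_p_integral p F \<Longrightarrow> fps_p_integral p (- F)"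
  by (auto simp: fps_p_integral_def)

lemma fps_p_integral_mult [intro]: "fps_p_integral p F \<Longrightarrow> fps_p_integral p G \<Longrightarrow> fps_p_integral p (F * G)"
  by (auto simp: fps_p_integral_def fps_mult_nth)

lemma fps_p_integral_power [intro]: "fps_p_integral p F \<Longrightarrow> fps_p_integral p (F ^ n)"
  by (induction n) auto

lemma fps_p_integral_sum [intro]: "(\<And>i. i \<in> A \<Longrightarrow> fps_p_integral p (f i)) \<Longrightarrow> fps_p_integral p (\<Sum>i\<in>A. f i)"
  by (induction A rule: infinite_finite_induct) auto

lemma fps_p_integral_prod [intro]: "(\<And>i. i \<in> A \<Longrightarrow> fps_p_integral p (f i)) \<Longrightarrow> fps_p_integral p (\<Prod>i\<in>A. f i)"
  by (induction A rule: infinite_finite_induct) auto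

lemma fps_p_cong_refl [simp, intro]: "fps_p_cong p M F F"
  by (simp add: fps_p_cong_def)

lemma fps_p_cong_sym: "fps_p_cong p M F G \<Longrightarrow> fps_p_cong p M G F"
  by (auto simp: fps_p_cong_def intro: p_cong_sym)

lemma fps_p_cong_trans [trans]: "fps_p_cong p M F G \<Longrightarrow> fps_p_cong p M G H \<Longrightarrow> fps_p_cong p M F H"
  by (auto simp: fps_p_cong_def intro: p_cong_trans)

lemma fps_p_cong_add [intro]: "fps_p_cong p M F F' \<Longrightarrow> fps_p_cong p M G G' \<Longrightarrow> fps_p_cong p M (F + G) (F' + G')"
  by (auto simp: fps_p_cong_def)

lemma fps_p_cong_diff [intro]: "fps_p_cong p M F F' \<Longrightarrow> fps_p_cong p M G G' \<Longrightarrow> fps_p_cong p M (F - G) (F' - G')"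
  by (auto simp: fps_p_cong_def)

lemma fps_p_cong_mult:
  "fps_p_cong p M F F' \<Longrightarrow> fps_p_cong p M G G' \<Longrightarrow> fps_p_integral p F \<Longrightarrow> fps_p_integral p G'
    \<Longrightarrow> fps_p_cong p M (F * G) (F' * G')"
  by (auto simp: fps_p_cong_def fps_p_integral_def fps_mult_nth intro!: p_cong_sum p_cong_mult)

lemma fps_p_cong_mult_left:
  "fps_p_cong p M G G' \<Longrightarrow> fps_p_integral p F \<Longrightarrow> fps_p_cong p M (F * G) (F * G')"
  by (auto simp: fps_p_cong_def fps_p_integral_def fps_mult_nth intro!: p_cong_sum p_cong_mult_left)

lemma fps_p_cong_sum [intro]:
  "(\<And>i. i \<in> A \<Longrightarrow> fps_p_cong p M (f i) (g i)) \<Longrightarrow> fps_p_cong p M (\<Sum>i\<in>A. f i) (\<Sum>i\<in>A. g i)"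
  by (induction A rule: infinite_finite_induct) auto

lemma fps_p_cong_prod:
  assumes "\<And>i. i \<in> A \<Longrightarrow> fps_p_cong p M (f i) (g i)"
    "\<And>i. i \<in> A \<Longrightarrow> fps_p_integral p (f i)" "\<And>i. i \<in> A \<Longrightarrow> fps_p_integral p (g i)"
  shows "fps_p_cong p M (\<Prod>i\<in>A. f i) (\<Prod>i\<in>A. g i)"
  using assms by (induction A rule: infinite_finite_induct) (auto intro!: fps_p_cong_mult)

lemma fps_p_cong_const: "p_cong p c d \<Longrightarrow> fps_p_cong p M (fps_const c) (fps_const d)"
  by (auto simp: fps_p_cong_def fps_const_def)

end

section \<open>Bernoulli numbers and harmonic sums\<close>

text \<open>The series X / (exp X - 1), the quotient being justified by
  \<open>bernoulli_fps_mult\<close>.\<close>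

definition bernoulli_fps :: "rat fps" where
  "bernoulli_fps = Abs_fps (\<lambda>n. bernoulli n / fact n)"

lemma sum_choose_bernoulli: "(\<Sum>j\<le>Suc m. of_nat (m + 2 choose j) * bernoulli j) = 0"
proof -
  have "m + 2 choose Suc m = m + 2"
    using binomial_symmetric[of "Suc m" "m + 2"] by simp
  then show ?thesis
    using bernoulli.simps(2)[of m] by (simp del: bernoulli.simps)
qed

lemma bernoulli_fps_mult: "bernoulli_fps * (fps_exp 1 - 1) = fps_X"
proof (rule fps_ext)
  fix n
  show "fps_nth (bernoulli_fps * (fps_exp 1 - 1)) n = fps_nth fps_X n"
  proof (cases "n \<le> 1")
    case True
    \<comment> \<open>The recursion governs the coefficients from degree 2 on; the two lower ones
      are computed directly.\<close>
    then have "n = 0 \<or> n = 1" by auto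
    then show ?thesis by (auto simp: fps_mult_nth bernoulli_fps_def)
  next
    case False
    define m where "m = n - 2"
    with False have n: "n = m + 2" by simp
    have "fps_nth (bernoulli_fps * (fps_exp 1 - 1)) n = (\<Sum>j\<le>n. bernoulli j / fact j * (if n - j = 0 then 0 else 1 / fact (n - j)))"
      unfolding fps_mult_nth atLeast0AtMost
      by (intro sum.cong refl) (auto simp: bernoulli_fps_def)
    also have "{..n} = insert n {..Suc m}" using n by auto
    also have "(\<Sum>j\<in>insert n {..Suc m}. bernoulli j / fact j * (if n - j = 0 then 0 else 1 / fact (n - j))) =
       (\<Sum>j\<le>Suc m. bernoulli j / fact j * (if n - j = 0 then 0 else 1 / fact (n - j)))"
      by (subst sum.insert) (auto simp: n)
    also have "\<dots> = (\<Sum>j\<le>Suc m. of_nat (n choose j) * bernoulli j) / fact n"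
      unfolding sum_divide_distrib
      by (intro sum.cong refl) (auto simp: n binomial_fact)
    finally show ?thesis
      using sum_choose_bernoulli[of m] False by (simp add: n fps_X_def)
  qed
qed

text \<open>This is 2X / (exp (2X) - 1). Its difference from \<open>bernoulli_fps\<close> is X /
  (exp X + 1), the series behind alternating power sums. The resulting factor 1 - 2^n on the
  coefficients is the origin of 1 - 2^(1-k).\<close>

definition bernoulli_fps2 :: "rat fps" where
  "bernoulli_fps2 = Abs_fps (\<lambda>n. 2 ^ n * bernoulli n / fact n)"

text \<open>After multiplication by exp X - 1 the claim rests on exp (2X) - 1 = (exp X - 1)(exp X +
  1); the nonzero factor is then cancelled.\<close>

lemma bernoulli_fps_diff: "(bernoulli_fps - bernoulli_fps2) * (fps_exp 1 + 1) = fps_X"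
proof -
  have "bernoulli_fps2 = bernoulli_fps oo (fps_const 2 * fps_X)"
    by (simp add: fps_compose_linear bernoulli_fps_def bernoulli_fps2_def)
  moreover have "(bernoulli_fps * (fps_exp 1 - 1)) oo (fps_const 2 * fps_X) = fps_const 2 * fps_X"
    unfolding bernoulli_fps_mult by simp
  ultimately have 2: "bernoulli_fps2 * (fps_exp 2 - 1) = fps_const 2 * fps_X"
    by (simp add: fps_compose_mult_distrib fps_compose_sub_distrib)
  have e: "fps_exp 2 = fps_exp 1 * (fps_exp 1 :: rat fps)"
    using fps_exp_add_mult[of "1 :: rat" 1] by simp
  have "((bernoulli_fps - bernoulli_fps2) * (fps_exp 1 + 1)) * (fps_exp 1 - 1)
     = (bernoulli_fps * (fps_exp 1 - 1)) * (fps_exp 1 + 1) - bernoulli_fps2 * (fps_exp 2 - 1)"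
    unfolding e by (simp add: algebra_simps)
  also have "\<dots> = fps_X * (fps_exp 1 - 1)"
    unfolding bernoulli_fps_mult 2 by (simp add: algebra_simps numeral_fps_const[symmetric])
  finally show ?thesis by simp
qed

lemma fps_exp_of_nat: "fps_exp (of_nat j) = fps_exp (1 :: rat) ^ j"
  by (simp add: fps_exp_power_mult)

text \<open>The geometric series gives (exp (qX) - 1) / (exp X - 1); comparing coefficients of
  X^(n+1) yields Faulhaber's formula.\<close>

lemma fps_X_mult_power_sums:
  "fps_X * (\<Sum>j<q. fps_exp (of_nat j)) = bernoulli_fps * (fps_exp (of_nat q) - 1 :: rat fps)"
proof -
  have "(fps_exp 1 - 1 :: rat fps) * (\<Sum>j<q. fps_exp (of_nat j)) = fps_exp (of_nat q) - 1"
    unfolding fps_exp_of_nat by (simp add: power_diff_1_eq)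
  then show ?thesis
    unfolding bernoulli_fps_mult[symmetric] by (simp add: mult.assoc)
qed

text \<open>Oddness of q turns (- exp X)^q into - exp (qX), so the numerator becomes exp (qX) + 1,
  with constant term 2.\<close>

lemma fps_X_mult_alternating_power_sums:
  assumes "odd q"
  shows "fps_X * (\<Sum>j<q. (-1) ^ j * fps_exp (of_nat j)) =
    (bernoulli_fps - bernoulli_fps2) * (fps_exp (of_nat q) + 1 :: rat fps)"
proof -
  have "(- fps_exp 1) ^ q - 1 = (- fps_exp 1 - 1 :: rat fps) * (\<Sum>j<q. (- fps_exp 1) ^ j)"
    by (rule power_diff_1_eq)
  also have "(- fps_exp 1 :: rat fps) ^ q = - (fps_exp 1 ^ q)" using assms by simp
  also have "- fps_exp 1 - 1 = - (fps_exp 1 + 1 :: rat fps)" by simp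
  finally have "(fps_exp 1 + 1 :: rat fps) * (\<Sum>j<q. (- fps_exp 1) ^ j) = fps_exp 1 ^ q + 1"
    by (simp add: algebra_simps)
  moreover have "(- fps_exp 1 :: rat fps) ^ j = (-1) ^ j * fps_exp (of_nat j)" for j
    unfolding fps_exp_of_nat by (rule power_minus)
  ultimately have "(fps_exp 1 + 1 :: rat fps) * (\<Sum>j<q. (-1) ^ j * fps_exp (of_nat j)) = fps_exp (of_nat q) + 1"
    by (simp add: fps_exp_of_nat)
  then show ?thesis
    unfolding bernoulli_fps_diff[symmetric] by (simp add: mult.assoc)
qed

text \<open>Formally \<open>1 / (x - c X)\<close>.\<close>

definition fps_geometric :: "rat \<Rightarrow> rat \<Rightarrow> rat fps" where
  "fps_geometric x c = Abs_fps (\<lambda>n. c ^ n / x ^ Suc n)"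

lemma linear_mult_fps_geometric:
  assumes "x \<noteq> 0"
  shows "(fps_const x - fps_const c * fps_X) * fps_geometric x c = 1"
proof (rule fps_ext)
  fix n
  show "fps_nth ((fps_const x - fps_const c * fps_X) * fps_geometric x c) n = fps_nth 1 n"
    using assms by (cases n) (simp_all add: fps_geometric_def left_diff_distrib mult.assoc)
qed

context prime_nat
begin

text \<open>To produce B_n the recursion divides only by n + 1, which is still below p.\<close>

lemma p_integral_bernoulli: "n < p - 1 \<Longrightarrow> p_integral p (bernoulli n)"
proof (induction n rule: less_induct)
  case (less n)
  show ?case
  proof (cases n)
    case (Suc m)
    have "\<not> p dvd m + 2" using less.prems Suc by (intro not_dvd_less) auto
    moreover have "p_integral p (- (\<Sum>j\<le>m. of_nat (m + 2 choose j) * bernoulli j))"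
      using less Suc by (intro p_integral_uminus p_integral_sum p_integral_mult p_integral_of_nat) auto
    ultimately show ?thesis
      unfolding Suc bernoulli.simps by (rule p_integral_divide[rotated])
  qed auto
qed

lemma p_integral_divide_fact: "p_integral p x \<Longrightarrow> n < p \<Longrightarrow> p_integral p (x / fact n)"
  using p_integral_divide[of x "fact n"] not_dvd_fact[of n] by simp

text \<open>In Faulhaber's formula every coefficient of exp (pX) - 1 carries a factor p, and the
  factorials in the denominators are prime to p because n + 1 < p. For n = 0 the term 0^0 = 1 makes
  the sum equal to p.\<close>

lemma power_sum_p_cong:
  assumes "n < p - 1"
  shows "p_cong p (\<Sum>j<p. of_nat j ^ n) 0"
proof -
  have "p \<noteq> 0" using prime by auto
  have "(\<Sum>j<p. of_nat j ^ n) / fact n = fps_nth (fps_X * (\<Sum>j<p. fps_exp (of_nat j :: rat))) (Suc n)"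
    by (simp add: fps_sum_nth sum_divide_distrib)
  also have "\<dots> = (\<Sum>i=0..Suc n. bernoulli i / fact i * fps_nth (fps_exp (of_nat p) - 1) (Suc n - i))"
    unfolding fps_X_mult_power_sums fps_mult_nth by (simp add: bernoulli_fps_def)
  finally have "(\<Sum>j<p. of_nat j ^ n) =
    (\<Sum>i=0..Suc n. fact n * (bernoulli i / fact i * fps_nth (fps_exp (of_nat p) - 1) (Suc n - i)))"
    unfolding sum_distrib_left[symmetric] by (simp add: divide_eq_eq mult.commute del: sum.atLeast0_atMost_Suc)
  also have "p_cong p \<dots> (\<Sum>i=0..Suc n. 0)"
  proof (intro p_cong_sum)
    fix i assume i: "i \<in> {0..Suc n}"
    show "p_cong p (fact n * (bernoulli i / fact i * fps_nth (fps_exp (of_nat p) - 1) (Suc n - i))) 0"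
    proof (cases "i = Suc n")
      case False
      with i have i: "i \<le> n" by simp
      have "p_integral p (fact n * (bernoulli i / fact i * (of_nat p ^ (n - i) / fact (Suc n - i))))"
      proof (intro p_integral_mult p_integral_divide_fact p_integral_power p_integral_of_nat)
        show "p_integral p (fact n)" using p_integral_of_nat[of "fact n"] by simp
        show "p_integral p (bernoulli i)" using i assms by (intro p_integral_bernoulli) auto
      qed (use assms i in auto)
      from p_cong_mult_p[OF this]
      show ?thesis using i by (simp add: Suc_diff_le mult_ac del: fact_Suc)
    qed simp
  qed
  finally show ?thesis by simp
qed

section \<open>Harmonic and alternating harmonic sums modulo p\<close>

lemma inverse_power_p_cong:
  assumes "0 < j" "j < p" "k < p"
  shows "p_cong p (1 / of_nat j ^ k) (of_nat j ^ (p - 1 - k))"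
proof -
  have "\<not> p dvd j" using assms by (simp add: nat_dvd_not_less)
  from p_cong_mult_left[OF p_cong_sym[OF p_cong_fermat[OF this]] p_integral_inverse[OF not_dvd_power[OF this, of k]]]
  have "p_cong p (1 / of_nat j ^ k) (of_nat j ^ (p - 1) / of_nat j ^ k)" by simp
  also have "of_nat j ^ (p - 1) / of_nat j ^ k = (of_nat j :: rat) ^ (p - 1 - k)"
    using assms by (simp add: power_diff)
  finally show ?thesis .
qed

lemma lessThan_p: "{..<p} = insert 0 {1..<p}"
  using prime by (auto simp: prime_gt_0_nat)

text \<open>By Fermat this is a power sum with exponent p - 1 - k between 1 and p - 2, to which j =
  0 contributes nothing.\<close>

lemma harmonic_p_cong:
  assumes "0 < k" "k < p - 1"
  shows "p_cong p (\<Sum>j\<in>{1..<p}. 1 / of_nat j ^ k) 0"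
proof -
  have "p_cong p (\<Sum>j\<in>{1..<p}. 1 / of_nat j ^ k) (\<Sum>j\<in>{1..<p}. of_nat j ^ (p - 1 - k))"
    using assms by (intro p_cong_sum inverse_power_p_cong) auto
  also have "(\<Sum>j\<in>{1..<p}. of_nat j ^ (p - 1 - k)) = (\<Sum>j<p. rat_of_nat j ^ (p - 1 - k))"
    unfolding lessThan_p using assms by (subst sum.insert) auto
  also have "p_cong p \<dots> 0"
    using assms by (intro power_sum_p_cong) auto
  finally show ?thesis .
qed

text \<open>Among the coefficients of exp (pX) + 1 only the constant term 2 lacks a factor p. It is
  paired with the index n + 1, so a single Bernoulli number survives.\<close>

lemma alternating_power_sum_p_cong:
  assumes "odd p" "Suc n < p - 1"
  shows "p_cong p (of_nat (Suc n) * (\<Sum>j<p. (-1) ^ j * of_nat j ^ n)) (2 * (1 - 2 ^ Suc n) * bernoulli (Suc n))"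
proof -
  define D where "D = (\<lambda>i. (1 - 2 ^ i) * bernoulli i)"
  have "(\<Sum>j<p. (-1) ^ j * of_nat j ^ n) / fact n = fps_nth (fps_X * (\<Sum>j<p. (-1) ^ j * fps_exp (of_nat j :: rat))) (Suc n)"
  proof -
    have "fps_nth ((-1) ^ j * F) m = (-1) ^ j * fps_nth F m" for j m and F :: "rat fps"
      by (cases "even j") auto
    then show ?thesis by (simp add: fps_sum_nth sum_divide_distrib)
  qed
  also have "\<dots> = (\<Sum>i=0..Suc n. D i / fact i * fps_nth (fps_exp (of_nat p) + 1) (Suc n - i))"
    unfolding fps_X_mult_alternating_power_sums[OF assms(1)] fps_mult_nth
    by (intro sum.cong refl) (simp add: bernoulli_fps_def bernoulli_fps2_def D_def algebra_simps diff_divide_distrib)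
  finally have "of_nat (Suc n) * (\<Sum>j<p. (-1) ^ j * of_nat j ^ n) =
    fact (Suc n) * (\<Sum>i=0..Suc n. (D i / fact i * fps_nth (fps_exp (of_nat p) + 1) (Suc n - i)))"
    by (simp add: divide_eq_eq mult_ac del: sum.atLeast0_atMost_Suc)
  also have "\<dots> = (\<Sum>i=0..Suc n. fact (Suc n) * (D i / fact i * fps_nth (fps_exp (of_nat p) + 1) (Suc n - i)))"
    by (rule sum_distrib_left)
  also have "p_cong p \<dots> (\<Sum>i=0..Suc n. if i = Suc n then 2 * D (Suc n) else 0)"
  proof (intro p_cong_sum)
    fix i assume i: "i \<in> {0..Suc n}"
    show "p_cong p (fact (Suc n) * (D i / fact i * fps_nth (fps_exp (of_nat p) + 1) (Suc n - i)))
      (if i = Suc n then 2 * D (Suc n) else 0)"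
    proof (cases "i = Suc n")
      case False
      with i have i: "i \<le> n" by simp
      have "p_integral p (fact (Suc n) * (D i / fact i * (of_nat p ^ (n - i) / fact (Suc n - i))))"
      proof (intro p_integral_mult p_integral_divide_fact p_integral_power p_integral_of_nat)
        show "p_integral p (fact (Suc n))" using p_integral_of_nat[of "fact (Suc n)"] by (simp only: of_nat_fact)
        have "p_integral p (bernoulli i)" using i assms by (intro p_integral_bernoulli) auto
        then show "p_integral p (D i)" unfolding D_def by auto
      qed (use assms i in auto)
      from p_cong_mult_p[OF this]
      show ?thesis using i by (simp add: Suc_diff_le mult_ac del: fact_Suc)
    qed (simp add: mult.commute del: fact_Suc)
  qed
  also have "(\<Sum>i=0..Suc n. if i = Suc n then 2 * D (Suc n) else 0) = 2 * D (Suc n)"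
    by simp
  finally show ?thesis by (simp only: D_def mult.assoc)
qed

text \<open>Fermat replaces 1/j^k by j^n with n + 1 = p - k. Modulo p this n + 1 is -k, which brings
  the sign and the denominator k, while 2^(n+1) = 2^(p-1) / 2^(k-1) becomes 2^(1-k).\<close>

lemma alternating_harmonic_p_cong:
  assumes "odd p" "2 \<le> k" "k < p - 1"
  shows "p_cong p (\<Sum>j\<in>{1..<p}. (-1) ^ j / of_nat j ^ k)
     (- 2 * (1 - 1 / 2 ^ (k - 1)) * bernoulli (p - k) / of_nat k)"
proof -
  define n where "n = p - 1 - k"
  have n: "Suc n = p - k" "n > 0" "Suc n < p - 1" using assms by (auto simp: n_def)
  define S where "S = (\<Sum>j<p. (-1) ^ j * rat_of_nat j ^ n)"
  have S: "p_integral p S" 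
    unfolding S_def by (intro p_integral_sum p_integral_mult p_integral_power p_integral_uminus) auto
  have B: "p_integral p (bernoulli (p - k))" using assms by (intro p_integral_bernoulli) auto
  have "\<not> p dvd 2" using assms(1) by (metis dvd_refl prime primes_dvd_imp_eq two_is_prime_nat)
  then have p2: "\<not> p dvd 2 ^ m" for m by (rule not_dvd_power)
  have "p_cong p (\<Sum>j\<in>{1..<p}. (-1) ^ j * (1 / of_nat j ^ k)) (\<Sum>j\<in>{1..<p}. (-1) ^ j * of_nat j ^ n)"
    unfolding n_def using assms by (intro p_cong_sum p_cong_mult_left inverse_power_p_cong) auto
  also have "(\<Sum>j\<in>{1..<p}. (-1) ^ j * of_nat j ^ n) = S"
    unfolding S_def lessThan_p using n by (subst sum.insert) auto
  finally have 1: "p_cong p (\<Sum>j\<in>{1..<p}. (-1) ^ j / of_nat j ^ k) S" by simp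
  have "p_cong p (of_nat k * S) (of_nat k * S - of_nat p * S)"
    using p_cong_diff[OF p_cong_refl p_cong_sym[OF p_cong_mult_p[OF S]], of "of_nat k * S"] by simp
  also have "of_nat k * S - of_nat p * S = - (of_nat (Suc n) * S)"
    unfolding n(1) using assms by (simp add: of_nat_diff algebra_simps)
  also have "p_cong p \<dots> (- (2 * (1 - 2 ^ Suc n) * bernoulli (Suc n)))"
    unfolding S_def using alternating_power_sum_p_cong[OF assms(1) n(3)] by (rule p_cong_uminus)
  also have "p_cong p \<dots> (- (2 * (1 - 1 / 2 ^ (k - 1)) * bernoulli (Suc n)))"
  proof -
    have "p_cong p (2 ^ (p - 1)) 1" using p_cong_fermat[OF \<open>\<not> p dvd 2\<close>] by simp
    also have "p - 1 = (k - 1) + Suc n" using assms n by simp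
    finally have "p_cong p (of_nat (2 ^ (k - 1)) * 2 ^ Suc n) (of_nat (2 ^ (k - 1)) * (1 / 2 ^ (k - 1)))"
      by (simp add: power_add mult_ac)
    then have *: "p_cong p (2 ^ Suc n) (1 / 2 ^ (k - 1))"
      using p2 by (rule p_cong_cancel)
    have i: "p_integral p (1 / 2 ^ (k - 1))" using p_integral_inverse[OF p2] by simp
    show ?thesis
      unfolding n(1)
      by (intro p_cong_uminus p_cong_mult p_cong_refl p_cong_diff *[unfolded n(1)] p_integral_mult p_integral_diff p_integral_power B i) auto
  qed
  also have "- (2 * (1 - 1 / 2 ^ (k - 1)) * bernoulli (Suc n)) =
      of_nat k * (- 2 * (1 - 1 / 2 ^ (k - 1)) * bernoulli (p - k) / of_nat k)"
    unfolding n(1) using assms by simp (simp add: algebra_simps)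
  finally have "p_cong p (of_nat k * S) (of_nat k * (- 2 * (1 - 1 / 2 ^ (k - 1)) * bernoulli (p - k) / of_nat k))" .
  then have "p_cong p S (- 2 * (1 - 1 / 2 ^ (k - 1)) * bernoulli (p - k) / of_nat k)"
    by (rule p_cong_cancel) (use assms in \<open>intro not_dvd_less, auto\<close>)
  with 1 show ?thesis by (rule p_cong_trans)
qed

lemma inverse_power_reflect_p_cong:
  assumes "0 < j" "j < p"
  shows "p_cong p (1 / of_nat (p - j) ^ k) ((-1) ^ k / of_nat j ^ k)"
proof -
  have "of_nat (p - j) - (-1) * of_nat j = of_nat p * (1 :: rat)"
    using assms by (simp add: of_nat_diff)
  then have "p_cong p (of_nat (p - j)) (-1 * of_nat j)"
    unfolding p_cong_def by blast
  then have "p_cong p (of_nat (p - j) ^ k) ((-1 * of_nat j) ^ k)"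
    by (rule p_cong_power) auto
  then have "p_cong p (of_nat ((p - j) ^ k)) ((-1) ^ k * of_nat (j ^ k))"
    by (simp only: power_mult_distrib of_nat_power)
  moreover have "\<not> p dvd (p - j) ^ k" "\<not> p dvd j ^ k"
    using assms by (intro not_dvd_power not_dvd_less; simp)+
  moreover have "p_integral p ((-1) ^ k)"
    by (intro p_integral_power p_integral_uminus p_integral_1)
  ultimately have "p_cong p (1 / of_nat ((p - j) ^ k)) ((-1) ^ k / of_nat (j ^ k))"
    by (intro p_cong_inverse) (simp_all flip: power_mult_distrib)
  then show ?thesis by simp
qed

text \<open>The reflection j -> p - j preserves even powers modulo p but flips (-1)^j because p is
  odd, so the sum is congruent to its own negative. Here this plays the part of the vanishing of
  Bernoulli numbers of odd index.\<close>

lemma alternating_harmonic_even_p_cong: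
  assumes "odd p" "even k"
  shows "p_cong p (\<Sum>j\<in>{1..<p}. (-1) ^ j / of_nat j ^ k) 0"
proof -
  let ?S = "\<Sum>j\<in>{1..<p}. (-1) ^ j * (1 / rat_of_nat j ^ k)"
  have "?S = (\<Sum>j\<in>{1..<p}. (-1) ^ (p - j) * (1 / of_nat (p - j) ^ k))"
    by (rule sum.reindex_bij_witness[of _ "\<lambda>j. p - j" "\<lambda>j. p - j"]) auto
  also have "p_cong p \<dots> (\<Sum>j\<in>{1..<p}. (-1) ^ (p - j) * ((-1) ^ k / of_nat j ^ k))"
    by (intro p_cong_sum p_cong_mult_left inverse_power_reflect_p_cong) auto
  also have "\<dots> = - ?S"
    unfolding sum_negf[symmetric]
  proof (intro sum.cong refl)
    fix j assume "j \<in> {1..<p}"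
    then have "even (p - j) \<longleftrightarrow> odd j" using assms(1) by auto
    then show "(-1) ^ (p - j) * ((-1) ^ k / of_nat j ^ k) = - ((-1) ^ j * (1 / rat_of_nat j ^ k))"
      using assms(2) by (cases "even j") auto
  qed
  finally have "p_cong p ?S (- ?S)" .
  then have "p_cong p (of_nat 2 * ?S) (of_nat 2 * 0)"
    using p_cong_add[OF _ p_cong_refl, of ?S "- ?S" ?S] by simp
  then have "p_cong p ?S 0"
    by (rule p_cong_cancel) (metis assms(1) dvd_refl prime primes_dvd_imp_eq two_is_prime_nat)
  then show ?thesis by simp
qed

section \<open>Products of linear factors modulo p\<close>

lemma fps_p_integral_geometric:
  assumes "\<not> p dvd n" "p_integral p c"
  shows "fps_p_integral p (fps_geometric (of_nat n) c)"
proof -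
  have "p_integral p (c ^ m / of_nat (n ^ Suc m))" for m
    by (intro p_integral_divide p_integral_power not_dvd_power assms)
  then show ?thesis by (simp add: fps_p_integral_def fps_geometric_def)
qed

text \<open>The logarithmic derivative of the product has harmonic sums as coefficients, which
  vanish modulo p in degrees below p - 2. Integration divides the coefficient of X^n by n, a unit
  for 0 < n < p - 1. Degree p - 1 lies beyond the bound: its coefficient is (-c)^(p-1).\<close>

lemma prod_linear_p_cong:
  assumes c: "p_integral p c"
  shows "fps_p_cong p (p - 1) (\<Prod>r\<in>{1..<p}. of_nat r - fps_const c * fps_X) (fact (p - 1))"
proof -
  \<comment> \<open>The factors are normalized to constant term 1; \<open>H r\<close> is minus the
    logarithmic derivative of \<open>L r\<close>.\<close>
  define L where "L = (\<lambda>r::nat. 1 - fps_const (c / of_nat r) * fps_X)"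
  define H where "H = (\<lambda>r::nat. fps_const (c / of_nat r) * fps_geometric 1 (c / of_nat r))"
  define F where "F = (\<Prod>r\<in>{1..<p}. L r)"
  have "fps_deriv (\<Prod>r\<in>A. L r) = - (\<Prod>r\<in>A. L r) * (\<Sum>r\<in>A. H r)" if "finite A" for A
    using that
  proof (induction A rule: finite_induct)
    case (insert a A)
    have "L a * H a = fps_const (c / of_nat a)"
      using linear_mult_fps_geometric[of 1 "c / of_nat a"] by (simp add: L_def H_def mult.left_commute)
    moreover have "fps_deriv (L a) = - fps_const (c / of_nat a)"
      by (simp add: L_def)
    ultimately have "fps_deriv (L a) = - (L a * H a)" by simp
    then show ?case
      using insert by (simp add: algebra_simps)
  qed simp
  then have F': "fps_deriv F = - F * (\<Sum>r\<in>{1..<p}. H r)"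
    by (simp add: F_def)
  have intL: "p_integral p (c / of_nat r)" if "r \<in> {1..<p}" for r
    using that c by (intro p_integral_divide not_dvd_less) auto
  have F_int: "fps_p_integral p F"
    unfolding F_def L_def using intL by (intro fps_p_integral_prod fps_p_integral_diff fps_p_integral_mult) auto
  have "fps_p_cong p (p - 2) (- F * (\<Sum>r\<in>{1..<p}. H r)) (- F * 0)"
  proof (rule fps_p_cong_mult_left)
    show "fps_p_cong p (p - 2) (\<Sum>r\<in>{1..<p}. H r) 0"
      unfolding fps_p_cong_def
    proof safe
      fix n assume "n < p - 2"
      then have "p_cong p (c ^ Suc n * (\<Sum>r\<in>{1..<p}. 1 / of_nat r ^ Suc n)) (c ^ Suc n * 0)"
        by (intro p_cong_mult_left harmonic_p_cong p_integral_power c) auto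
      then show "p_cong p (fps_nth (\<Sum>r\<in>{1..<p}. H r) n) (fps_nth 0 n)"
        by (simp add: fps_sum_nth H_def fps_geometric_def sum_distrib_left power_divide)
    qed
  qed (use F_int in auto)
  then have *: "fps_p_cong p (p - 2) (fps_deriv F) 0"
    unfolding F' by simp
  have "fps_p_cong p (p - 1) F 1"
    unfolding fps_p_cong_def
  proof safe
    fix n assume n: "n < p - 1"
    show "p_cong p (fps_nth F n) (fps_nth 1 n)"
    proof (cases n)
      case 0
      have "fps_nth (\<Prod>r\<in>A. L r) 0 = 1" for A
        by (induction A rule: infinite_finite_induct) (auto simp: L_def)
      then show ?thesis using 0 by (simp add: F_def)
    next
      case (Suc m)
      then have "m < p - 2" using n by auto
      with * have "p_cong p (fps_nth (fps_deriv F) m) (fps_nth 0 m)"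
        unfolding fps_p_cong_def by blast
      then have "p_cong p (of_nat n * fps_nth F n) (of_nat n * 0)"
        by (simp add: Suc)
      then have "p_cong p (fps_nth F n) 0"
        by (rule p_cong_cancel) (use n Suc in \<open>intro not_dvd_less, auto\<close>)
      then show ?thesis by (simp add: Suc)
    qed
  qed
  then have "fps_p_cong p (p - 1) (of_nat (fact (p - 1)) * F) (of_nat (fact (p - 1)) * 1)"
    by (rule fps_p_cong_mult_left) (rule fps_p_integral_of_nat)
  moreover have "(\<Prod>r\<in>{1..<p}. of_nat r - fps_const c * fps_X) = of_nat (fact (p - 1)) * F"
  proof -
    have "(\<Prod>r\<in>{1..<p}. of_nat r - fps_const c * fps_X) = (\<Prod>r\<in>{1..<p}. of_nat r * L r)"
    proof (intro prod.cong refl)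
      fix r assume "r \<in> {1..<p}"
      then have "rat_of_nat r * (c / of_nat r) = c" by simp
      then show "of_nat r - fps_const c * fps_X = of_nat r * L r"
        unfolding L_def fps_of_nat[symmetric] right_diff_distrib mult.assoc[symmetric] fps_const_mult by simp
    qed
    also have "\<dots> = of_nat (\<Prod>r\<in>{1..<p}. r) * F"
      by (simp add: prod.distrib F_def)
    also have "(\<Prod>r\<in>{1..<p}. r) = fact (p - 1)"
      unfolding fact_prod of_nat_id by (intro prod.cong) (use prime_gt_0_nat[OF prime] in auto)
    finally show ?thesis .
  qed
  ultimately show ?thesis by simp
qed

end

section \<open>Generating functions of nested sums\<close>

text \<open>With \<open>c = 1\<close> and \<open>h m = m\<close> this is the truncated star sum, with \<open>c = -1\<close> and
  \<open>h m = m - 1\<close> the truncated non-star sum times \<open>(-1)\<close> to the depth.\<close>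

fun nested_sum :: "(nat \<Rightarrow> nat) \<Rightarrow> rat \<Rightarrow> nat \<Rightarrow> nat list \<Rightarrow> rat" where
  "nested_sum h c n [] = 1"
| "nested_sum h c n (k # ks) = (\<Sum>m\<in>{1..n}. c / of_nat m ^ k * nested_sum h c (h m) ks)"

text \<open>The relation \<open>R\<close> is \<ge> for the star sums and > for the others. The
  equivalence is asked for positive m only, since truncated subtraction gives \<open>h 0 = 0\<close>
  in the strict case although 0 > 0 fails.\<close>

lemma nested_sum_eq:
  assumes h: "\<And>m. h m \<le> m" and R: "\<And>m x. m > 0 \<Longrightarrow> R m x \<longleftrightarrow> x \<le> h m"
  shows "nested_sum h c n ks = c ^ length ks *
    (\<Sum>ms | length ms = length ks \<and> set ms \<subseteq> {0<..n} \<and> sorted_wrt R ms.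
       1 / (\<Prod>i<length ks. of_nat (ms ! i) ^ (ks ! i)))"
proof (induction ks arbitrary: n)
  case Nil
  have "{ms. length ms = 0 \<and> set ms \<subseteq> {0<..n} \<and> sorted_wrt R ms} = {[]}" by auto
  then show ?case by simp
next
  case (Cons k ks)
  define S where "S = (\<lambda>b ks. {ms. length ms = length (ks :: nat list) \<and> set ms \<subseteq> {0<..b} \<and> sorted_wrt R ms})"
  have fin: "finite (S b ks)" for b ks
  proof (rule finite_subset)
    show "S b ks \<subseteq> {ms. set ms \<subseteq> {0<..b} \<and> length ms = length ks}" by (auto simp: S_def)
  qed (simp add: finite_lists_length_eq)
  \<comment> \<open>\<open>sorted_wrt\<close> compares the head with every later entry; all these
    conditions merge into the one upper bound \<open>h m\<close> on the tail.\<close>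
  have mem: "m # ms \<in> S n (k # ks) \<longleftrightarrow> m \<in> {1..n} \<and> ms \<in> S (h m) ks" for m ms
  proof (cases "m \<in> {1..n}")
    case True
    then have "R m x \<longleftrightarrow> x \<le> h m" for x using R by auto
    moreover have "x \<le> n" if "x \<le> h m" for x using that h[of m] True by auto
    ultimately show ?thesis using True by (auto simp: S_def)
  qed (auto simp: S_def)
  have "nested_sum h c n (k # ks) = (\<Sum>m\<in>{1..n}. \<Sum>ms\<in>S (h m) ks.
     c / of_nat m ^ k * (c ^ length ks * (1 / (\<Prod>i<length ks. of_nat (ms ! i) ^ (ks ! i)))))"
    by (simp add: Cons.IH S_def sum_distrib_left)
  also have "\<dots> = (\<Sum>(m, ms)\<in>(SIGMA m:{1..n}. S (h m) ks).
     c / of_nat m ^ k * (c ^ length ks * (1 / (\<Prod>i<length ks. of_nat (ms ! i) ^ (ks ! i)))))"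
    by (rule sum.Sigma) (use fin in auto)
  also have "\<dots> = (\<Sum>ms\<in>S n (k # ks). c ^ length (k # ks) * (1 / (\<Prod>i<length (k # ks). of_nat (ms ! i) ^ ((k # ks) ! i))))"
  proof (rule sum.reindex_bij_witness[of _ "\<lambda>ms. (hd ms, tl ms)" "\<lambda>(m, ms). m # ms"])
    fix ms assume "ms \<in> S n (k # ks)"
    moreover from this have "ms \<noteq> []" by (auto simp: S_def)
    ultimately show "(hd ms, tl ms) \<in> (SIGMA m:{1..n}. S (h m) ks)" "(case (hd ms, tl ms) of (m, ms) \<Rightarrow> m # ms) = ms"
      using mem[of "hd ms" "tl ms"] by auto
  next
    fix x assume x: "x \<in> (SIGMA m:{1..n}. S (h m) ks)"
    obtain m ms where [simp]: "x = (m, ms)" by force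
    show "(case x of (m, ms) \<Rightarrow> m # ms) \<in> S n (k # ks)"
      using x mem[of m ms] by simp
    show "c ^ length (k # ks) * (1 / (\<Prod>i<length (k # ks). of_nat ((case x of (m, ms) \<Rightarrow> m # ms) ! i) ^ ((k # ks) ! i))) =
      (case x of (m, ms) \<Rightarrow> c / of_nat m ^ k * (c ^ length ks * (1 / (\<Prod>i<length ks. of_nat (ms ! i) ^ (ks ! i)))))"
      by (simp add: prod.lessThan_Suc_shift del: prod.lessThan_Suc)
  qed auto
  finally show ?case by (simp add: S_def sum_distrib_left)
qed

lemma zeta_star_sum_eq_nested_sum:
  assumes "p > 0"
  shows "zeta_star_sum ks p = nested_sum (\<lambda>m. m) 1 (p - 1) ks"
proof -
  have "{0<..<p} = {0<..p - 1}" using assms by auto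
  then show ?thesis
    unfolding zeta_star_sum_def by (subst nested_sum_eq[where R = "(\<ge>)"]) auto
qed

lemma zeta_sum_eq_nested_sum:
  assumes "p > 0"
  shows "(-1) ^ length ks * zeta_sum ks p = nested_sum (\<lambda>m. m - 1) (-1) (p - 1) ks"
proof -
  have "{0<..<p} = {0<..p - 1}" using assms by auto
  then show ?thesis
    unfolding zeta_sum_def by (subst nested_sum_eq[where R = "(>)"]) auto
qed

section \<open>Compositions and generating functions by weight and height\<close>

definition compositions :: "nat \<Rightarrow> nat list set" where
  "compositions k = {ks. (\<forall>x\<in>set ks. x > 0) \<and> sum_list ks = k}"

text \<open>The empty list is no index, but it is kept here as the tail of an index of depth one; it
  gives the constant term 1.\<close>

lemma compositions_0: "compositions 0 = {[]}"
proof -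
  have "ks = []" if "\<forall>x\<in>set ks. x > 0" "sum_list ks = 0" for ks :: "nat list"
    using that by (cases ks) auto
  then show ?thesis by (auto simp: compositions_def)
qed

lemma height_Cons: "height (l # ks) = (if l > 1 then 1 else 0) + height ks"
proof -
  have "{i. i < length (l # ks) \<and> (l # ks) ! i > 1} =
      (if l > 1 then {0} else {}) \<union> Suc ` {i. i < length ks \<and> ks ! i > 1}"
  proof (rule Set.set_eqI)
    fix i show "i \<in> {i. i < length (l # ks) \<and> (l # ks) ! i > 1} \<longleftrightarrow>
        i \<in> (if l > 1 then {0} else {}) \<union> Suc ` {i. i < length ks \<and> ks ! i > 1}"
      by (cases i) auto
  qed
  then show ?thesis
    unfolding height_def by (auto simp: card_image)
qed

lemma height_le_sum_list: "height ks \<le> sum_list ks"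
proof (induction ks)
  case (Cons l ks)
  then show ?case by (auto simp: height_Cons)
qed (simp add: height_def)

lemma finite_compositions: "finite (compositions k)"
proof (rule finite_subset)
  have "length ks \<le> sum_list ks" if "\<forall>x\<in>set ks. x > 0" for ks :: "nat list"
    using that by (induction ks) auto
  then show "compositions k \<subseteq> {ks. set ks \<subseteq> {..k} \<and> length ks \<le> k}"
    by (auto simp: compositions_def dest: member_le_sum_list)
qed (simp add: finite_lists_length_le)

lemma sum_Cons_compositions:
  assumes "finite L"
  shows "(\<Sum>ks\<in>(\<Union>l\<in>L. (#) l ` compositions (k - l)). f ks) = (\<Sum>l\<in>L. \<Sum>ks\<in>compositions (k - l). f (l # ks))"
proof -
  have "(\<Sum>ks\<in>(\<Union>l\<in>L. (#) l ` compositions (k - l)). f ks) = (\<Sum>l\<in>L. \<Sum>ks\<in>(#) l ` compositions (k - l). f ks)"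
    by (rule sum.UNION_disjoint) (use assms finite_compositions in auto)
  then show ?thesis by (simp add: sum.reindex)
qed

lemma Cons_mem_Union_compositions:
  "a # ks \<in> (\<Union>l\<in>L. (#) l ` compositions (k - l)) \<longleftrightarrow> a \<in> L \<and> ks \<in> compositions (k - a)"
  by auto

lemma compositions_eq:
  assumes "k > 0"
  shows "compositions k = (\<Union>l\<in>{1..k}. (#) l ` compositions (k - l))"
proof (rule Set.set_eqI)
  fix ks show "ks \<in> compositions k \<longleftrightarrow> ks \<in> (\<Union>l\<in>{1..k}. (#) l ` compositions (k - l))"
    using assms by (cases ks) (auto simp only: Cons_mem_Union_compositions, auto simp: compositions_def)
qed

lemma admissible_compositions_eq:
  "{ks \<in> compositions k. ks \<noteq> [] \<and> hd ks > 1} = (\<Union>l\<in>{2..k}. (#) l ` compositions (k - l))"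
proof (rule Set.set_eqI)
  fix ks show "ks \<in> {ks \<in> compositions k. ks \<noteq> [] \<and> hd ks > 1} \<longleftrightarrow> ks \<in> (\<Union>l\<in>{2..k}. (#) l ` compositions (k - l))"
    by (cases ks) (auto simp only: Cons_mem_Union_compositions mem_Collect_eq, auto simp: compositions_def)
qed

definition height_weight :: "rat \<Rightarrow> nat \<Rightarrow> rat" where
  "height_weight z l = (if l = 0 then 0 else if l = 1 then 1 else z)"

text \<open>The series f_m, with X for t: the contribution of one summation variable, summed over
  all possible exponents.\<close>

definition entry_fps :: "rat \<Rightarrow> nat \<Rightarrow> rat fps" where
  "entry_fps z m = Abs_fps (\<lambda>l. height_weight z l / of_nat m ^ l)"

text \<open>The part of f_m with exponent at least 2, which encodes the condition k_1 > 1.\<close>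

definition first_entry_fps :: "rat \<Rightarrow> nat \<Rightarrow> rat fps" where
  "first_entry_fps z m = Abs_fps (\<lambda>l. (if l \<le> 1 then 0 else z) / of_nat m ^ l)"

definition nested_sum_fps :: "(nat \<Rightarrow> nat) \<Rightarrow> rat \<Rightarrow> rat \<Rightarrow> nat \<Rightarrow> rat fps" where
  "nested_sum_fps h c z n = Abs_fps (\<lambda>k. \<Sum>ks\<in>compositions k. z ^ height ks * nested_sum h c n ks)"

text \<open>\<open>L\<close> is the set of first entries allowed: all of 1, ..., k for the recursion
  of the generating function, and 2, ..., k for the indices in the theorem.\<close>

lemma sum_Cons_nested_sum:
  assumes "finite L" "0 \<notin> L"
  shows "(\<Sum>ks\<in>(\<Union>l\<in>L. (#) l ` compositions (k - l)). z ^ height ks * nested_sum h c n ks) =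
    c * (\<Sum>m\<in>{1..n}. \<Sum>l\<in>L. height_weight z l / of_nat m ^ l * fps_nth (nested_sum_fps h c z (h m)) (k - l))"
proof -
  have "(\<Sum>ks\<in>(\<Union>l\<in>L. (#) l ` compositions (k - l)). z ^ height ks * nested_sum h c n ks) =
    (\<Sum>l\<in>L. \<Sum>ks\<in>compositions (k - l). z ^ height (l # ks) * nested_sum h c n (l # ks))"
    by (rule sum_Cons_compositions) fact
  also have "\<dots> = (\<Sum>l\<in>L. \<Sum>ks\<in>compositions (k - l). \<Sum>m\<in>{1..n}.
      c * (height_weight z l / of_nat m ^ l * (z ^ height ks * nested_sum h c (h m) ks)))"
  proof (intro sum.cong refl)
    fix l ks assume "l \<in> L"
    then have "l \<noteq> 0" using assms(2) by metis
    then have "z ^ height (l # ks) = height_weight z l * z ^ height ks"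
      by (simp add: height_Cons height_weight_def)
    then show "z ^ height (l # ks) * nested_sum h c n (l # ks) =
      (\<Sum>m\<in>{1..n}. c * (height_weight z l / of_nat m ^ l * (z ^ height ks * nested_sum h c (h m) ks)))"
      by (simp add: sum_distrib_left mult_ac)
  qed
  also have "\<dots> = (\<Sum>l\<in>L. \<Sum>m\<in>{1..n}. \<Sum>ks\<in>compositions (k - l).
      c * (height_weight z l / of_nat m ^ l * (z ^ height ks * nested_sum h c (h m) ks)))"
    by (intro sum.cong refl sum.swap)
  also have "\<dots> = (\<Sum>m\<in>{1..n}. \<Sum>l\<in>L. \<Sum>ks\<in>compositions (k - l).
      c * (height_weight z l / of_nat m ^ l * (z ^ height ks * nested_sum h c (h m) ks)))"
    by (rule sum.swap)
  finally show ?thesis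
    by (simp add: nested_sum_fps_def sum_distrib_left)
qed

lemma nested_sum_fps_eq:
  "nested_sum_fps h c z n = 1 + fps_const c * (\<Sum>m\<in>{1..n}. entry_fps z m * nested_sum_fps h c z (h m))"
proof (rule fps_ext)
  fix k
  show "fps_nth (nested_sum_fps h c z n) k =
    fps_nth (1 + fps_const c * (\<Sum>m\<in>{1..n}. entry_fps z m * nested_sum_fps h c z (h m))) k"
  proof (cases "k = 0")
    case True
    then show ?thesis
      by (simp add: nested_sum_fps_def compositions_0 fps_sum_nth entry_fps_def height_weight_def height_def)
  next
    case False
    have "fps_nth (nested_sum_fps h c z n) k = c * (\<Sum>m\<in>{1..n}. \<Sum>l\<in>{1..k}.
        height_weight z l / of_nat m ^ l * fps_nth (nested_sum_fps h c z (h m)) (k - l))"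
      using False sum_Cons_nested_sum[where L = "{1..k}" and k = k and z = z and h = h and c = c and n = n]
      by (simp add: nested_sum_fps_def[of h c z n] compositions_eq)
    \<comment> \<open>The coefficient of \<open>entry_fps\<close> in degree 0 is 0, so the range
      extends to that of a Cauchy product.\<close>
    also have "{1..k} = {0..k} - {0}" by auto
    also have "(\<Sum>m\<in>{1..n}. \<Sum>l\<in>{0..k} - {0}.
        height_weight z l / of_nat m ^ l * fps_nth (nested_sum_fps h c z (h m)) (k - l)) =
       (\<Sum>m\<in>{1..n}. \<Sum>l\<in>{0..k}.
        height_weight z l / of_nat m ^ l * fps_nth (nested_sum_fps h c z (h m)) (k - l))"
      by (intro sum.cong refl sum.mono_neutral_left) (auto simp: height_weight_def)
    finally show ?thesis
      using False unfolding fps_add_nth fps_mult_left_const_nth fps_sum_nth unfolding fps_mult_nth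
      by (simp add: entry_fps_def)
  qed
qed

text \<open>Grouping by height is exhaustive over s = 1, ..., k: the first entry exceeds 1, so the
  height is positive, and it is at most the weight.\<close>

lemma sum_I0_nested_sum:
  assumes "k > 0"
  shows "(\<Sum>s\<in>{1..k}. z ^ s * (\<Sum>ks\<in>I\<^sub>0 k s. nested_sum h c n ks)) =
    fps_nth (fps_const c * (\<Sum>m\<in>{1..n}. first_entry_fps z m * nested_sum_fps h c z (h m))) k"
proof -
  define J where "J = {ks \<in> compositions k. ks \<noteq> [] \<and> hd ks > 1}"
  have I0: "I\<^sub>0 k s = {ks \<in> J. height ks = s}" for s
    by (auto simp: I\<^sub>0_def J_def compositions_def)
  have "height ks \<in> {1..k}" if "ks \<in> J" for ks
  proof -
    from that obtain l ks' where "ks = l # ks'" "l > 1" by (cases ks) (auto simp: J_def)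
    then show ?thesis using that height_le_sum_list[of ks]
      by (auto simp: J_def compositions_def height_Cons)
  qed
  moreover have "finite J" unfolding J_def using finite_compositions by auto
  ultimately have "(\<Sum>ks\<in>J. z ^ height ks * nested_sum h c n ks) =
     (\<Sum>s\<in>{1..k}. \<Sum>ks | ks \<in> J \<and> height ks = s. z ^ height ks * nested_sum h c n ks)"
    by (intro sum.group[symmetric]) auto
  then have "(\<Sum>s\<in>{1..k}. z ^ s * (\<Sum>ks\<in>I\<^sub>0 k s. nested_sum h c n ks)) = (\<Sum>ks\<in>J. z ^ height ks * nested_sum h c n ks)"
    unfolding I0 by (simp add: sum_distrib_left)
  also have "\<dots> = c * (\<Sum>m\<in>{1..n}. \<Sum>l\<in>{2..k}. height_weight z l / of_nat m ^ l * fps_nth (nested_sum_fps h c z (h m)) (k - l))"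
    unfolding J_def admissible_compositions_eq by (rule sum_Cons_nested_sum) auto
  also have "\<dots> = c * (\<Sum>m\<in>{1..n}. \<Sum>l\<in>{2..k}. fps_nth (first_entry_fps z m) l * fps_nth (nested_sum_fps h c z (h m)) (k - l))"
    by (intro arg_cong2[of _ _ _ _ "(*)"] sum.cong refl) (auto simp: height_weight_def first_entry_fps_def)
  also have "\<dots> = c * (\<Sum>m\<in>{1..n}. \<Sum>l\<in>{0..k}. fps_nth (first_entry_fps z m) l * fps_nth (nested_sum_fps h c z (h m)) (k - l))"
    by (intro arg_cong2[of _ _ _ _ "(*)"] sum.cong refl sum.mono_neutral_left) (auto simp: first_entry_fps_def)
  finally show ?thesis
    unfolding fps_mult_left_const_nth fps_sum_nth unfolding fps_mult_nth .
qed

lemma entry_fps_eq: "entry_fps z m = fps_const (1 / of_nat m) * fps_X + first_entry_fps z m"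
  by (rule fps_ext) (auto simp: entry_fps_def first_entry_fps_def height_weight_def fps_X_def)

lemma first_entry_fps_eq:
  assumes "m > 0"
  shows "of_nat m * (of_nat m - fps_X) * first_entry_fps z m = fps_const z * fps_X ^ 2"
proof -
  have "first_entry_fps z m = fps_const (z / of_nat m) * (fps_X * (fps_X * fps_geometric (of_nat m) 1))"
  proof (rule fps_ext)
    fix n
    show "fps_nth (first_entry_fps z m) n =
      fps_nth (fps_const (z / of_nat m) * (fps_X * (fps_X * fps_geometric (of_nat m) 1))) n"
    proof (cases "n \<le> 1")
      case False
      then have "n = Suc (Suc (n - 2))" by simp
      then obtain n' where n': "n = Suc (Suc n')" by blast
      show ?thesis by (simp add: n' first_entry_fps_def fps_geometric_def)
    qed (cases n, auto simp: first_entry_fps_def)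
  qed
  then have "of_nat m * (of_nat m - fps_X) * first_entry_fps z m =
    fps_const (of_nat m) * fps_const (z / of_nat m) * fps_X ^ 2 *
    ((fps_const (of_nat m) - fps_const 1 * fps_X) * fps_geometric (of_nat m) 1)"
    by (simp add: fps_of_nat power2_eq_square mult_ac)
  also have "\<dots> = fps_const z * fps_X ^ 2"
    using assms by (subst linear_mult_fps_geometric) simp_all
  finally show ?thesis .
qed

lemma one_minus_entry_fps:
  assumes "m > 0"
  shows "of_nat m * (of_nat m - fps_X) * (1 - entry_fps z m) = (of_nat m - fps_X) ^ 2 - fps_const z * fps_X ^ 2"
proof -
  have "of_nat m * fps_const (1 / of_nat m) = (1 :: rat fps)"
    using assms by (simp flip: fps_of_nat)
  then have "of_nat m * (of_nat m - fps_X) * (1 - entry_fps z m)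
     = of_nat m * (of_nat m - fps_X) - fps_X * (of_nat m - fps_X) - of_nat m * (of_nat m - fps_X) * first_entry_fps z m"
    unfolding entry_fps_eq by (simp add: algebra_simps)
  then show ?thesis
    unfolding first_entry_fps_eq[OF assms] by (simp add: algebra_simps power2_eq_square)
qed

section \<open>Product formulas for the generating functions\<close>

abbreviation star_fps :: "rat \<Rightarrow> nat \<Rightarrow> rat fps" where
  "star_fps \<equiv> nested_sum_fps (\<lambda>m. m) 1"

abbreviation signed_fps :: "rat \<Rightarrow> nat \<Rightarrow> rat fps" where
  "signed_fps \<equiv> nested_sum_fps (\<lambda>m. m - 1) (-1)"

lemma nested_sum_fps_0: "nested_sum_fps h c z 0 = 1"
  by (subst nested_sum_fps_eq) simp

text \<open>In the star case the term m = n + 1 of the recursion contains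
  \<open>star_fps z (Suc n)\<close> itself, so 1 - f_{n+1} acts as a divisor. With strict
  inequalities, as in \<open>signed_fps_Suc\<close>, it acts as a factor.\<close>

lemma star_fps_Suc: "star_fps z (Suc n) * (1 - entry_fps z (Suc n)) = star_fps z n"
proof -
  let ?S = "\<Sum>m\<in>{1..n}. entry_fps z m * star_fps z m"
  have "star_fps z (Suc n) - entry_fps z (Suc n) * star_fps z (Suc n) = 1 + ?S"
    unfolding diff_eq_eq by (rule trans[OF nested_sum_fps_eq]) simp
  also have "1 + ?S = star_fps z n"
    by (rule sym, rule trans[OF nested_sum_fps_eq]) simp
  finally show ?thesis by (simp add: algebra_simps)
qed

lemma signed_fps_Suc: "signed_fps z (Suc n) = signed_fps z n * (1 - entry_fps z (Suc n))"
proof -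
  let ?S = "\<Sum>m\<in>{1..n}. entry_fps z m * signed_fps z (m - 1)"
  have c: "fps_const (-1) = (-1 :: rat fps)" by (simp flip: fps_const_neg)
  have "signed_fps z (Suc n) = 1 - (?S + entry_fps z (Suc n) * signed_fps z n)"
    by (rule trans[OF nested_sum_fps_eq]) (simp add: c)
  also have "\<dots> = (1 - ?S) - entry_fps z (Suc n) * signed_fps z n"
    by simp
  also have "1 - ?S = signed_fps z n"
    by (rule sym, rule trans[OF nested_sum_fps_eq]) (simp add: c)
  finally show ?thesis by (simp add: algebra_simps)
qed

lemma star_fps_mult_prod:
  "star_fps z n * (\<Prod>j\<in>{1..n}. (of_nat j - fps_X) ^ 2 - fps_const z * fps_X ^ 2) =
     (\<Prod>j\<in>{1..n}. of_nat j * (of_nat j - fps_X))"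
proof (induction n)
  case (Suc n)
  have "star_fps z (Suc n) * ((of_nat (Suc n) - fps_X) ^ 2 - fps_const z * fps_X ^ 2)
      = star_fps z n * (of_nat (Suc n) * (of_nat (Suc n) - fps_X))"
  proof -
    have "star_fps z (Suc n) * ((of_nat (Suc n) - fps_X) ^ 2 - fps_const z * fps_X ^ 2)
      = (star_fps z (Suc n) * (1 - entry_fps z (Suc n))) * (of_nat (Suc n) * (of_nat (Suc n) - fps_X))"
      unfolding one_minus_entry_fps[OF zero_less_Suc, symmetric] by (simp only: mult_ac)
    then show ?thesis unfolding star_fps_Suc .
  qed
  then have "star_fps z (Suc n) * (\<Prod>j\<in>{1..Suc n}. (of_nat j - fps_X) ^ 2 - fps_const z * fps_X ^ 2)
     = (star_fps z n * (\<Prod>j\<in>{1..n}. (of_nat j - fps_X) ^ 2 - fps_const z * fps_X ^ 2)) *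
       (of_nat (Suc n) * (of_nat (Suc n) - fps_X))"
    by (simp add: prod.nat_ivl_Suc' mult_ac)
  then show ?case
    unfolding Suc by (simp add: prod.nat_ivl_Suc' mult_ac)
qed (simp add: nested_sum_fps_0)

text \<open>The first entry contributes f_m - X/m, and the sum of the f_m P_m is P_n - 1 by the
  recursion.\<close>

lemma sum_first_entry_star_fps:
  "(\<Sum>m\<in>{1..n}. first_entry_fps z m * star_fps z m) =
     star_fps z n - 1 - fps_X * (\<Sum>m\<in>{1..n}. fps_const (1 / of_nat m) * star_fps z m)"
proof -
  have "first_entry_fps z m * star_fps z m =
      entry_fps z m * star_fps z m - fps_X * (fps_const (1 / of_nat m) * star_fps z m)" for m
    by (simp add: entry_fps_eq algebra_simps)
  then have "(\<Sum>m\<in>{1..n}. first_entry_fps z m * star_fps z m) =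
    (\<Sum>m\<in>{1..n}. entry_fps z m * star_fps z m) - fps_X * (\<Sum>m\<in>{1..n}. fps_const (1 / of_nat m) * star_fps z m)"
    by (simp only: sum_subtractf sum_distrib_left)
  also have "(\<Sum>m\<in>{1..n}. entry_fps z m * star_fps z m) = star_fps z n - 1"
    unfolding eq_diff_eq by (rule sym, rule trans[OF nested_sum_fps_eq]) simp
  finally show ?thesis .
qed

context prime_nat
begin

lemma p_integral_nested_sum:
  assumes "\<And>m. h m \<le> m" "p_integral p c" "n < p"
  shows "p_integral p (nested_sum h c n ks)"
  using assms(3)
proof (induction ks arbitrary: n)
  case (Cons k ks)
  have "p_integral p (c / of_nat (m ^ k) * nested_sum h c (h m) ks)" if "m \<in> {1..n}" for m
    using that Cons.prems assms(1)[of m]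
    by (intro p_integral_mult p_integral_divide assms(2) Cons.IH not_dvd_power not_dvd_less) auto
  then show ?case by auto
qed auto

lemma fps_p_integral_nested_sum_fps:
  assumes "\<And>m. h m \<le> m" "p_integral p c" "n < p" "p_integral p z"
  shows "fps_p_integral p (nested_sum_fps h c z n)"
  using assms by (auto simp: fps_p_integral_def nested_sum_fps_def intro!: p_integral_sum p_integral_mult p_integral_power p_integral_nested_sum)

lemma p_integral_divide_power: "p_integral p x \<Longrightarrow> 0 < m \<Longrightarrow> m < p \<Longrightarrow> p_integral p (x / of_nat m ^ l)"
  using p_integral_divide[of x "m ^ l"] not_dvd_power not_dvd_less by simp

lemma fps_p_integral_entry_fps:
  assumes "0 < m" "m < p" "p_integral p z"
  shows "fps_p_integral p (entry_fps z m)" "fps_p_integral p (first_entry_fps z m)"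
  using assms by (auto simp: fps_p_integral_def entry_fps_def first_entry_fps_def height_weight_def intro!: p_integral_divide_power p_integral_inverse not_dvd_less)

end

section \<open>The exact identity for the star sums\<close>

lemma pochhammer_eq_prod_nat: "pochhammer (1 + x) n = (\<Prod>i\<in>{1..n}. of_nat i + x)"
  by (induction n) (simp_all add: pochhammer_Suc prod.nat_ivl_Suc' mult_ac add_ac)

lemma fps_to_fls_prod: "fps_to_fls (\<Prod>i\<in>A. f i) = (\<Prod>i\<in>A. fps_to_fls (f i :: rat fps))"
  by (induction A rule: infinite_finite_induct) (simp_all add: fls_times_fps_to_fls)

lemma fps_to_fls_sum: "fps_to_fls (\<Sum>i\<in>A. f i) = (\<Sum>i\<in>A. fps_to_fls (f i :: rat fps))"
  by (induction A rule: infinite_finite_induct) simp_all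

lemma fps_to_fls_pochhammer: "fps_to_fls (pochhammer f n) = pochhammer (fps_to_fls f :: rat fls) n"
  by (induction n) (simp_all add: pochhammer_Suc fls_times_fps_to_fls)

text \<open>The inverse of \<open>shifted_linear_prod\<close>, written out factor by factor. Both
  omit r = q from the range j + 1, ..., q + j: modulo q = p that factor would lose its constant
  term.\<close>

definition shifted_geometric_prod :: "nat \<Rightarrow> nat \<Rightarrow> rat fps" where
  "shifted_geometric_prod q j =
     (\<Prod>r\<in>{j<..<q}. fps_geometric (of_nat r) 2) * (\<Prod>r\<in>{1..j}. fps_geometric (of_nat (q + r)) 2)"

definition shifted_linear_prod :: "nat \<Rightarrow> nat \<Rightarrow> rat fps" where
  "shifted_linear_prod q j =
     (\<Prod>r\<in>{j<..<q}. of_nat r - 2 * fps_X) * (\<Prod>r\<in>{1..j}. of_nat (q + r) - 2 * fps_X)"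

lemma linear_mult_geometric_of_nat:
  "r > 0 \<Longrightarrow> (of_nat r - fps_const c * fps_X) * fps_geometric (of_nat r) c = 1"
  using linear_mult_fps_geometric[of "of_nat r" c] by (simp add: fps_of_nat)

lemma shifted_linear_prod_mult_geometric: "shifted_linear_prod q j * shifted_geometric_prod q j = 1"
proof -
  have "(of_nat r - 2 * fps_X) * fps_geometric (of_nat r) 2 = 1" if "r > 0" for r
    using linear_mult_geometric_of_nat[OF that, of 2] by (simp add: numeral_fps_const)
  then have *: "(\<Prod>r\<in>A. of_nat (f r) - 2 * fps_X) * (\<Prod>r\<in>A. fps_geometric (of_nat (f r)) 2) = 1"
    if "\<And>r. r \<in> A \<Longrightarrow> f r > 0" for A :: "nat set" and f
    using that by (simp add: prod.distrib[symmetric])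
  have "shifted_linear_prod q j * shifted_geometric_prod q j =
    ((\<Prod>r\<in>{j<..<q}. of_nat r - 2 * fps_X) * (\<Prod>r\<in>{j<..<q}. fps_geometric (of_nat r) 2)) *
    ((\<Prod>r\<in>{1..j}. of_nat (q + r) - 2 * fps_X) * (\<Prod>r\<in>{1..j}. fps_geometric (of_nat (q + r)) 2))"
    unfolding shifted_linear_prod_def shifted_geometric_prod_def by (simp only: mult_ac)
  also have "\<dots> = 1"
    using *[of "{j<..<q}" "\<lambda>r. r"] *[of "{1..j}" "\<lambda>r. q + r"] by simp
  finally show ?thesis .
qed

text \<open>The factors are r - 2X for r = j + 1, ..., j + q, a complete residue system modulo q;
  the one with r = q is isolated.\<close>

lemma pochhammer_eq_shifted_linear_prod:
  assumes "1 \<le> j" "j < q"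
  shows "pochhammer (1 + of_nat j - 2 * fps_X) q = (of_nat q - 2 * fps_X) * shifted_linear_prod q j"
proof -
  have "pochhammer (1 + of_nat j - 2 * fps_X) q = (\<Prod>i\<in>{1..q}. of_nat i + (of_nat j - 2 * fps_X :: rat fps))"
    using pochhammer_eq_prod_nat[of "of_nat j - 2 * fps_X :: rat fps" q] by (simp add: add_diff_eq)
  also have "\<dots> = (\<Prod>r\<in>{j<..q + j}. of_nat r - 2 * fps_X)"
    by (rule prod.reindex_bij_witness[of _ "\<lambda>r. r - j" "\<lambda>i. i + j"]) auto
  also have "{j<..q + j} = {j<..<q} \<union> ({q} \<union> {q<..q + j})" using assms by auto
  also have "(\<Prod>r\<in>\<dots>. of_nat r - 2 * fps_X) = (\<Prod>r\<in>{j<..<q}. of_nat r - 2 * fps_X) *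
     ((of_nat q - 2 * fps_X) * (\<Prod>r\<in>{q<..q + j}. of_nat r - 2 * fps_X :: rat fps))"
    by (subst prod.union_disjoint; (subst prod.union_disjoint)?) auto
  also have "(\<Prod>r\<in>{q<..q + j}. of_nat r - 2 * fps_X) = (\<Prod>r\<in>{1..j}. of_nat (q + r) - 2 * fps_X :: rat fps)"
    by (rule prod.reindex_bij_witness[of _ "\<lambda>r. q + r" "\<lambda>i. i - q"]) auto
  finally show ?thesis
    unfolding shifted_linear_prod_def by (simp only: mult_ac)
qed

text \<open>The factor (1 - q)...(m - 1 - q) / (m - 1)! by which the summands are modified. It
  equals (-1)^(m-1) times the binomial coefficient of q - 1 over m - 1, and is 1 modulo q =
  p.\<close>

definition pochhammer_ratio :: "nat \<Rightarrow> nat \<Rightarrow> rat" where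
  "pochhammer_ratio q m = pochhammer (1 - of_nat q) (m - 1) / fact (m - 1)"

lemma fls_const_pochhammer_ratio:
  "fls_const (pochhammer_ratio q m) = pochhammer (1 - of_nat q) (m - 1) / fact (m - 1)"
proof -
  have fact: "fls_const (fact n) = (fact n :: rat fls)" for n
    using fls_of_nat[of "fact n", where ?'a = rat] unfolding of_nat_fact by (rule sym)
  have "fls_const (pochhammer a n) = pochhammer (fls_const a) n" for a :: rat and n
  proof (induction n)
    case (Suc n)
    then show ?case
      unfolding pochhammer_Suc fls_const_mult_const[symmetric] fls_plus_const[symmetric] fls_of_nat by simp
  qed simp
  moreover have "fls_const (1 - of_nat q) = (1 - of_nat q :: rat fls)"
    unfolding fls_minus_const[symmetric] fls_of_nat by simp
  ultimately have poch: "fls_const (pochhammer (1 - of_nat q) n) = (pochhammer (1 - of_nat q) n :: rat fls)" for n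
    by simp
  have "fls_const (pochhammer_ratio q m) * fls_const (fact (m - 1)) = fls_const (pochhammer (1 - of_nat q) (m - 1))"
    unfolding fls_const_mult_const pochhammer_ratio_def by simp
  then have "fls_const (pochhammer_ratio q m) * fact (m - 1) = (pochhammer (1 - of_nat q) (m - 1) :: rat fls)"
    unfolding fact poch .
  then show ?thesis by (simp add: eq_divide_eq)
qed

lemma height_factor_eq:
  fixes w :: rat
  shows "(of_nat j - fps_X) ^ 2 - fps_const (w ^ 2) * fps_X ^ 2 =
    (of_nat j - fps_const (1 + w) * fps_X) * (of_nat j - fps_const (1 - w) * fps_X)"
proof -
  have "(x - X) ^ 2 - W ^ 2 * X ^ 2 = (x - (1 + W) * X) * (x - (1 - W) * X)" for x X W :: "rat fps"
    by (simp add: power2_eq_square algebra_simps)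
  from this[of "of_nat j" fps_X "fps_const w"] show ?thesis
    unfolding fps_const_power[symmetric] fps_const_add[symmetric] fps_const_sub[symmetric] fps_const_1_eq_1 .
qed

text \<open>The partial fraction identity is applied with t = X and v = z X^2 in the field of
  Laurent series and pulled back by injectivity of the embedding. The factor q - 2X on the left
  cancels the isolated factor of the Pochhammer symbol, so everything on the right is p-integral
  when q = p.\<close>

lemma star_fps_partial_fractions:
  fixes w :: rat
  assumes "odd q"
  defines "z \<equiv> w ^ 2"
  shows "(of_nat q - 2 * fps_X) * (\<Sum>m\<in>{1..<q}. fps_const (pochhammer_ratio q m / of_nat m) * star_fps z m) =
    (\<Sum>j\<in>{1..<q}. (-1) ^ (j - 1) * 2 * (of_nat j - fps_X) * fps_const (pochhammer_ratio q j) *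
       ((\<Prod>r\<in>{1..<q}. of_nat r - fps_X) * (of_nat j - fps_X + (-1) ^ j * (of_nat q - fps_X))) *
       shifted_geometric_prod q j * (fps_geometric (of_nat j) (1 + w) * fps_geometric (of_nat j) (1 - w)))"
proof -
  define t where "t = (fls_X :: rat fls)"
  define v where "v = fps_to_fls (fps_const z * fps_X ^ 2)"
  define Q where "Q = (\<lambda>j::nat. (of_nat j - fps_X) ^ 2 - fps_const z * fps_X ^ 2 :: rat fps)"
  have Q: "fps_to_fls (Q j) = (of_nat j - t)\<^sup>2 - v" for j
    by (simp add: Q_def v_def t_def fps_to_fls_power)
  have Q_geo: "Q j * (fps_geometric (of_nat j) (1 + w) * fps_geometric (of_nat j) (1 - w)) = 1" if "j > 0" for j
  proof -
    have "Q j = (of_nat j - fps_const (1 + w) * fps_X) * (of_nat j - fps_const (1 - w) * fps_X)"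
      unfolding Q_def z_def by (rule height_factor_eq)
    then have "Q j * (fps_geometric (of_nat j) (1 + w) * fps_geometric (of_nat j) (1 - w)) =
      ((of_nat j - fps_const (1 + w) * fps_X) * fps_geometric (of_nat j) (1 + w)) *
      ((of_nat j - fps_const (1 - w) * fps_X) * fps_geometric (of_nat j) (1 - w))"
      by (simp only: mult_ac)
    then show ?thesis
      using that by (simp add: linear_mult_geometric_of_nat)
  qed
  have Q0: "fps_to_fls (Q j) \<noteq> 0" if "j > 0" for j
    using Q_geo[OF that] by auto
  have nz: "of_nat n - 2 * t \<noteq> 0" for n
  proof
    assume "of_nat n - 2 * t = 0"
    moreover have "fps_to_fls (of_nat n - 2 * fps_X) = of_nat n - 2 * t" by (simp add: t_def fls_times_fps_to_fls)
    ultimately have "fps_to_fls (of_nat n - 2 * fps_X :: rat fps) = fps_to_fls 0"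
      by (simp only: fps_zero_to_fls)
    then have "fps_nth (of_nat n - 2 * fps_X :: rat fps) 1 = 0"
      by (simp only: fps_to_fls_eq_iff fps_zero_nth)
    then show False by (simp add: numeral_fps_const)
  qed
  have lin: "(\<Prod>r\<in>{1..m}. of_nat r - t) = pochhammer (1 - t) m" for m
    using pochhammer_eq_prod_nat[of "- t" m] by simp
  have star: "fps_to_fls (star_fps z m) * (\<Prod>i\<in>{1..m}. (of_nat i - t)\<^sup>2 - v) = fact m * pochhammer (1 - t) m" for m
  proof -
    have "fps_to_fls (star_fps z m * (\<Prod>i\<in>{1..m}. Q i)) = fps_to_fls (\<Prod>i\<in>{1..m}. of_nat i * (of_nat i - fps_X))"
      unfolding Q_def star_fps_mult_prod ..
    then show ?thesis
      unfolding fls_times_fps_to_fls fps_to_fls_prod Q lin[symmetric] fact_prod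
      by (simp add: prod.distrib t_def)
  qed
  have L: "fps_to_fls (fps_const (pochhammer_ratio q m / of_nat m) * star_fps z m) =
     pochhammer (1 - of_nat q) (m - 1) * pochhammer (1 - t) m / (\<Prod>i\<in>{1..m}. (of_nat i - t)\<^sup>2 - v)"
    if "m \<in> {1..<q}" for m
  proof -
    have "(\<Prod>i\<in>{1..m}. (of_nat i - t)\<^sup>2 - v) \<noteq> 0"
      using Q0 unfolding Q[symmetric] by simp
    then have "fps_to_fls (star_fps z m) = fact m * pochhammer (1 - t) m / (\<Prod>i\<in>{1..m}. (of_nat i - t)\<^sup>2 - v)"
      using star[of m] by (simp add: eq_divide_eq)
    moreover have "fls_const (pochhammer_ratio q m / of_nat m) * fact m = pochhammer (1 - of_nat q) (m - 1)"
    proof -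
      have m: "(fact m :: rat fls) = fls_const (of_nat m) * fact (m - 1)"
        using that by (simp add: fact_reduce fls_of_nat)
      have "fls_const (pochhammer_ratio q m / of_nat m) * fls_const (of_nat m) = fls_const (pochhammer_ratio q m)"
        using that by simp
      then have "fls_const (pochhammer_ratio q m / of_nat m) * fact m = fls_const (pochhammer_ratio q m) * fact (m - 1)"
        unfolding m mult.assoc[symmetric] by simp
      then show ?thesis by (simp add: fls_const_pochhammer_ratio)
    qed
    ultimately show ?thesis
      by (simp add: fls_times_fps_to_fls flip: mult.assoc)
  qed
  have R: "(of_nat q - 2 * t) * ((-1) ^ (j - 1) * 2 * (of_nat j - t) * pochhammer (1 - of_nat q) (j - 1) / fact (j - 1)
        * (pochhammer (1 - t) (q - 1) * (of_nat j - t - (-1) ^ (q - j) * (of_nat q - t)))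
        / pochhammer (1 + of_nat j - 2 * t) q / ((of_nat j - t)\<^sup>2 - v)) =
     fps_to_fls ((-1) ^ (j - 1) * 2 * (of_nat j - fps_X) * fps_const (pochhammer_ratio q j) *
       ((\<Prod>r\<in>{1..<q}. of_nat r - fps_X) * (of_nat j - fps_X + (-1) ^ j * (of_nat q - fps_X))) *
       shifted_geometric_prod q j * (fps_geometric (of_nat j) (1 + w) * fps_geometric (of_nat j) (1 - w)))"
    if j: "j \<in> {1..<q}" for j
  proof -
    have "even (q - j) \<longleftrightarrow> odd j" using j assms(1) by auto
    then have sgn: "(-1) ^ (q - j) = (- ((-1) ^ j) :: rat fls)" by (cases "even j") auto
    have "{1..<q} = {1..q - 1}" using j by auto
    then have lin': "fps_to_fls (\<Prod>r\<in>{1..<q}. of_nat r - fps_X) = pochhammer (1 - t) (q - 1)"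
      unfolding lin[symmetric] by (simp add: fps_to_fls_prod t_def)
    have "fps_to_fls (pochhammer (1 + of_nat j - 2 * fps_X) q) = fps_to_fls ((of_nat q - 2 * fps_X) * shifted_linear_prod q j)"
      using j by (simp add: pochhammer_eq_shifted_linear_prod)
    then have 1: "pochhammer (1 + of_nat j - 2 * t) q = (of_nat q - 2 * t) * fps_to_fls (shifted_linear_prod q j)"
      by (simp add: fps_to_fls_pochhammer fls_times_fps_to_fls t_def)
    have "fps_to_fls (shifted_linear_prod q j * shifted_geometric_prod q j) = 1"
      by (simp add: shifted_linear_prod_mult_geometric)
    then have 2: "fps_to_fls (shifted_geometric_prod q j) = 1 / fps_to_fls (shifted_linear_prod q j)"
      "fps_to_fls (shifted_linear_prod q j) \<noteq> 0"
      by (auto simp: fls_times_fps_to_fls eq_divide_eq mult.commute)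
    have "fps_to_fls (Q j * (fps_geometric (of_nat j) (1 + w) * fps_geometric (of_nat j) (1 - w))) = 1"
      using Q_geo[of j] j by simp
    then have 3: "fps_to_fls (fps_geometric (of_nat j) (1 + w) * fps_geometric (of_nat j) (1 - w)) = 1 / ((of_nat j - t)\<^sup>2 - v)"
      using Q0[of j] j unfolding fls_times_fps_to_fls[of "Q j"] Q by (simp add: eq_divide_eq mult.commute)
    have alg: "P * (A * B / F * G / (P * D) / C) = A * (B / F) * G * (1 / D) * (1 / C)" if "P \<noteq> 0" for A B C D F G P :: "rat fls"
      using that by (simp add: mult.assoc)
    have 4: "fps_to_fls ((-1) ^ n) = (-1) ^ n" for n
      by (simp add: fps_to_fls_power)
    show ?thesis
      unfolding fls_times_fps_to_fls[of _ "fps_geometric (of_nat j) (1 + w) * fps_geometric (of_nat j) (1 - w)"] 3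
      unfolding 1 sgn alg[OF nz] fls_times_fps_to_fls 2 lin'
      by (simp add: fls_times_fps_to_fls fps_to_fls_power fls_const_pochhammer_ratio t_def)
  qed
  have v: "(of_nat j - t)\<^sup>2 \<noteq> v" if "1 \<le> j" for j
    using Q0[of j] Q[of j] that by auto
  have "fps_to_fls ((of_nat q - 2 * fps_X) * (\<Sum>m\<in>{1..<q}. fps_const (pochhammer_ratio q m / of_nat m) * star_fps z m)) =
    (of_nat q - 2 * t) * (\<Sum>m\<in>{1..<q}. pochhammer (1 - of_nat q) (m - 1) * pochhammer (1 - t) m / (\<Prod>i\<in>{1..m}. (of_nat i - t)\<^sup>2 - v))"
    unfolding fls_times_fps_to_fls[of _ "sum _ _"] fps_to_fls_sum using L by (simp add: t_def fls_times_fps_to_fls[of 2])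
  also have "\<dots> = (\<Sum>j\<in>{1..<q}. (of_nat q - 2 * t) * ((-1) ^ (j - 1) * 2 * (of_nat j - t) * pochhammer (1 - of_nat q) (j - 1) / fact (j - 1)
        * (pochhammer (1 - t) (q - 1) * (of_nat j - t - (-1) ^ (q - j) * (of_nat q - t)))
        / pochhammer (1 + of_nat j - 2 * t) q / ((of_nat j - t)\<^sup>2 - v)))"
    using hypergeometric_partial_fractions[of t q v] nz v by (simp add: sum_distrib_left)
  also have "\<dots> = fps_to_fls (\<Sum>j\<in>{1..<q}. (-1) ^ (j - 1) * 2 * (of_nat j - fps_X) * fps_const (pochhammer_ratio q j) *
       ((\<Prod>r\<in>{1..<q}. of_nat r - fps_X) * (of_nat j - fps_X + (-1) ^ j * (of_nat q - fps_X))) *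
       shifted_geometric_prod q j * (fps_geometric (of_nat j) (1 + w) * fps_geometric (of_nat j) (1 - w)))"
    unfolding fps_to_fls_sum by (intro sum.cong refl R)
  finally show ?thesis by (simp only: fps_to_fls_eq_iff)
qed

section \<open>Reduction modulo a prime\<close>

context prime_nat
begin

lemma p_cong_p_0: "p_cong p (of_nat p) 0"
  using p_cong_mult_p[OF p_integral_1] by simp

lemma fps_p_cong_of_nat: "p_cong p (of_nat m) (of_nat n) \<Longrightarrow> fps_p_cong p M (of_nat m) (of_nat n)"
  using fps_p_cong_const by (simp flip: fps_of_nat)

lemma fps_p_cong_add_p: "fps_p_cong p M (of_nat (p + r)) (of_nat r)"
  using p_cong_add[OF p_cong_p_0 p_cong_refl, of "of_nat r"] by (intro fps_p_cong_of_nat) simp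

lemma fps_p_cong_p_0: "fps_p_cong p M (of_nat p) 0"
  using fps_p_cong_add_p[of M 0] by simp

lemma fps_p_cong_cancel:
  assumes "fps_p_cong p M (of_nat n * F) (of_nat n * G)" "\<not> p dvd n"
  shows "fps_p_cong p M F G"
  unfolding fps_p_cong_def
proof safe
  fix i assume "i < M"
  with assms(1) have "p_cong p (of_nat n * fps_nth F i) (of_nat n * fps_nth G i)"
    by (simp add: fps_p_cong_def flip: fps_of_nat)
  then show "p_cong p (fps_nth F i) (fps_nth G i)"
    using assms(2) by (rule p_cong_cancel)
qed

lemma fps_p_integral_minus_1_power [intro]: "fps_p_integral p ((-1) ^ n)"
  by auto

lemma pochhammer_ratio_p_cong:
  assumes "m \<le> p"
  shows "p_cong p (pochhammer_ratio p m) 1" "p_integral p (pochhammer_ratio p m)"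
proof -
  have int: "p_integral p (pochhammer (1 - of_nat p) n)" for n
    unfolding pochhammer_prod by auto
  have "p_cong p (pochhammer (1 - of_nat p) n) (pochhammer (1 - 0) n)" for n
    unfolding pochhammer_prod by (intro p_cong_prod p_cong_add p_cong_diff p_cong_refl p_cong_p_0) auto
  then have *: "p_cong p (pochhammer (1 - of_nat p) (m - 1)) (fact (m - 1))"
    by (simp add: pochhammer_fact)
  have "m - 1 < p" using assms prime_gt_0_nat[OF prime] by linarith
  then have nd: "\<not> p dvd fact (m - 1)" by (rule not_dvd_fact)
  show "p_cong p (pochhammer_ratio p m) 1"
    using p_cong_mult_left[OF * p_integral_inverse[OF nd]] by (simp add: pochhammer_ratio_def)
  show "p_integral p (pochhammer_ratio p m)"
    using p_integral_divide[OF int nd] by (simp add: pochhammer_ratio_def)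
qed

lemma prod_linear_1_p_cong:
  "fps_p_cong p (p - 1) (\<Prod>r\<in>{1..<p}. of_nat r - fps_X) (fact (p - 1))"
  using prod_linear_p_cong[OF p_integral_1] by simp

text \<open>Reducing p + r to r moves the upper factors into the gap 1, ..., j, which restores the
  full product over 1, ..., p - 1.\<close>

lemma shifted_linear_prod_p_cong:
  assumes "1 \<le> j" "j < p"
  shows "fps_p_cong p (p - 1) (shifted_linear_prod p j) (fact (p - 1))"
proof -
  have int: "fps_p_integral p (of_nat r - 2 * fps_X)" for r by auto
  have "fps_p_cong p (p - 1) (shifted_linear_prod p j)
     ((\<Prod>r\<in>{j<..<p}. of_nat r - 2 * fps_X) * (\<Prod>r\<in>{1..j}. of_nat r - 2 * fps_X))"
    unfolding shifted_linear_prod_def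
    by (intro fps_p_cong_mult fps_p_cong_prod fps_p_cong_diff fps_p_cong_add_p fps_p_cong_refl fps_p_integral_prod int)
  also have "(\<Prod>r\<in>{j<..<p}. of_nat r - 2 * fps_X) * (\<Prod>r\<in>{1..j}. of_nat r - 2 * fps_X) =
     (\<Prod>r\<in>{j<..<p} \<union> {1..j}. of_nat r - fps_const 2 * fps_X :: rat fps)"
    by (subst prod.union_disjoint) (auto simp: numeral_fps_const)
  also have "{j<..<p} \<union> {1..j} = {1..<p}" using assms by auto
  also have "fps_p_cong p (p - 1) (\<Prod>r\<in>{1..<p}. of_nat r - fps_const 2 * fps_X) (fact (p - 1))"
    by (rule prod_linear_p_cong) auto
  finally show ?thesis .
qed

lemma fps_p_integral_shifted_geometric_prod:
  assumes "1 \<le> j" "j < p"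
  shows "fps_p_integral p (shifted_geometric_prod p j)"
proof -
  have "\<not> p dvd r" if "r \<in> {j<..<p} \<or> r \<in> {1..j}" for r
    using that assms by (intro not_dvd_less) auto
  then show ?thesis
    unfolding shifted_geometric_prod_def
    by (intro fps_p_integral_mult fps_p_integral_prod fps_p_integral_geometric) auto
qed

text \<open>The product of the r - X and the shifted product of the r - 2X are both (p - 1)! modulo
  p, so they cancel.\<close>

lemma prod_linear_mult_shifted_geometric_p_cong:
  assumes "1 \<le> j" "j < p"
  shows "fps_p_cong p (p - 1) ((\<Prod>r\<in>{1..<p}. of_nat r - fps_X) * shifted_geometric_prod p j) 1"
proof -
  have "fps_p_cong p (p - 1) (\<Prod>r\<in>{1..<p}. of_nat r - fps_X) (shifted_linear_prod p j)"
    using fps_p_cong_trans[OF prod_linear_1_p_cong fps_p_cong_sym[OF shifted_linear_prod_p_cong[OF assms]]] .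
  from fps_p_cong_mult_left[OF this fps_p_integral_shifted_geometric_prod[OF assms]]
  show ?thesis using shifted_linear_prod_mult_geometric[of p j] by (simp add: mult.commute)
qed

text \<open>With L(c) the product of the r - cX, P_{p-1} L(1 + w) L(1 - w) = (p - 1)! L(1). Each
  L(c) is congruent to (p - 1)!, a unit modulo p.\<close>

lemma star_fps_p_cong_1:
  assumes w: "p_integral p w"
  shows "fps_p_cong p (p - 1) (star_fps (w ^ 2) (p - 1)) 1"
proof -
  define L where "L = (\<lambda>c :: rat. \<Prod>r\<in>{1..<p}. of_nat r - fps_const c * fps_X)"
  define K where "K = (fact (p - 1) :: rat fps)"
  define A where "A = star_fps (w ^ 2) (p - 1)"
  have p: "{1..p - 1} = {1..<p}" using prime_gt_0_nat[OF prime] by auto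
  have K_int: "fps_p_integral p K"
    using fps_p_integral_of_nat[of "fact (p - 1)"] by (simp only: K_def of_nat_fact)
  have LK: "fps_p_cong p (p - 1) (L c) K" if "p_integral p c" for c
    using prod_linear_p_cong[OF that] by (simp add: L_def K_def)
  have L_int: "fps_p_integral p (L c)" if "p_integral p c" for c
    using that unfolding L_def by auto
  have A_int: "fps_p_integral p A"
    unfolding A_def using prime_gt_0_nat[OF prime] w by (intro fps_p_integral_nested_sum_fps) auto
  have ab: "p_integral p (1 + w)" "p_integral p (1 - w)" using w by auto
  have K: "K = (\<Prod>r\<in>{1..<p}. of_nat r)"
    unfolding K_def fact_prod p by simp
  have id: "A * (L (1 + w) * L (1 - w)) = K * L 1"
    using star_fps_mult_prod[of "w ^ 2" "p - 1"]
    unfolding height_factor_eq p by (simp add: A_def L_def K prod.distrib)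
  have "fps_p_cong p (p - 1) (A * (K * K)) (A * (L (1 + w) * L (1 - w)))"
    by (intro fps_p_cong_mult_left fps_p_cong_mult fps_p_cong_sym[OF LK] ab A_int K_int L_int)
  also have "A * (L (1 + w) * L (1 - w)) = K * L 1" by (rule id)
  also have "fps_p_cong p (p - 1) (K * L 1) (K * K)"
    by (intro fps_p_cong_mult_left LK K_int) auto
  finally have "fps_p_cong p (p - 1) (of_nat (fact (p - 1) * fact (p - 1)) * A) (of_nat (fact (p - 1) * fact (p - 1)) * 1)"
    by (simp add: K_def mult_ac)
  then show ?thesis
    unfolding A_def
    by (rule fps_p_cong_cancel) (use prime prime_gt_0_nat[OF prime] in \<open>auto simp: prime_dvd_mult_iff prime_dvd_fact_iff\<close>)
qed

text \<open>With y = j - X one has 2 y ga gb = ga + gb and y (ga + gb) = 2 + w X (ga - gb). The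
  summand without a sign stems from the term missing in Chu--Vandermonde, the one with (-1)^j from
  the full evaluation.\<close>

lemma height_partial_fraction_term:
  fixes w :: rat
  assumes "j > 0"
  defines "ga \<equiv> fps_geometric (of_nat j) (1 + w)" and "gb \<equiv> fps_geometric (of_nat j) (1 - w)"
  shows "(-1) ^ (j - 1) * 2 * (of_nat j - fps_X) * (of_nat j - fps_X + (-1) ^ j * - fps_X) * (ga * gb)
    = fps_X * (ga + gb) - fps_const ((-1) ^ j) * (2 + fps_const w * (fps_X * (ga - gb)))"
proof -
  define W where "W = fps_const w"
  define y :: "rat fps" where "y = of_nat j - fps_X"
  define e :: "rat fps" where "e = (-1) ^ j"
  have a: "(y - W * fps_X) * ga = 1" and b: "(y + W * fps_X) * gb = 1"
  proof -
    have "y - W * fps_X = of_nat j - fps_const (1 + w) * fps_X" "y + W * fps_X = of_nat j - fps_const (1 - w) * fps_X"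
      by (simp_all add: y_def W_def algebra_simps flip: fps_const_add fps_const_sub)
    then show "(y - W * fps_X) * ga = 1" "(y + W * fps_X) * gb = 1"
      unfolding ga_def gb_def using linear_mult_geometric_of_nat[OF assms(1)] by simp_all
  qed
  have "2 * y * (ga * gb) = ((y - W * fps_X) * ga) * gb + ((y + W * fps_X) * gb) * ga"
    by (simp add: algebra_simps)
  then have 1: "2 * y * (ga * gb) = ga + gb"
    unfolding a b by simp
  have "y * (ga + gb) = (y - W * fps_X) * ga + (y + W * fps_X) * gb + W * (fps_X * (ga - gb))"
    by (simp add: algebra_simps)
  then have 2: "y * (ga + gb) = 2 + W * (fps_X * (ga - gb))"
    unfolding a b by simp
  have e: "e * e = 1" "(-1) ^ (j - 1) = - e" "fps_const ((-1) ^ j) = e"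
  proof -
    show "e * e = 1" by (simp add: e_def flip: power_add)
    show "(-1) ^ (j - 1) = - e" using assms(1) by (cases j) (auto simp: e_def)
    show "fps_const ((-1) ^ j) = e" by (cases "even j") (auto simp: e_def simp flip: fps_const_neg)
  qed
  have "(- e) * 2 * y * (y + e * - fps_X) * (ga * gb) = (e * e) * fps_X * (2 * y * (ga * gb)) - e * (y * (2 * y * (ga * gb)))"
    by (simp add: algebra_simps)
  then have "(- e) * 2 * y * (y + e * - fps_X) * (ga * gb) = fps_X * (ga + gb) - e * (2 + W * (fps_X * (ga - gb)))"
    unfolding e(1) 1 2 by simp
  then show ?thesis
    unfolding e(2,3) y_def[symmetric] W_def[symmetric] e_def[symmetric] .
qed

text \<open>Reducing the exact identity turns p - 2X into -2X, p - X into -X, and both the ratios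
  and the product of all linear factors with their shifted inverses into 1.\<close>

lemma fps_X_mult_sum_star_fps_p_cong:
  fixes w :: rat
  assumes "odd p" and w: "p_integral p w"
  shows "fps_p_cong p (p - 1) (- 2 * fps_X * (\<Sum>m\<in>{1..<p}. fps_const (1 / of_nat m) * star_fps (w ^ 2) m))
    (\<Sum>j\<in>{1..<p}. fps_X * (fps_geometric (of_nat j) (1 + w) + fps_geometric (of_nat j) (1 - w)) - fps_const ((-1) ^ j) *
       (2 + fps_const w * (fps_X * (fps_geometric (of_nat j) (1 + w) - fps_geometric (of_nat j) (1 - w)))))"
proof -
  define L where "L = (\<Prod>r\<in>{1..<p}. of_nat r - fps_X :: rat fps)"
  define gg where "gg = (\<lambda>j::nat. fps_geometric (of_nat j) (1 + w) * fps_geometric (of_nat j) (1 - w))"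
  have gg_int: "fps_p_integral p (gg j)" if "j \<in> {1..<p}" for j
    unfolding gg_def using that w by (intro fps_p_integral_mult fps_p_integral_geometric not_dvd_less) auto
  have star_int: "fps_p_integral p (star_fps (w ^ 2) m)" if "m \<in> {1..<p}" for m
    using that w by (intro fps_p_integral_nested_sum_fps) auto
  have inv_int: "p_integral p (1 / of_nat m)" if "m \<in> {1..<p}" for m
    using that by (intro p_integral_inverse not_dvd_less) auto
  have ratio: "p_cong p (pochhammer_ratio p m) 1" "p_integral p (pochhammer_ratio p m)" if "m \<in> {1..<p}" for m
    using that by (auto intro!: pochhammer_ratio_p_cong)
  have "fps_p_cong p (p - 1)
     ((0 - 2 * fps_X) * (\<Sum>m\<in>{1..<p}. fps_const (1 / of_nat m) * star_fps (w ^ 2) m))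
     ((of_nat p - 2 * fps_X) * (\<Sum>m\<in>{1..<p}. fps_const (pochhammer_ratio p m / of_nat m) * star_fps (w ^ 2) m))"
  proof (intro fps_p_cong_mult fps_p_cong_diff fps_p_cong_refl fps_p_cong_sym[OF fps_p_cong_p_0] fps_p_cong_sum
      fps_p_cong_const fps_p_integral_sum fps_p_integral_mult fps_p_integral_const)
    fix m assume m: "m \<in> {1..<p}"
    show "p_cong p (1 / of_nat m) (pochhammer_ratio p m / of_nat m)"
      using p_cong_mult_left[OF p_cong_sym[OF ratio(1)[OF m]] inv_int[OF m]] by simp
    show "p_integral p (pochhammer_ratio p m / of_nat m)"
      using p_integral_mult[OF ratio(2)[OF m] inv_int[OF m]] by simp
  qed (use inv_int star_int in auto)
  also have "(of_nat p - 2 * fps_X) * (\<Sum>m\<in>{1..<p}. fps_const (pochhammer_ratio p m / of_nat m) * star_fps (w ^ 2) m) =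
    (\<Sum>j\<in>{1..<p}. (-1) ^ (j - 1) * 2 * (of_nat j - fps_X) * fps_const (pochhammer_ratio p j) *
       (L * (of_nat j - fps_X + (-1) ^ j * (of_nat p - fps_X))) * shifted_geometric_prod p j * gg j)"
    unfolding L_def gg_def by (rule star_fps_partial_fractions) fact
  also have "\<dots> = (\<Sum>j\<in>{1..<p}. (-1) ^ (j - 1) * 2 * (of_nat j - fps_X) * gg j *
       (fps_const (pochhammer_ratio p j) * ((L * shifted_geometric_prod p j) * (of_nat j - fps_X + (-1) ^ j * (of_nat p - fps_X)))))"
    by (simp only: mult_ac)
  also have "fps_p_cong p (p - 1) \<dots> (\<Sum>j\<in>{1..<p}. (-1) ^ (j - 1) * 2 * (of_nat j - fps_X) * gg j *
       (fps_const 1 * (1 * (of_nat j - fps_X + (-1) ^ j * (0 - fps_X)))))"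
  proof (intro fps_p_cong_sum)
    fix j assume j: "j \<in> {1..<p}"
    have "fps_p_integral p L" unfolding L_def by auto
    moreover have "fps_p_integral p (shifted_geometric_prod p j)"
      using j by (intro fps_p_integral_shifted_geometric_prod) auto
    moreover have "fps_p_cong p (p - 1) (L * shifted_geometric_prod p j) 1"
      unfolding L_def using j by (intro prod_linear_mult_shifted_geometric_p_cong) auto
    ultimately show "fps_p_cong p (p - 1)
       ((-1) ^ (j - 1) * 2 * (of_nat j - fps_X) * gg j *
       (fps_const (pochhammer_ratio p j) * ((L * shifted_geometric_prod p j) * (of_nat j - fps_X + (-1) ^ j * (of_nat p - fps_X)))))
       ((-1) ^ (j - 1) * 2 * (of_nat j - fps_X) * gg j *
       (fps_const 1 * (1 * (of_nat j - fps_X + (-1) ^ j * (0 - fps_X)))))"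
      by (intro fps_p_cong_mult_left[where F = "_ * gg j"] fps_p_cong_mult fps_p_cong_add fps_p_cong_diff fps_p_cong_refl fps_p_cong_p_0
          fps_p_cong_const ratio j fps_p_integral_const fps_p_integral_mult fps_p_integral_add fps_p_integral_diff
          fps_p_integral_minus_1_power fps_p_integral_of_nat fps_p_integral_numeral fps_p_integral_X
          fps_p_integral_0 fps_p_integral_1 gg_int)
  qed
  also have "\<dots> = (\<Sum>j\<in>{1..<p}. fps_X * (fps_geometric (of_nat j) (1 + w) + fps_geometric (of_nat j) (1 - w)) - fps_const ((-1) ^ j) *
       (2 + fps_const w * (fps_X * (fps_geometric (of_nat j) (1 + w) - fps_geometric (of_nat j) (1 - w)))))"
  proof (intro sum.cong refl)
    fix j assume "j \<in> {1..<p}"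
    then have "j > 0" by auto
    from height_partial_fraction_term[OF this, of w]
    show "(-1) ^ (j - 1) * 2 * (of_nat j - fps_X) * gg j * (fps_const 1 * (1 * (of_nat j - fps_X + (-1) ^ j * (0 - fps_X))))
      = fps_X * (fps_geometric (of_nat j) (1 + w) + fps_geometric (of_nat j) (1 - w)) - fps_const ((-1) ^ j) *
       (2 + fps_const w * (fps_X * (fps_geometric (of_nat j) (1 + w) - fps_geometric (of_nat j) (1 - w))))"
      unfolding gg_def fps_const_1_eq_1 mult_1 diff_0 by (simp only: mult_ac)
  qed
  finally show ?thesis by simp
qed

text \<open>The part without sign contributes a multiple of a harmonic sum, hence 0 modulo p, and
  the constant 2 reaches degree 0 only. The factor 2 on the left is that of -2X.\<close>

lemma star_coeff_p_cong:
  fixes w :: rat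
  assumes "odd p" and w: "p_integral p w" and k: "0 < k" "k < p - 1"
  shows "p_cong p (2 * fps_nth (\<Sum>m\<in>{1..p - 1}. first_entry_fps (w ^ 2) m * star_fps (w ^ 2) m) k)
     (- (w * ((1 + w) ^ (k - 1) - (1 - w) ^ (k - 1))) * (\<Sum>j\<in>{1..<p}. (-1) ^ j / of_nat j ^ k))"
proof -
  define S where "S = (\<Sum>m\<in>{1..<p}. fps_const (1 / of_nat m) * star_fps (w ^ 2) m)"
  define a b where "a = 1 + w" and "b = 1 - w"
  have p: "{1..p - 1} = {1..<p}" using prime_gt_0_nat[OF prime] by auto
  have ab: "p_integral p a" "p_integral p b" using w by (auto simp: a_def b_def)
  have "2 * (\<Sum>m\<in>{1..p - 1}. first_entry_fps (w ^ 2) m * star_fps (w ^ 2) m) =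
      2 * (star_fps (w ^ 2) (p - 1) - 1) + - 2 * fps_X * S"
    unfolding sum_first_entry_star_fps unfolding S_def p by (simp add: algebra_simps)
  also have "fps_p_cong p (p - 1) \<dots> (2 * (1 - 1) + (\<Sum>j\<in>{1..<p}. fps_X * (fps_geometric (of_nat j) a + fps_geometric (of_nat j) b) - fps_const ((-1) ^ j) *
       (2 + fps_const w * (fps_X * (fps_geometric (of_nat j) a - fps_geometric (of_nat j) b)))))"
    unfolding S_def a_def b_def
    by (intro fps_p_cong_add fps_p_cong_mult_left fps_p_cong_diff star_fps_p_cong_1 fps_X_mult_sum_star_fps_p_cong assms) auto
  finally have "p_cong p (fps_nth (2 * (\<Sum>m\<in>{1..p - 1}. first_entry_fps (w ^ 2) m * star_fps (w ^ 2) m)) k)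
     (fps_nth (\<Sum>j\<in>{1..<p}. fps_X * (fps_geometric (of_nat j) a + fps_geometric (of_nat j) b) - fps_const ((-1) ^ j) *
       (2 + fps_const w * (fps_X * (fps_geometric (of_nat j) a - fps_geometric (of_nat j) b)))) k)"
    using k unfolding fps_p_cong_def by simp
  also have "fps_nth (2 * (\<Sum>m\<in>{1..p - 1}. first_entry_fps (w ^ 2) m * star_fps (w ^ 2) m)) k =
    2 * fps_nth (\<Sum>m\<in>{1..p - 1}. first_entry_fps (w ^ 2) m * star_fps (w ^ 2) m) k"
    by (simp only: numeral_fps_const fps_mult_left_const_nth)
  also have "fps_nth (\<Sum>j\<in>{1..<p}. fps_X * (fps_geometric (of_nat j) a + fps_geometric (of_nat j) b) - fps_const ((-1) ^ j) *
       (2 + fps_const w * (fps_X * (fps_geometric (of_nat j) a - fps_geometric (of_nat j) b)))) k =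
    (\<Sum>j\<in>{1..<p}. (a ^ (k - 1) + b ^ (k - 1)) * (1 / of_nat j ^ k) - (w * (a ^ (k - 1) - b ^ (k - 1))) * ((-1) ^ j / of_nat j ^ k))"
    unfolding fps_sum_nth
  proof (intro sum.cong refl)
    fix j
    obtain k' where k': "k = Suc k'" using k by (cases k) auto
    show "fps_nth (fps_X * (fps_geometric (of_nat j) a + fps_geometric (of_nat j) b) - fps_const ((-1) ^ j) *
       (2 + fps_const w * (fps_X * (fps_geometric (of_nat j) a - fps_geometric (of_nat j) b)))) k =
      (a ^ (k - 1) + b ^ (k - 1)) * (1 / of_nat j ^ k) - (w * (a ^ (k - 1) - b ^ (k - 1))) * ((-1) ^ j / of_nat j ^ k)"
      unfolding k' fps_sub_nth fps_mult_left_const_nth fps_add_nth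
      by (simp add: fps_geometric_def numeral_fps_const) (simp add: algebra_simps add_divide_distrib diff_divide_distrib)
  qed
  also have "\<dots> = (a ^ (k - 1) + b ^ (k - 1)) * (\<Sum>j\<in>{1..<p}. 1 / of_nat j ^ k) -
     (w * (a ^ (k - 1) - b ^ (k - 1))) * (\<Sum>j\<in>{1..<p}. (-1) ^ j / of_nat j ^ k)"
    by (simp only: sum_subtractf sum_distrib_left)
  also have "p_cong p \<dots> ((a ^ (k - 1) + b ^ (k - 1)) * 0 -
     (w * (a ^ (k - 1) - b ^ (k - 1))) * (\<Sum>j\<in>{1..<p}. (-1) ^ j / of_nat j ^ k))"
    using k ab by (intro p_cong_diff p_cong_refl p_cong_mult_left harmonic_p_cong) auto
  finally show ?thesis by (simp add: a_def b_def)
qed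

section \<open>Reflection of the non-star sums into star sums\<close>

lemma entry_fps_reflect_p_cong:
  assumes "0 < m" "m < p" "p_integral p z"
  shows "fps_p_cong p M (entry_fps z m) (entry_fps z (p - m) oo - fps_X)"
    "fps_p_cong p M (first_entry_fps z m) (first_entry_fps z (p - m) oo - fps_X)"
proof -
  have *: "p_cong p (c / of_nat m ^ l) ((-1) ^ l * (c / of_nat (p - m) ^ l))" if "p_integral p c" for c l
  proof -
    have "p_integral p (c * (-1) ^ l)" using that by auto
    from p_cong_mult_left[OF p_cong_sym[OF inverse_power_reflect_p_cong[of m l, OF assms(1,2)]] this]
    show ?thesis by (simp add: mult_ac flip: power_mult_distrib)
  qed
  have "p_integral p (height_weight z l)" for l
    using assms(3) by (auto simp: height_weight_def)
  from *[OF this] show "fps_p_cong p M (entry_fps z m) (entry_fps z (p - m) oo - fps_X)"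
    by (auto simp: fps_p_cong_def fps_compose_uminus' entry_fps_def)
  have "p_integral p (if l \<le> 1 then 0 else z)" for l :: nat
    using assms(3) by auto
  from *[OF this] show "fps_p_cong p M (first_entry_fps z m) (first_entry_fps z (p - m) oo - fps_X)"
    by (auto simp: fps_p_cong_def fps_compose_uminus' first_entry_fps_def)
qed

lemma fps_p_cong_compose_uminus:
  assumes "fps_p_cong p M F G"
  shows "fps_p_cong p M (F oo - fps_X) (G oo - fps_X)"
  unfolding fps_p_cong_def fps_compose_uminus'
proof safe
  fix n assume "n < M"
  then have "p_cong p (fps_nth F n) (fps_nth G n)" using assms by (simp add: fps_p_cong_def)
  then have "p_cong p ((-1) ^ n * fps_nth F n) ((-1) ^ n * fps_nth G n)"
    by (rule p_cong_mult_left) auto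
  then show "p_cong p (fps_nth (Abs_fps (\<lambda>n. (-1) ^ n * fps_nth F n)) n) (fps_nth (Abs_fps (\<lambda>n. (-1) ^ n * fps_nth G n)) n)"
    by simp
qed

lemma fps_p_integral_compose_uminus:
  "fps_p_integral p F \<Longrightarrow> fps_p_integral p (F oo - fps_X)"
  unfolding fps_p_integral_def fps_compose_uminus' by auto

text \<open>Modulo p, f_{n+1}(X) is f_{p-1-n}(-X). Raising n multiplies the left side by 1 minus
  this series, and so does lowering the upper bound of the star sum from p - 1 - n. The induction
  starts at P_{p-1} \<equiv> 1.\<close>

lemma signed_fps_p_cong:
  assumes w: "p_integral p w" and "n \<le> p - 1"
  shows "fps_p_cong p (p - 1) (signed_fps (w ^ 2) n) (star_fps (w ^ 2) (p - 1 - n) oo - fps_X)"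
  using assms(2)
proof (induction n)
  case 0
  have "fps_p_cong p (p - 1) (star_fps (w ^ 2) (p - 1) oo - fps_X) (1 oo - fps_X)"
    by (intro fps_p_cong_compose_uminus star_fps_p_cong_1 w)
  then show ?case by (simp add: nested_sum_fps_0 fps_p_cong_sym)
next
  case (Suc n)
  define z where "z = w ^ 2"
  have z: "p_integral p z" using w by (auto simp: z_def)
  have 1: "p - 1 - n = p - Suc n" "p - 1 - n = Suc (p - 1 - Suc n)" using Suc.prems by auto
  have "fps_p_cong p (p - 1) (signed_fps z n * (1 - entry_fps z (Suc n)))
     ((star_fps z (p - 1 - n) oo - fps_X) * (1 - (entry_fps z (p - Suc n) oo - fps_X)))"
  proof (intro fps_p_cong_mult fps_p_cong_diff fps_p_cong_refl)
    show "fps_p_cong p (p - 1) (signed_fps z n) (star_fps z (p - 1 - n) oo - fps_X)"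
      using Suc by (simp add: z_def)
    show "fps_p_cong p (p - 1) (entry_fps z (Suc n)) (entry_fps z (p - Suc n) oo - fps_X)"
      using Suc.prems z by (intro entry_fps_reflect_p_cong) auto
    show "fps_p_integral p (signed_fps z n)"
      using Suc.prems z by (intro fps_p_integral_nested_sum_fps) auto
    show "fps_p_integral p (1 - (entry_fps z (p - Suc n) oo - fps_X))"
      using Suc.prems z by (intro fps_p_integral_diff fps_p_integral_compose_uminus fps_p_integral_entry_fps) auto
  qed
  also have "(star_fps z (p - 1 - n) oo - fps_X) * (1 - (entry_fps z (p - Suc n) oo - fps_X)) =
     (star_fps z (Suc (p - 1 - Suc n)) * (1 - entry_fps z (Suc (p - 1 - Suc n)))) oo - fps_X"
    unfolding 1(1)[symmetric] unfolding 1(2) by (simp add: fps_compose_mult_distrib fps_compose_sub_distrib)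
  also have "\<dots> = star_fps z (p - 1 - Suc n) oo - fps_X"
    unfolding star_fps_Suc ..
  finally show ?case
    unfolding z_def signed_fps_Suc .
qed

text \<open>Under m -> p - m the substitution of -X for X yields (-1)^k; the remaining minus is the
  sign attached to the first entry.\<close>

lemma signed_coeff_p_cong:
  assumes w: "p_integral p w" and k: "k < p - 1"
  shows "p_cong p (fps_nth (fps_const (-1) * (\<Sum>m\<in>{1..p - 1}. first_entry_fps (w ^ 2) m * signed_fps (w ^ 2) (m - 1))) k)
     (- ((-1) ^ k * fps_nth (\<Sum>m\<in>{1..p - 1}. first_entry_fps (w ^ 2) m * star_fps (w ^ 2) m) k))"
proof -
  define z where "z = w ^ 2"
  have z: "p_integral p z" using w by (auto simp: z_def)
  have "fps_p_cong p (p - 1) (\<Sum>m\<in>{1..p - 1}. first_entry_fps z m * signed_fps z (m - 1))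
     (\<Sum>m\<in>{1..p - 1}. (first_entry_fps z (p - m) oo - fps_X) * (star_fps z (p - m) oo - fps_X))"
  proof (intro fps_p_cong_sum fps_p_cong_mult)
    fix m assume m: "m \<in> {1..p - 1}"
    show "fps_p_cong p (p - 1) (first_entry_fps z m) (first_entry_fps z (p - m) oo - fps_X)"
      using m z by (intro entry_fps_reflect_p_cong) auto
    show "fps_p_integral p (first_entry_fps z m)"
      using m z by (intro fps_p_integral_entry_fps) auto
    show "fps_p_integral p (star_fps z (p - m) oo - fps_X)"
      using m z by (intro fps_p_integral_compose_uminus fps_p_integral_nested_sum_fps) auto
    \<comment> \<open>The strict bound m - 1 reflects to p - m itself, so the reflected sums are
      star sums.\<close>
    have "p - 1 - (m - 1) = p - m" using m by auto
    then show "fps_p_cong p (p - 1) (signed_fps z (m - 1)) (star_fps z (p - m) oo - fps_X)"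
      using signed_fps_p_cong[OF w, of "m - 1"] m by (auto simp: z_def)
  qed
  also have "(\<Sum>m\<in>{1..p - 1}. (first_entry_fps z (p - m) oo - fps_X) * (star_fps z (p - m) oo - fps_X)) =
     (\<Sum>m\<in>{1..p - 1}. (first_entry_fps z m * star_fps z m) oo - fps_X)"
    by (rule sum.reindex_bij_witness[of _ "\<lambda>m. p - m" "\<lambda>m. p - m"])
       (auto simp: fps_compose_mult_distrib)
  also have "\<dots> = (\<Sum>m\<in>{1..p - 1}. first_entry_fps z m * star_fps z m) oo - fps_X"
    by (rule fps_compose_sum_distrib[symmetric])
  finally have "p_cong p (fps_nth (\<Sum>m\<in>{1..p - 1}. first_entry_fps z m * signed_fps z (m - 1)) k)
     ((-1) ^ k * fps_nth (\<Sum>m\<in>{1..p - 1}. first_entry_fps z m * star_fps z m) k)"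
    using k unfolding fps_p_cong_def fps_compose_uminus' by simp
  then show ?thesis
    unfolding z_def[symmetric] fps_mult_left_const_nth using p_cong_uminus by simp
qed

end

section \<open>The coefficients\<close>

text \<open>Only odd exponents i = 2s - 1 survive in the difference, and the extra factor w makes
  the power w^(2s). With n = k - 1 the range is 1, ..., k; binomial coefficients with 2s - 1 > n are
  0.\<close>

lemma odd_binomial_sum:
  fixes w :: rat
  shows "w * ((1 + w) ^ n - (1 - w) ^ n) = (\<Sum>s\<in>{1..Suc n}. (w ^ 2) ^ s * (2 * of_nat (n choose (2 * s - 1))))"
proof -
  define g where "g = (\<lambda>i. of_nat (n choose i) * (w * (w ^ i - (- w) ^ i)))"
  have "(1 + w) ^ n - (1 - w) ^ n = (w + 1) ^ n - (- w + 1) ^ n"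
    by (simp add: add.commute)
  also have "\<dots> = (\<Sum>i\<le>n. of_nat (n choose i) * (w ^ i - (- w) ^ i))"
    unfolding binomial_ring by (simp add: sum_subtractf algebra_simps)
  finally have "w * ((1 + w) ^ n - (1 - w) ^ n) = (\<Sum>i\<le>n. g i)"
    by (simp add: g_def sum_distrib_left mult_ac)
  also have "\<dots> = (\<Sum>i\<in>(\<lambda>s. 2 * s - 1) ` {1..Suc n}. g i)"
  proof (rule sum.mono_neutral_cong)
    fix i assume i: "i \<in> {..n} - (\<lambda>s. 2 * s - 1) ` {1..Suc n}"
    have "even i"
    proof (rule ccontr)
      assume "odd i"
      then obtain t where t: "i = 2 * t + 1" by (elim oddE)
      then have "i = 2 * Suc t - 1" "Suc t \<in> {1..Suc n}" using i by auto
      then show False using i by blast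
    qed
    then show "g i = 0" by (simp add: g_def)
  next
    fix i assume "i \<in> (\<lambda>s. 2 * s - 1) ` {1..Suc n} - {..n}"
    then show "g i = 0" by (simp add: g_def binomial_eq_0)
  qed auto
  also have "\<dots> = (\<Sum>s\<in>{1..Suc n}. g (2 * s - 1))"
    by (rule sum.reindex_cong[of "\<lambda>s. 2 * s - 1"]) (auto simp: inj_on_def)
  also have "\<dots> = (\<Sum>s\<in>{1..Suc n}. (w ^ 2) ^ s * (2 * of_nat (n choose (2 * s - 1))))"
  proof (intro sum.cong refl)
    fix s assume "s \<in> {1..Suc n}"
    then obtain t where "s = Suc t" by (cases s) auto
    then show "g (2 * s - 1) = (w ^ 2) ^ s * (2 * of_nat (n choose (2 * s - 1)))"
      by (simp add: g_def power_mult[symmetric]) (simp add: power2_eq_square)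
  qed
  finally show ?thesis .
qed

section \<open>Separating the heights\<close>

context prime_nat
begin

text \<open>Orthogonality of the power functions on nonzero residues: the sum of w^e vanishes modulo
  p unless p - 1 divides e, and |2s' - 2s| < p - 1 leaves only e = 0, where the sum is p -
  1.\<close>

lemma power_quotient_sum_p_cong:
  assumes "2 * k < p - 1" "s \<le> k" "s' \<le> k"
  shows "p_cong p (\<Sum>w\<in>{1..<p}. 1 / of_nat w ^ (2 * s) * of_nat w ^ (2 * s')) (if s' = s then -1 else 0)"
proof (cases s' s rule: linorder_cases)
  case equal
  then have "(\<Sum>w\<in>{1..<p}. 1 / of_nat w ^ (2 * s) * of_nat w ^ (2 * s')) = (\<Sum>w\<in>{1..<p}. 1 :: rat)"
    by (intro sum.cong) auto
  also have "\<dots> = of_nat p - 1"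
    using prime_gt_0_nat[OF prime] by (simp add: of_nat_diff)
  also have "p_cong p \<dots> (0 - 1)"
    by (intro p_cong_diff p_cong_refl) (use p_cong_mult_p[OF p_integral_1] in simp)
  finally show ?thesis using equal by simp
next
  case less
  have "(\<Sum>w\<in>{1..<p}. 1 / of_nat w ^ (2 * s) * of_nat w ^ (2 * s')) = (\<Sum>w\<in>{1..<p}. 1 / rat_of_nat w ^ (2 * s - 2 * s'))"
  proof (intro sum.cong refl)
    fix w assume "w \<in> {1..<p}"
    then have "rat_of_nat w \<noteq> 0" by simp
    then show "1 / of_nat w ^ (2 * s) * of_nat w ^ (2 * s') = 1 / rat_of_nat w ^ (2 * s - 2 * s')"
      using less power_add[of "rat_of_nat w" "2 * s - 2 * s'" "2 * s'"] by simp
  qed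
  also have "p_cong p \<dots> 0"
    using less assms by (intro harmonic_p_cong) auto
  finally show ?thesis using less by simp
next
  case greater
  have "(\<Sum>w\<in>{1..<p}. 1 / of_nat w ^ (2 * s) * of_nat w ^ (2 * s')) = (\<Sum>w\<in>{1..<p}. rat_of_nat w ^ (2 * s' - 2 * s))"
  proof (intro sum.cong refl)
    fix w assume "w \<in> {1..<p}"
    then have "rat_of_nat w \<noteq> 0" by simp
    then show "1 / of_nat w ^ (2 * s) * of_nat w ^ (2 * s') = rat_of_nat w ^ (2 * s' - 2 * s)"
      using greater power_add[of "rat_of_nat w" "2 * s' - 2 * s" "2 * s"] by simp
  qed
  also have "\<dots> = (\<Sum>w<p. of_nat w ^ (2 * s' - 2 * s))"
    unfolding lessThan_p using greater by (subst sum.insert) auto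
  also have "p_cong p \<dots> 0"
    using assms by (intro power_sum_p_cong) auto
  finally show ?thesis using greater by simp
qed

text \<open>Summing the values of the polynomial against w^(-2s) over all nonzero residues isolates
  \<open>- D s\<close>.\<close>

lemma even_polynomial_coeff_p_cong:
  assumes "2 * k < p - 1" and D: "\<And>s. s \<in> {1..k} \<Longrightarrow> p_integral p (D s)"
    and zero: "\<And>w. w \<in> {1..<p} \<Longrightarrow> p_cong p (\<Sum>s\<in>{1..k}. (of_nat w ^ 2) ^ s * D s) 0"
    and s: "s \<in> {1..k}"
  shows "p_cong p (D s) 0"
proof -
  have "p_cong p (\<Sum>w\<in>{1..<p}. 1 / of_nat w ^ (2 * s) * (\<Sum>s'\<in>{1..k}. (of_nat w ^ 2) ^ s' * D s'))
     (\<Sum>w\<in>{1..<p}. 1 / of_nat w ^ (2 * s) * 0)"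
    by (intro p_cong_sum p_cong_mult_left zero p_integral_divide_power) auto
  also have "(\<Sum>w\<in>{1..<p}. 1 / of_nat w ^ (2 * s) * (\<Sum>s'\<in>{1..k}. (of_nat w ^ 2) ^ s' * D s')) =
    (\<Sum>w\<in>{1..<p}. \<Sum>s'\<in>{1..k}. D s' * (1 / of_nat w ^ (2 * s) * of_nat w ^ (2 * s')))"
    unfolding sum_distrib_left power_mult[symmetric] by (intro sum.cong refl) (simp only: mult_ac)
  also have "\<dots> = (\<Sum>s'\<in>{1..k}. D s' * (\<Sum>w\<in>{1..<p}. 1 / of_nat w ^ (2 * s) * of_nat w ^ (2 * s')))"
    unfolding sum_distrib_left by (rule sum.swap)
  finally have 1: "p_cong p (\<Sum>s'\<in>{1..k}. D s' * (\<Sum>w\<in>{1..<p}. 1 / of_nat w ^ (2 * s) * of_nat w ^ (2 * s'))) 0"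
    by simp
  have 2: "p_cong p (\<Sum>s'\<in>{1..k}. D s' * (\<Sum>w\<in>{1..<p}. 1 / of_nat w ^ (2 * s) * of_nat w ^ (2 * s')))
     (\<Sum>s'\<in>{1..k}. D s' * (if s' = s then -1 else 0))"
    using assms(1) s by (intro p_cong_sum p_cong_mult_left power_quotient_sum_p_cong[of k] D) auto
  have 3: "(\<Sum>s'\<in>{1..k}. D s' * (if s' = s then -1 else 0)) = - D s"
    using s by (simp add: if_distrib[of "\<lambda>x. _ * x"] cong: if_cong)
  have "p_cong p (- D s) 0"
    using p_cong_trans[OF p_cong_sym[OF 2] 1] unfolding 3 .
  then show ?thesis using p_cong_uminus[of "- D s" 0] by simp
qed

lemma p_integral_one_minus_power2:
  assumes "odd p"
  shows "p_integral p (1 - 1 / 2 ^ n)"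
proof -
  have "\<not> p dvd 2" using assms by (metis dvd_refl prime primes_dvd_imp_eq two_is_prime_nat)
  then have "\<not> p dvd 2 ^ n" by (rule not_dvd_power)
  from p_integral_inverse[OF this] show ?thesis by auto
qed

lemma p_integral_scaled_bernoulli:
  assumes "odd p" "2 \<le> k" "k < p - 1"
  shows "p_integral p ((1 - 1 / 2 ^ (k - 1)) * (bernoulli (p - k) / of_nat k))"
  using assms
  by (intro p_integral_mult p_integral_divide p_integral_bernoulli p_integral_one_minus_power2 not_dvd_less) auto

lemma star_coeff_bernoulli_p_cong:
  fixes w :: rat
  assumes "odd p" and w: "p_integral p w" and k: "2 \<le> k" "k < p - 1"
  shows "p_cong p (fps_nth (\<Sum>m\<in>{1..p - 1}. first_entry_fps (w ^ 2) m * star_fps (w ^ 2) m) k)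
     (w * ((1 + w) ^ (k - 1) - (1 - w) ^ (k - 1)) * ((1 - 1 / 2 ^ (k - 1)) * (bernoulli (p - k) / of_nat k)))"
proof -
  define c where "c = w * ((1 + w) ^ (k - 1) - (1 - w) ^ (k - 1))"
  have c: "p_integral p c" 
    unfolding c_def by (intro p_integral_mult p_integral_diff p_integral_power p_integral_add p_integral_1 w)
  have "\<not> p dvd 2" using assms by (metis dvd_refl prime primes_dvd_imp_eq two_is_prime_nat)
  have "p_cong p (2 * fps_nth (\<Sum>m\<in>{1..p - 1}. first_entry_fps (w ^ 2) m * star_fps (w ^ 2) m) k)
     (- c * (\<Sum>j\<in>{1..<p}. (-1) ^ j / of_nat j ^ k))"
    unfolding c_def using k by (intro star_coeff_p_cong assms) auto
  also have "p_cong p \<dots> (- c * (- 2 * (1 - 1 / 2 ^ (k - 1)) * bernoulli (p - k) / of_nat k))"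
    using c k by (intro p_cong_mult_left alternating_harmonic_p_cong assms) auto
  finally have "p_cong p (2 * fps_nth (\<Sum>m\<in>{1..p - 1}. first_entry_fps (w ^ 2) m * star_fps (w ^ 2) m) k)
     (- c * (- 2 * (1 - 1 / 2 ^ (k - 1)) * bernoulli (p - k) / of_nat k))" .
  moreover have "- c * (- 2 * x * y / z) = 2 * (c * (x * (y / z)))" for x y z :: rat
    by simp
  ultimately have "p_cong p (of_nat 2 * fps_nth (\<Sum>m\<in>{1..p - 1}. first_entry_fps (w ^ 2) m * star_fps (w ^ 2) m) k)
     (of_nat 2 * (c * ((1 - 1 / 2 ^ (k - 1)) * (bernoulli (p - k) / of_nat k))))"
    by (simp only: of_nat_numeral)
  then show ?thesis
    unfolding c_def[symmetric] using \<open>\<not> p dvd 2\<close> by (rule p_cong_cancel)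
qed

text \<open>For even \<open>k\<close> the Bernoulli factor vanishes, so the sign \<open>(-1) ^ k\<close> of the reflection
  only matters for odd \<open>k\<close>, where it cancels.\<close>

lemma signed_coeff_bernoulli_p_cong:
  fixes w :: rat
  assumes "odd p" and w: "p_integral p w" and k: "2 \<le> k" "k < p - 1"
  shows "p_cong p (fps_nth (fps_const (-1) * (\<Sum>m\<in>{1..p - 1}. first_entry_fps (w ^ 2) m * signed_fps (w ^ 2) (m - 1))) k)
     (w * ((1 + w) ^ (k - 1) - (1 - w) ^ (k - 1)) * ((1 - 1 / 2 ^ (k - 1)) * (bernoulli (p - k) / of_nat k)))"
    (is "p_cong p ?L (?c * ?\<beta>)")
proof -
  let ?E = "fps_nth (\<Sum>m\<in>{1..p - 1}. first_entry_fps (w ^ 2) m * star_fps (w ^ 2) m) k"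
  have 1: "p_cong p ?L (- ((-1) ^ k * ?E))"
    using k by (intro signed_coeff_p_cong w)
  have 2: "p_cong p (- ((-1) ^ k * ?E)) (- ((-1) ^ k * (?c * ?\<beta>)))"
    by (intro p_cong_uminus p_cong_mult_left star_coeff_bernoulli_p_cong assms p_integral_power) auto
  have 3: "p_cong p (- ((-1) ^ k * (?c * ?\<beta>))) (?c * ?\<beta>)"
  proof (cases "even k")
    case True
    have "\<not> p dvd 2" using assms by (metis dvd_refl prime primes_dvd_imp_eq two_is_prime_nat)
    have "p_cong p (- 2 * (1 - 1 / 2 ^ (k - 1)) * bernoulli (p - k) / of_nat k) (\<Sum>j\<in>{1..<p}. (-1) ^ j / of_nat j ^ k)"
      using alternating_harmonic_p_cong[OF assms(1) k] by (rule p_cong_sym)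
    also have "p_cong p \<dots> 0"
      using assms(1) True by (rule alternating_harmonic_even_p_cong)
    finally have "p_cong p (- 2 * (1 - 1 / 2 ^ (k - 1)) * bernoulli (p - k) / of_nat k) 0" .
    moreover have "- 2 * x * y / z = of_nat 2 * - (x * (y / z))" for x y z :: rat
      by simp
    ultimately have "p_cong p (of_nat 2 * - ?\<beta>) (of_nat 2 * 0)" by (simp only: mult_zero_right)
    then have "p_cong p (- ?\<beta>) 0" using \<open>\<not> p dvd 2\<close> by (rule p_cong_cancel)
    then have *: "p_cong p ?\<beta> 0" using p_cong_uminus[of "- ?\<beta>" 0] by simp
    have "p_integral p ?c"
      by (intro p_integral_mult p_integral_diff p_integral_power p_integral_add p_integral_1 w)
    from p_cong_mult_left[OF * this] have 4: "p_cong p (?c * ?\<beta>) 0"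
      by (simp only: mult_zero_right)
    from p_cong_uminus[OF this] have "p_cong p (- (?c * ?\<beta>)) 0"
      by (simp only: minus_zero)
    moreover have "(-1) ^ k = (1 :: rat)" using True by simp
    ultimately show ?thesis
      using p_cong_trans[OF _ p_cong_sym[OF 4]] by (simp only: mult_1)
  qed simp
  show ?thesis
    by (rule p_cong_trans[OF 1 p_cong_trans[OF 2 3]])
qed

text \<open>Both sides of \<open>coeff\<close> are polynomials in w^2 whose coefficients are indexed
  by the height, the right one by \<open>odd_binomial_sum\<close>. \<open>D\<close> is the
  difference of these coefficients; \<open>\<beta>\<close> is the same for all w and all
  heights.\<close>

lemma sum_I0_p_cong:
  assumes h: "\<And>m. h m \<le> m" "p_integral p c" and k: "0 < k" "2 * k < p - 1" and s: "s \<in> {1..k}"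
    and \<beta>: "p_integral p \<beta>"
    and coeff: "\<And>w :: nat. p_cong p (fps_nth (fps_const c * (\<Sum>m\<in>{1..p - 1}. first_entry_fps (of_nat w ^ 2) m * nested_sum_fps h c (of_nat w ^ 2) (h m))) k)
       (of_nat w * ((1 + of_nat w) ^ (k - 1) - (1 - of_nat w) ^ (k - 1)) * \<beta>)"
  shows "p_cong p (\<Sum>ks\<in>I\<^sub>0 k s. nested_sum h c (p - 1) ks) (2 * of_nat ((k - 1) choose (2 * s - 1)) * \<beta>)"
proof -
  define D where "D = (\<lambda>s. (\<Sum>ks\<in>I\<^sub>0 k s. nested_sum h c (p - 1) ks) - 2 * of_nat ((k - 1) choose (2 * s - 1)) * \<beta>)"
  have "p_cong p (D s) 0"
  proof (rule even_polynomial_coeff_p_cong)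
    fix s
    show "p_integral p (D s)"
      unfolding D_def using h \<beta> prime_gt_0_nat[OF prime]
      by (intro p_integral_diff p_integral_sum p_integral_mult p_integral_nested_sum) auto
  next
    fix w
    have "(\<Sum>s\<in>{1..k}. (of_nat w ^ 2) ^ s * D s) =
      (\<Sum>s\<in>{1..k}. (of_nat w ^ 2) ^ s * (\<Sum>ks\<in>I\<^sub>0 k s. nested_sum h c (p - 1) ks)) -
      (\<Sum>s\<in>{1..k}. (of_nat w ^ 2) ^ s * (2 * of_nat ((k - 1) choose (2 * s - 1)))) * \<beta>"
      unfolding D_def sum_distrib_right sum_subtractf[symmetric] by (intro sum.cong refl) (simp add: algebra_simps)
    also have "(\<Sum>s\<in>{1..k}. (of_nat w ^ 2) ^ s * (2 * of_nat ((k - 1) choose (2 * s - 1)))) =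
       of_nat w * ((1 + of_nat w) ^ (k - 1) - (1 - of_nat w) ^ (k - 1) :: rat)"
      using odd_binomial_sum[of "of_nat w" "k - 1"] k by simp
    also have "p_cong p ((\<Sum>s\<in>{1..k}. (of_nat w ^ 2) ^ s * (\<Sum>ks\<in>I\<^sub>0 k s. nested_sum h c (p - 1) ks)) -
        of_nat w * ((1 + of_nat w) ^ (k - 1) - (1 - of_nat w) ^ (k - 1)) * \<beta>) 0"
      unfolding sum_I0_nested_sum[OF k(1)] using coeff[of w] by (simp only: p_cong_iff_diff[symmetric])
    finally show "p_cong p (\<Sum>s\<in>{1..k}. (of_nat w ^ 2) ^ s * D s) 0" .
  qed (use k s in auto)
  then show ?thesis
    by (simp only: D_def p_cong_iff_diff[symmetric])
qed

text \<open>The bound 2k + 1 < p is the one under which the heights separate; it also gives that p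
  is odd and k < p - 1.\<close>

lemma sum_zeta_p_cong:
  assumes k: "2 \<le> k" "2 * k + 1 < p" and s: "s \<in> {1..k}"
  defines "\<beta> \<equiv> (1 - 1 / 2 ^ (k - 1)) * (bernoulli (p - k) / of_nat k)"
  shows "p_cong p (\<Sum>ks\<in>I\<^sub>0 k s. zeta_star_sum ks p) (2 * of_nat ((k - 1) choose (2 * s - 1)) * \<beta>)"
    and "p_cong p (\<Sum>ks\<in>I\<^sub>0 k s. (-1) ^ length ks * zeta_sum ks p) (2 * of_nat ((k - 1) choose (2 * s - 1)) * \<beta>)"
proof -
  have odd: "odd p" using prime_odd_nat[OF prime] k by auto
  have p: "p > 0" using k by simp
  have \<beta>: "p_integral p \<beta>"
    unfolding \<beta>_def using k by (intro p_integral_scaled_bernoulli odd) auto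
  show "p_cong p (\<Sum>ks\<in>I\<^sub>0 k s. zeta_star_sum ks p) (2 * of_nat ((k - 1) choose (2 * s - 1)) * \<beta>)"
    unfolding zeta_star_sum_eq_nested_sum[OF p]
  proof (rule sum_I0_p_cong)
    fix w :: nat
    show "p_cong p (fps_nth (fps_const 1 * (\<Sum>m\<in>{1..p - 1}. first_entry_fps (of_nat w ^ 2) m * star_fps (of_nat w ^ 2) m)) k)
       (of_nat w * ((1 + of_nat w) ^ (k - 1) - (1 - of_nat w) ^ (k - 1)) * \<beta>)"
      unfolding \<beta>_def fps_const_1_eq_1 mult_1 using k by (intro star_coeff_bernoulli_p_cong odd) auto
  qed (use k s \<beta> in auto)
  show "p_cong p (\<Sum>ks\<in>I\<^sub>0 k s. (-1) ^ length ks * zeta_sum ks p) (2 * of_nat ((k - 1) choose (2 * s - 1)) * \<beta>)"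
    unfolding zeta_sum_eq_nested_sum[OF p]
  proof (rule sum_I0_p_cong)
    fix w :: nat
    show "p_cong p (fps_nth (fps_const (-1) * (\<Sum>m\<in>{1..p - 1}. first_entry_fps (of_nat w ^ 2) m * signed_fps (of_nat w ^ 2) (m - 1))) k)
       (of_nat w * ((1 + of_nat w) ^ (k - 1) - (1 - of_nat w) ^ (k - 1)) * \<beta>)"
      unfolding \<beta>_def using k by (intro signed_coeff_bernoulli_p_cong odd) auto
  qed (use k s \<beta> in auto)
qed

lemma p_integral_zeta_star_sum: "p_integral p (zeta_star_sum ks p)"
  unfolding zeta_star_sum_eq_nested_sum[OF prime_gt_0_nat[OF prime]]
  using prime_gt_0_nat[OF prime] by (intro p_integral_nested_sum) auto

lemma p_integral_signed_zeta_sum: "p_integral p ((-1) ^ length ks * zeta_sum ks p)"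
  unfolding zeta_sum_eq_nested_sum[OF prime_gt_0_nat[OF prime]]
  using prime_gt_0_nat[OF prime] by (intro p_integral_nested_sum) auto

lemma p_integral_zeta_sum: "p_integral p (zeta_sum ks p)"
proof -
  have "p_integral p ((-1) ^ length ks * ((-1) ^ length ks * zeta_sum ks p))"
    by (intro p_integral_mult[OF _ p_integral_signed_zeta_sum] p_integral_power p_integral_uminus p_integral_1)
  moreover have "(-1) ^ length ks * ((-1) ^ length ks * x) = x" for x :: rat
    by (cases "even (length ks)") auto
  ultimately show ?thesis by (simp only:)
qed

end

text \<open>In these cases the binomial coefficient of the theorem is 0 as well. For k = 1 the
  meaningless \<open>Z_A 1\<close> is thus multiplied by 0; splitting off k < s leaves heights
  between 1 and k.\<close>

lemma I0_eq_empty: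
  assumes "k = 1 \<or> k < s"
  shows "I\<^sub>0 k s = {}"
proof -
  have False if "ks \<in> I\<^sub>0 k s" for ks
  proof (cases ks)
    case (Cons l ks')
    then show False using that assms height_le_sum_list[of ks] by (auto simp: I\<^sub>0_def)
  qed (use that in \<open>auto simp: I\<^sub>0_def\<close>)
  then show ?thesis by blast
qed

theorem mainTheorem1:
  fixes k s :: nat
  assumes "k > 0" and "s > 0"
  shows "(\<Sum>ks\<in>I\<^sub>0 k s. zeta_star_A ks) =
           2 * of_nat ((k - 1) choose (2 * s - 1)) * of_rat_A (1 - 2 powi (1 - int k)) * Z_A k
    \<and> (\<Sum>ks\<in>I\<^sub>0 k s. (-1) ^ length ks * zeta_A ks) =
           2 * of_nat ((k - 1) choose (2 * s - 1)) * of_rat_A (1 - 2 powi (1 - int k)) * Z_A k"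
proof (cases "k = 1 \<or> k < s")
  case True
  then have "(k - 1) choose (2 * s - 1) = 0"
    using assms by (intro binomial_eq_0) auto
  then show ?thesis
    unfolding I0_eq_empty[OF True] by (simp only: sum.empty of_nat_0 mult_zero_right mult_zero_left)
next
  case False
  then have k: "2 \<le> k" and s: "s \<in> {1..k}" using assms by auto
  \<comment> \<open>Beyond this bound all congruences for weight k hold and every prime is
    odd.\<close>
  define M where "M = 2 * k + 1"
  define n where "n = (k - 1) choose (2 * s - 1)"
  define r :: rat where "r = 1 - 2 powi (1 - int k)"
  define R where "R = (\<lambda>p. of_nat (2 * n) * (r * (bernoulli (p - k) / of_nat k)))"
  have r: "r = 1 - 1 / 2 ^ (k - 1)"
  proof -
    have "1 - int k = - int (k - 1)" using assms(1) by simp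
    then show ?thesis
      unfolding r_def by (simp only: power_int_minus power_int_of_nat inverse_eq_divide)
  qed
  have odd: "odd p" if "prime p" "p > M" for p
    using prime_odd_nat[OF that(1)] that(2) k by (simp add: M_def)
  have rZ: "p_integral p r \<and> p_integral p (bernoulli (p - k) / of_nat k)" if "prime p" "p > M" for p
  proof -
    interpret prime_nat p by unfold_locales fact
    show ?thesis unfolding r using that k odd[OF that]
      by (intro conjI p_integral_one_minus_power2 p_integral_divide p_integral_bernoulli not_dvd_less) (auto simp: M_def)
  qed
  have R_int: "p_integral p (R p)" if "prime p" "p > M" for p
  proof -
    interpret prime_nat p by unfold_locales fact
    show ?thesis
      unfolding R_def using rZ[OF that] by (intro p_integral_mult p_integral_of_nat) blast+
  qed
  have rhs: "2 * of_nat n * of_rat_A r * Z_A k = of_rat_family R"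
  proof -
    have "of_rat_A r * Z_A k = of_rat_family (\<lambda>p. r * (bernoulli (p - k) / of_nat k))"
      unfolding of_rat_A_def Z_A_def by (rule of_rat_family_mult[of M]) (rule rZ)
    moreover have "of_rat_family (\<lambda>p. of_nat (2 * n)) * of_rat_family (\<lambda>p. r * (bernoulli (p - k) / of_nat k)) = of_rat_family R"
      unfolding R_def
    proof (rule of_rat_family_mult[of M])
      fix p assume p: "prime p" "p > M"
      interpret prime_nat p by unfold_locales fact
      show "p_integral p (of_nat (2 * n)) \<and> p_integral p (r * (bernoulli (p - k) / of_nat k))"
        using rZ[OF p] by blast
    qed
    ultimately show ?thesis
      unfolding of_rat_family_of_nat by (simp add: mult.assoc)
  qed
  have "(\<Sum>ks\<in>I\<^sub>0 k s. zeta_star_A ks) = of_rat_family (\<lambda>p. \<Sum>ks\<in>I\<^sub>0 k s. zeta_star_sum ks p)"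
    unfolding zeta_star_A_def
    by (rule of_rat_family_sum[OF finite_I\<^sub>0, of _ _ M]) (rule prime_nat.p_integral_zeta_star_sum[OF prime_nat.intro])
  also have "\<dots> = of_rat_family R"
  proof (rule of_rat_family_cong[of M])
    fix p assume p: "prime p" "p > M"
    interpret prime_nat p by unfold_locales fact
    have "p_cong p (\<Sum>ks\<in>I\<^sub>0 k s. zeta_star_sum ks p) (R p)"
      using sum_zeta_p_cong(1)[OF k _ s] p(2) by (simp add: R_def n_def r M_def mult.assoc)
    then show "p_integral p (\<Sum>ks\<in>I\<^sub>0 k s. zeta_star_sum ks p) \<and> p_integral p (R p) \<and>
        p_cong p (\<Sum>ks\<in>I\<^sub>0 k s. zeta_star_sum ks p) (R p)"
      using R_int[OF p] p_integral_zeta_star_sum by auto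
  qed
  finally have 1: "(\<Sum>ks\<in>I\<^sub>0 k s. zeta_star_A ks) = of_rat_family R" .
  have "(-1) ^ length ks * zeta_A ks = of_rat_family (\<lambda>p. (-1) ^ length ks * zeta_sum ks p)" for ks
    unfolding zeta_A_def of_rat_family_minus_1_power[symmetric]
  proof (rule of_rat_family_mult[of M])
    fix p assume p: "prime p" "p > M"
    interpret prime_nat p by unfold_locales fact
    show "p_integral p ((-1) ^ length ks) \<and> p_integral p (zeta_sum ks p)"
      using p_integral_zeta_sum by auto
  qed
  then have "(\<Sum>ks\<in>I\<^sub>0 k s. (-1) ^ length ks * zeta_A ks) = of_rat_family (\<lambda>p. \<Sum>ks\<in>I\<^sub>0 k s. (-1) ^ length ks * zeta_sum ks p)"
    by (simp only:) (rule of_rat_family_sum[OF finite_I\<^sub>0, of _ _ M], rule prime_nat.p_integral_signed_zeta_sum[OF prime_nat.intro])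
  also have "\<dots> = of_rat_family R"
  proof (rule of_rat_family_cong[of M])
    fix p assume p: "prime p" "p > M"
    interpret prime_nat p by unfold_locales fact
    have "p_cong p (\<Sum>ks\<in>I\<^sub>0 k s. (-1) ^ length ks * zeta_sum ks p) (R p)"
      using sum_zeta_p_cong(2)[OF k _ s] p(2) by (simp add: R_def n_def r M_def mult.assoc)
    then show "p_integral p (\<Sum>ks\<in>I\<^sub>0 k s. (-1) ^ length ks * zeta_sum ks p) \<and> p_integral p (R p) \<and>
        p_cong p (\<Sum>ks\<in>I\<^sub>0 k s. (-1) ^ length ks * zeta_sum ks p) (R p)"
      using R_int[OF p] p_integral_signed_zeta_sum by auto
  qed
  finally show ?thesis
    unfolding 1 n_def[symmetric] r_def[symmetric] rhs by simp
qed

end
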